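(* Every finite Abelian group of odd order possesses a natural cover, i.e. $\widetilde{\mathcal K}(G,2)$ is a cover of $G$ whenever $G$ is a finite Abelian group of odd order. More precisely, let $G^\ast$ be an arbitrary cover of an Abelian group $G$ of odd order and let $M$ be the kernel of $G^\ast\to G$. Then the natural cover of $G$ is obtained as a subquotient of $(G^\ast)^2$ via $$\widetilde{\mathcal K}(G,2)\;\cong\;\langle (g,g^{-1}),\,(m,1)\mid g\in G^\ast,\ m\in M\rangle\,/\,\langle (m,m^{-1})\mid m\in M\rangle .$$
   Context: For a group $G$ and $n\geq 2$, let $G^{\rm ab}=G/[G,G]$ and let $\mathcal K(G,n)$ be the kernel of the homomorphism $G^n\to G^{\rm ab}$, $(g_1,\dots,g_n)\mapsto\overline{g_1\cdots g_n}$. Choose a presentation $G\cong F/N$ with $F$ a free group and $N$ a normal subgroup of $F$. Let $\langle\langle\mathcal K(N,n)\rangle\rangle$ be the normal closure of $\mathcal K(N,n)$ in $F^n$ (it is contained in $\mathcal K(F,n)$), and define $\widetilde{\mathcal K}(G,n):=\mathcal K(F,n)/\langle\langle\mathcal K(N,n)\rangle\rangle$. Up to isomorphism this does not depend on the choice of presentation. A cover of a finite group $G$ is a group $G^\ast$ together with a central short exact sequence $0\to M\to G^\ast\to G\to 1$ such that $M\leq[G^\ast,G^\ast]$ and $M$ is isomorphic to the Schur multiplier $H^2(G,\mathbb C^\ast)$ of $G$ (trivial action), which for finite $G$ is (non-canonically) isomorphic to $H_2(G,\mathbb Z)$. There is a central short exact sequence $0\to H_2(G,\mathbb Z)\to\widetilde{\mathcal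 K}(G,n)\to\mathcal K(G,n)\to 1$: identifying $H_2(G,\mathbb Z)$ with $(N\cap[F,F])/[F,N]$ by Hopf's formula, the first map is $x\mapsto(x,1,\dots,1)$, and the second is induced by $F^n\to G^n$. If $G$ is Abelian and $n=2$, then $\mathcal K(G,2)=\{(g,g^{-1})\}\cong G$ and the sequence reads $0\to H_2(G,\mathbb Z)\to\widetilde{\mathcal K}(G,2)\to G\to 1$. An Abelian group $G$ is said to have a natural cover if $\widetilde{\mathcal K}(G,2)$ is a cover of $G$ (via this sequence); in that case $\widetilde{\mathcal K}(G,2)$ is called the natural cover of $G$. *)

theory Defs
  imports Complex_Main "HOL-Algebra.Generated_Groups" "HOL-Algebra.Product_Groups"
begin

section \<open>Free groups and presentations\<close>

text \<open>A letter \<^term>\<open>(x, True)\<close> stands for \<open>x\<close>, a letter \<^term>\<open>(x, False)\<close> for the inverse of \<open>x\<close>.\<close>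

definition letter_val :: "('a, 'm) monoid_scheme \<Rightarrow> 'a \<times> bool \<Rightarrow> 'a" where
  "letter_val F l = (if snd l then fst l else inv\<^bsub>F\<^esub> (fst l))"

definition word_val :: "('a, 'm) monoid_scheme \<Rightarrow> ('a \<times> bool) list \<Rightarrow> 'a" where
  "word_val F w = foldr (\<lambda>l g. letter_val F l \<otimes>\<^bsub>F\<^esub> g) w \<one>\<^bsub>F\<^esub>"

definition reduced :: "('a \<times> bool) list \<Rightarrow> bool" where
  "reduced w \<longleftrightarrow> successively (\<lambda>k l. fst k = fst l \<longrightarrow> snd k = snd l) w"

definition reduced_words :: "'a set \<Rightarrow> ('a \<times> bool) list set" where
  "reduced_words X = {w \<in> lists (X \<times> UNIV). reduced w}"

text \<open>\<open>X\<close> is a free basis of \<open>F\<close>: every element of \<open>F\<close> is the value of exactly one reduced word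
  in \<open>X\<close>; \<open>X\<close> may be infinite.\<close>

definition free_basis :: "('a, 'm) monoid_scheme \<Rightarrow> 'a set \<Rightarrow> bool" where
  "free_basis F X \<longleftrightarrow> X \<subseteq> carrier F \<and> bij_betw (word_val F) (reduced_words X) (carrier F)"

definition free_group :: "('a, 'm) monoid_scheme \<Rightarrow> bool" where
  "free_group F \<longleftrightarrow> group F \<and> (\<exists>X. free_basis F X)"

text \<open>A presentation of \<open>G\<close> as \<open>F/N\<close> is given by an epimorphism \<open>\<pi>\<close> from the free group \<open>F\<close>
  onto \<open>G\<close>, with \<open>N\<close> the kernel of \<open>\<pi>\<close>.\<close>

definition presentation ::
    "('f, 'm) monoid_scheme \<Rightarrow> ('f \<Rightarrow> 'g) \<Rightarrow> ('g, 'n) monoid_scheme \<Rightarrow> bool" where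
  "presentation F \<pi> G \<longleftrightarrow> free_group F \<and> \<pi> \<in> epi F G"


section \<open>The groups \<open>\<K>(G,2)\<close> and their covering analogues\<close>

definition normal_closure :: "('a, 'm) monoid_scheme \<Rightarrow> 'a set \<Rightarrow> 'a set" where
  "normal_closure G S = \<Inter> {H. H \<lhd> G \<and> S \<subseteq> H}"

definition abelianization :: "('a, 'm) monoid_scheme \<Rightarrow> 'a set monoid" where
  "abelianization G = G Mod (derived G (carrier G))"

definition K2 :: "('a, 'm) monoid_scheme \<Rightarrow> ('a \<times> 'a) set" where
  "K2 G = kernel (G \<times>\<times> G) (abelianization G)
            (\<lambda>(a, b). derived G (carrier G) #>\<^bsub>G\<^esub> (a \<otimes>\<^bsub>G\<^esub> b))"

definition K2_tilde ::
    "('f, 'm) monoid_scheme \<Rightarrow> ('f \<Rightarrow> 'g) \<Rightarrow> ('g, 'n) monoid_scheme \<Rightarrow> ('f \<times> 'f) set monoid" where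
  "K2_tilde F \<pi> G =
     (F \<times>\<times> F)\<lparr>carrier := K2 F\<rparr> Mod normal_closure (F \<times>\<times> F) (K2 (F\<lparr>carrier := kernel F G \<pi>\<rparr>))"

text \<open>The map from \<^term>\<open>K2_tilde F \<pi> G\<close> to \<^term>\<open>K2 G\<close> induced by \<open>\<pi> \<times> \<pi>\<close>; its value on a coset
  is the common image of the elements of that coset.\<close>

definition K2_tilde_map :: "('f \<Rightarrow> 'g) \<Rightarrow> ('f \<times> 'f) set \<Rightarrow> 'g \<times> 'g" where
  "K2_tilde_map \<pi> C = the_elem ((\<lambda>(a, b). (\<pi> a, \<pi> b)) ` C)"

text \<open>For Abelian \<open>G\<close>, \<^term>\<open>K2 G\<close> consists of the pairs \<open>(g, g\<inverse>)\<close>, and is identified with \<open>G\<close>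
  by the first projection.\<close>

definition K2_tilde_proj :: "('f \<Rightarrow> 'g) \<Rightarrow> ('f \<times> 'f) set \<Rightarrow> 'g" where
  "K2_tilde_proj \<pi> C = fst (K2_tilde_map \<pi> C)"


section \<open>The Schur multiplier\<close>

definition Cstar :: "complex monoid" where
  "Cstar = \<lparr>carrier = UNIV - {0}, mult = (*), one = 1\<rparr>"

definition cochains2 :: "('a, 'm) monoid_scheme \<Rightarrow> ('a \<times> 'a \<Rightarrow> complex) monoid" where
  "cochains2 G = product_group (carrier G \<times> carrier G) (\<lambda>_. Cstar)"

definition cocycles2 :: "('a, 'm) monoid_scheme \<Rightarrow> ('a \<times> 'a \<Rightarrow> complex) set" where
  "cocycles2 G = {f \<in> carrier (cochains2 G).
     \<forall>x \<in> carrier G. \<forall>y \<in> carrier G. \<forall>z \<in> carrier G.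
       f (y, z) * f (x, y \<otimes>\<^bsub>G\<^esub> z) = f (x \<otimes>\<^bsub>G\<^esub> y, z) * f (x, y)}"

definition coboundaries2 :: "('a, 'm) monoid_scheme \<Rightarrow> ('a \<times> 'a \<Rightarrow> complex) set" where
  "coboundaries2 G =
     (\<lambda>c. \<lambda>(x, y) \<in> carrier G \<times> carrier G. c y * c x / c (x \<otimes>\<^bsub>G\<^esub> y))
       ` (carrier G \<rightarrow>\<^sub>E carrier Cstar)"

text \<open>The second cohomology group of \<open>G\<close> with coefficients in \<open>\<complex>\<^sup>*\<close> (trivial action).\<close>

definition schur_multiplier ::
    "('a, 'm) monoid_scheme \<Rightarrow> ('a \<times> 'a \<Rightarrow> complex) set monoid" where
  "schur_multiplier G = (cochains2 G)\<lparr>carrier := cocycles2 G\<rparr> Mod coboundaries2 G"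


section \<open>Covers\<close>

definition is_cover ::
    "('g, 'n) monoid_scheme \<Rightarrow> ('e, 'm) monoid_scheme \<Rightarrow> ('e \<Rightarrow> 'g) \<Rightarrow> bool" where
  "is_cover G E p \<longleftrightarrow>
     group G \<and> finite (carrier G) \<and> group E \<and> p \<in> epi E G \<and>
     (\<forall>m \<in> kernel E G p. \<forall>e \<in> carrier E. m \<otimes>\<^bsub>E\<^esub> e = e \<otimes>\<^bsub>E\<^esub> m) \<and>
     kernel E G p \<subseteq> derived E (carrier E) \<and>
     E\<lparr>carrier := kernel E G p\<rparr> \<cong> schur_multiplier G"

text \<open>The subquotient of \<open>E \<times> E\<close> attached to \<open>E\<close> and a central subgroup \<open>M\<close>.\<close>

definition cover_subgroup :: "('e, 'm) monoid_scheme \<Rightarrow> 'e set \<Rightarrow> ('e \<times> 'e) set" where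
  "cover_subgroup E M = generate (E \<times>\<times> E)
     ({(g, inv\<^bsub>E\<^esub> g) | g. g \<in> carrier E} \<union> {(m, \<one>\<^bsub>E\<^esub>) | m. m \<in> M})"

definition antidiagonal :: "('e, 'm) monoid_scheme \<Rightarrow> 'e set \<Rightarrow> ('e \<times> 'e) set" where
  "antidiagonal E M = generate (E \<times>\<times> E) {(m, inv\<^bsub>E\<^esub> m) | m. m \<in> M}"

definition cover_subquotient :: "('e, 'm) monoid_scheme \<Rightarrow> 'e set \<Rightarrow> ('e \<times> 'e) set monoid" where
  "cover_subquotient E M =
     (E \<times>\<times> E)\<lparr>carrier := cover_subgroup E M\<rparr> Mod antidiagonal E M"


section \<open>Every group has a presentation\<close>

text \<open>The free group on a set \<open>X\<close>, realised on reduced words.\<close>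

fun push :: "'a \<times> bool \<Rightarrow> ('a \<times> bool) list \<Rightarrow> ('a \<times> bool) list" where
  "push l [] = [l]"
| "push l (k # w) = (if fst l = fst k \<and> snd l \<noteq> snd k then w else l # k # w)"

definition word_group :: "'a set \<Rightarrow> ('a \<times> bool) list monoid" where
  "word_group X = \<lparr>carrier = reduced_words X, mult = foldr push, one = []\<rparr>"

definition flip :: "'a \<times> bool \<Rightarrow> 'a \<times> bool" where
  "flip l = (fst l, \<not> snd l)"

lemma reduced_Nil [simp]: "reduced []"
  by (simp add: reduced_def)

lemma reduced_Cons:
  "reduced (l # w) \<longleftrightarrow> reduced w \<and> (w = [] \<or> \<not> (fst l = fst (hd w) \<and> snd l \<noteq> snd (hd w)))"
  by (cases w) (auto simp: reduced_def)

lemma reduced_push: "reduced w \<Longrightarrow> reduced (push l w)"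
  by (cases w) (auto simp: reduced_Cons)

lemma push_reduced: "reduced (l # w) \<Longrightarrow> push l w = l # w"
  by (cases w) (auto simp: reduced_Cons)

lemma push_flip: "reduced w \<Longrightarrow> push (flip l) (push l w) = w"
  by (cases w; cases "tl w") (auto simp: reduced_Cons flip_def prod_eq_iff)

lemma flip_flip [simp]: "flip (flip l) = l"
  by (simp add: flip_def)

lemma set_push: "set (push l w) \<subseteq> insert l (set w)"
  by (cases w) auto

lemma reduced_words_iff: "w \<in> reduced_words X \<longleftrightarrow> set w \<subseteq> X \<times> UNIV \<and> reduced w"
  by (auto simp: reduced_words_def)

lemma push_in:
  assumes "w \<in> reduced_words X" "fst l \<in> X"
  shows "push l w \<in> reduced_words X"
proof -
  have "l \<in> X \<times> UNIV"
    using assms(2) by (cases l) auto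
  then show ?thesis
    using assms(1) set_push[of l w] by (auto simp: reduced_words_iff reduced_push)
qed

lemma foldr_push_in:
  "u \<in> lists (X \<times> UNIV) \<Longrightarrow> v \<in> reduced_words X \<Longrightarrow> foldr push u v \<in> reduced_words X"
  by (induction u) (auto intro!: push_in)

lemma foldr_push_Nil: "reduced u \<Longrightarrow> foldr push u [] = u"
  by (induction u) (auto simp: push_reduced reduced_Cons)

lemma reduced_foldr_push: "reduced w \<Longrightarrow> reduced (foldr push v w)"
  by (induction v) (auto simp: reduced_push)

lemma foldr_push_push:
  assumes "reduced w"
  shows "foldr push (push l v) w = push l (foldr push v w)"
proof (cases v)
  case Nil
  then show ?thesis by simp
next
  case (Cons k u)
  show ?thesis
  proof (cases "fst l = fst k \<and> snd l \<noteq> snd k")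
    case True
    then have "l = flip k"
      by (auto simp: flip_def prod_eq_iff)
    then show ?thesis
      using True Cons push_flip[OF reduced_foldr_push[OF assms]] by simp
  qed (use Cons in auto)
qed

lemma foldr_push_assoc:
  assumes "reduced w"
  shows "foldr push (foldr push u v) w = foldr push u (foldr push v w)"
  by (induction u) (auto simp: foldr_push_push assms)

lemma foldr_push_inverse:
  assumes "reduced w"
  shows "foldr push (rev (map flip u)) (foldr push u w) = w"
  by (induction u) (auto simp: push_flip reduced_foldr_push assms)

lemma group_word_group: "group (word_group X)"
proof (rule groupI)
  fix x assume x: "x \<in> carrier (word_group X)"
  let ?y = "foldr push (rev (map flip x)) []"
  have "rev (map flip x) \<in> lists (X \<times> UNIV)"
    using x by (fastforce simp: word_group_def reduced_words_iff flip_def)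
  then have "?y \<in> carrier (word_group X)"
    using foldr_push_in[of _ X "[]"] by (simp add: word_group_def reduced_words_iff)
  moreover have "?y \<otimes>\<^bsub>word_group X\<^esub> x = \<one>\<^bsub>word_group X\<^esub>"
    using x foldr_push_assoc[of x "rev (map flip x)" "[]"] foldr_push_inverse[of "[]" x]
    by (simp add: word_group_def reduced_words_iff foldr_push_Nil)
  ultimately show "\<exists>y \<in> carrier (word_group X). y \<otimes>\<^bsub>word_group X\<^esub> x = \<one>\<^bsub>word_group X\<^esub>"
    by blast
next
  fix x y assume "x \<in> carrier (word_group X)" "y \<in> carrier (word_group X)"
  then show "x \<otimes>\<^bsub>word_group X\<^esub> y \<in> carrier (word_group X)"
    using foldr_push_in[of x X y] by (simp add: word_group_def reduced_words_def)
qed (auto simp: word_group_def reduced_words_iff foldr_push_assoc)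

abbreviation (input) gen :: "'a \<Rightarrow> ('a \<times> bool) list" where
  "gen x \<equiv> [(x, True)]"

lemma inv_gen: "x \<in> X \<Longrightarrow> inv\<^bsub>word_group X\<^esub> (gen x) = [(x, False)]"
  by (rule group.inv_equality[OF group_word_group])
    (auto simp: word_group_def reduced_words_iff reduced_Cons)

lemma letter_val_word_group:
  "fst l \<in> X \<Longrightarrow> letter_val (word_group X) (map_prod gen id l) = [l]"
  by (cases l) (auto simp: letter_val_def inv_gen)

lemma word_val_word_group:
  "w \<in> lists (X \<times> UNIV) \<Longrightarrow> word_val (word_group X) (map (map_prod gen id) w) = foldr push w []"
proof (induction w)
  case (Cons l w)
  have "letter_val (word_group X) (map_prod gen id l) = [l]"
    using Cons letter_val_word_group[of l X] by auto
  with Cons show ?case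
    by (auto simp: word_val_def word_group_def)
qed (simp add: word_val_def word_group_def)

lemma reduced_map_gen: "reduced (map (map_prod gen id) w) \<longleftrightarrow> reduced w"
  by (induction w) (auto simp: reduced_Cons hd_map)

lemma reduced_words_gen:
  "reduced_words (gen ` X) = map (map_prod gen id) ` reduced_words X"
proof -
  have "(gen ` X) \<times> UNIV = map_prod gen (id :: bool \<Rightarrow> bool) ` (X \<times> UNIV)"
    by force
  then have "lists ((gen ` X) \<times> (UNIV :: bool set)) = map (map_prod gen id) ` lists (X \<times> UNIV)"
    by (simp add: lists_image)
  then show ?thesis
    by (auto simp: reduced_words_def reduced_map_gen)
qed

lemma free_basis_word_group: "free_basis (word_group X) (gen ` X)"
proof -
  have "word_val (word_group X) (map (map_prod gen id) w) = w" if "w \<in> reduced_words X" for w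
    using that word_val_word_group[of w X] foldr_push_Nil[of w] by (simp add: reduced_words_def)
  then have "bij_betw (word_val (word_group X)) (map (map_prod gen id) ` reduced_words X)
               (reduced_words X)"
    by (intro bij_betw_byWitness[where f' = "map (map_prod gen id)"]) auto
  then show ?thesis
    unfolding free_basis_def reduced_words_gen
    by (auto simp: word_group_def reduced_words_iff reduced_Cons)
qed

lemma (in group) letter_val_closed: "fst l \<in> carrier G \<Longrightarrow> letter_val G l \<in> carrier G"
  by (simp add: letter_val_def)

lemma (in group) word_val_closed: "set w \<subseteq> carrier G \<times> UNIV \<Longrightarrow> word_val G w \<in> carrier G"
  by (induction w) (auto simp: word_val_def letter_val_def)

lemma (in group) word_val_push:
  assumes "set w \<subseteq> carrier G \<times> UNIV" "fst l \<in> carrier G"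
  shows "word_val G (push l w) = letter_val G l \<otimes> word_val G w"
proof (cases w)
  case (Cons k u)
  have u: "word_val G u \<in> carrier G" and k: "fst k \<in> carrier G"
    using assms Cons by (auto intro!: word_val_closed)
  show ?thesis
  proof (cases "fst l = fst k \<and> snd l \<noteq> snd k")
    case True
    then have "letter_val G l \<otimes> letter_val G k = \<one>"
      using k by (auto simp: letter_val_def)
    moreover have "letter_val G l \<otimes> (letter_val G k \<otimes> word_val G u)
        = letter_val G l \<otimes> letter_val G k \<otimes> word_val G u"
      using u k assms(2) by (simp add: m_assoc letter_val_closed)
    ultimately have "letter_val G l \<otimes> (letter_val G k \<otimes> word_val G u) = word_val G u"
      using u by simp
    then show ?thesis
      using True Cons by (simp add: word_val_def)
  qed (use Cons in \<open>auto simp: word_val_def\<close>)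
qed (simp add: word_val_def)

lemma (in group) word_val_mult:
  assumes "u \<in> lists (carrier G \<times> UNIV)" "v \<in> reduced_words (carrier G)"
  shows "word_val G (foldr push u v) = word_val G u \<otimes> word_val G v"
  using assms(1)
proof (induction u)
  case Nil
  then show ?case
    using assms(2) word_val_closed by (auto simp: word_val_def reduced_words_iff)
next
  case (Cons l u)
  have "set (foldr push u v) \<subseteq> carrier G \<times> UNIV"
    using Cons foldr_push_in[OF _ assms(2), of u] by (auto simp: reduced_words_iff)
  then have "word_val G (foldr push (l # u) v) = letter_val G l \<otimes> (word_val G u \<otimes> word_val G v)"
    using Cons by (auto simp: word_val_push)
  moreover have "fst l \<in> carrier G" "set u \<subseteq> carrier G \<times> UNIV" "set v \<subseteq> carrier G \<times> UNIV"
    using Cons assms(2) by (auto simp: reduced_words_iff)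
  ultimately have "word_val G (foldr push (l # u) v)
      = (letter_val G l \<otimes> word_val G u) \<otimes> word_val G v"
    by (simp add: m_assoc letter_val_closed word_val_closed)
  then show ?case
    by (simp add: word_val_def)
qed

lemma presentation_word_group:
  assumes "group G"
  shows "presentation (word_group (carrier G)) (word_val G) G"
proof -
  interpret group G by fact
  have hom: "word_val G \<in> hom (word_group (carrier G)) G"
    by (rule homI) (auto simp: word_group_def reduced_words_iff word_val_closed
        intro!: word_val_mult)
  have "g \<in> word_val G ` carrier (word_group (carrier G))" if "g \<in> carrier G" for g
    using that by (intro image_eqI[of _ _ "gen g"])
      (auto simp: word_val_def letter_val_def word_group_def reduced_words_iff reduced_Cons)
  with hom show ?thesis
    using group_word_group free_basis_word_group
    by (auto simp: presentation_def free_group_def epi_iff_subset)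
qed

end

theory Submission
  imports Defs "HOL-Algebra.Multiplicative_Group"
begin

text \<open>
  Let \<open>G = F/N\<close> be Abelian of odd order \<open>n\<close>, with \<open>F\<close> free. Put \<open>D = [F,F]\<close>, \<open>L = [F,N]\<close> and
  \<open>Q = F/L\<close>. As \<open>G\<close> is Abelian, \<open>D \<subseteq> N\<close>, and \<open>Q\<close> is a central extension of \<open>G\<close>; in such an
  extension commutators are central, so \<open>[x,y]\<close> is bimultiplicative and depends on the images of
  \<open>x\<close> and \<open>y\<close> in \<open>G\<close> only. Freeness of \<open>F\<close> makes \<open>Q\<close> universal: it maps, over \<open>G\<close>, to every
  central extension of \<open>G\<close>.

  \<^emph>\<open>The kernel.\<close> A pair \<open>(a,b)\<close> lies in \<open>\<K>(F,2)\<close> iff \<open>ab \<in> D\<close>. The normal closure of \<open>\<K>(N,2)\<close>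
  contains the pairs \<open>(n,n\<inverse>)\<close>, hence the pairs \<open>([x,n],1)\<close>, and turns out to be
  \<open>W = {(a,b) \<in> N \<times> N. ab \<in> L}\<close> (\<open>normal_closure_K2_kernel\<close>). Therefore the kernel of
  \<open>\<K>(F,2)/W \<rightarrow> G\<close> is central and isomorphic to \<open>D/L = [Q,Q]\<close> through \<open>(a,b) \<mapsto> ab\<close>.

  \<^emph>\<open>It consists of products of commutators.\<close> Modulo \<open>W\<close>, the commutator of \<open>(x,x\<inverse>)\<close> and
  \<open>(y,y\<inverse>)\<close> is \<open>([x,y]\<^sup>2,1)\<close>. Since \<open>[x,y]\<close> has odd order in \<open>Q\<close>, replacing \<open>x\<close> by its power with
  exponent \<open>(n+1)/2\<close> yields \<open>([x,y],1)\<close> (\<open>kernel_proj_subset_derived\<close>).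

  \<^emph>\<open>It is the Schur multiplier.\<close> The finite Abelian group \<open>[Q,Q]\<close> is isomorphic to its character
  group (\<open>dual_group_iso\<close>). Sending a character \<open>\<chi>\<close> to \<open>(x,y) \<mapsto> \<chi>[x,y]\<close> identifies that character
  group with the group of alternating bicharacters of \<open>G\<close>: it is injective because commutators
  generate, and surjective because an alternating \<open>\<beta>\<close> is the commutator pairing of the central
  extension of \<open>G\<close> by \<open>\<complex>\<^sup>*\<close> with cocycle \<open>\<beta>\<close> to the power \<open>(n+1)/2\<close>, to which \<open>Q\<close> maps
  (\<open>dual_derived_iso_alternating\<close>). On the other side, a cocycle \<open>f\<close> has the alternating
  bicharacter \<open>f(x,y)/f(y,x)\<close>, and this identifies the Schur multiplier with the same group: a
  symmetric cocycle belongs to an Abelian extension of \<open>G\<close> by \<open>\<complex>\<^sup>*\<close>, which splits because \<open>\<complex>\<^sup>*\<close>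
  is divisible (\<open>schur_multiplier_iso_alternating\<close>).

  \<^emph>\<open>An arbitrary cover.\<close> Let \<open>E\<close> be a cover of \<open>G\<close> with kernel \<open>M\<close>; then \<open>M = [E,E]\<close>. The map
  \<open>Q \<rightarrow> E\<close> over \<open>G\<close> takes \<open>[Q,Q]\<close> onto \<open>[E,E]\<close>, and both groups have the order of the Schur
  multiplier, so it is bijective there. With \<open>\<phi>\<close> the composite \<open>F \<rightarrow> Q \<rightarrow> E\<close>, the assignment
  \<open>(a,b) \<mapsto> (\<phi> a, \<phi> b)\<close> therefore maps \<open>\<K>(F,2)\<close> onto the subquotient of \<open>E \<times> E\<close> with kernel
  exactly \<open>W\<close> (\<open>K2_tilde_iso_cover_subquotient\<close>).
\<close>

section \<open>Characters of finite Abelian groups\<close>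

lemma Cstar_simps [simp]:
  "carrier Cstar = UNIV - {0}" "x \<otimes>\<^bsub>Cstar\<^esub> y = x * y" "\<one>\<^bsub>Cstar\<^esub> = 1"
  by (simp_all add: Cstar_def)

lemma comm_group_Cstar: "comm_group Cstar"
proof (rule comm_groupI)
  fix x assume "x \<in> carrier Cstar"
  then show "\<exists>y \<in> carrier Cstar. y \<otimes>\<^bsub>Cstar\<^esub> x = \<one>\<^bsub>Cstar\<^esub>"
    by (intro bexI[of _ "inverse x"]) auto
qed auto

lemma group_Cstar: "group Cstar"
  using comm_group_Cstar by (rule comm_group.axioms(2))

lemma inv_Cstar: "x \<noteq> 0 \<Longrightarrow> inv\<^bsub>Cstar\<^esub> x = 1 / x"
  by (rule group.inv_equality[OF group_Cstar]) auto

lemma pow_Cstar: "x [^]\<^bsub>Cstar\<^esub> (n :: nat) = x ^ n"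
  by (induction n) (simp_all add: nat_pow_def)

text \<open>Restricting to extensional functions makes a character determined by its values on the group.\<close>
definition characters :: "('a, 'm) monoid_scheme \<Rightarrow> ('a \<Rightarrow> complex) set" where
  "characters A = hom A Cstar \<inter> extensional (carrier A)"

definition dual_group :: "('a, 'm) monoid_scheme \<Rightarrow> ('a \<Rightarrow> complex) monoid" where
  "dual_group A = (product_group (carrier A) (\<lambda>_. Cstar))\<lparr>carrier := characters A\<rparr>"

context
  fixes A :: "('a, 'm) monoid_scheme" and \<chi> :: "'a \<Rightarrow> complex"
  assumes A: "group A" and \<chi>: "\<chi> \<in> hom A Cstar"
begin

interpretation group_hom A Cstar \<chi>
  using A \<chi> group_Cstar by (simp add: group_hom_def group_hom_axioms_def)

lemma character_nonzero: "x \<in> carrier A \<Longrightarrow> \<chi> x \<noteq> 0"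
  using hom_closed by simp

lemma character_mult: "x \<in> carrier A \<Longrightarrow> y \<in> carrier A \<Longrightarrow> \<chi> (x \<otimes>\<^bsub>A\<^esub> y) = \<chi> x * \<chi> y"
  by simp

lemma character_one: "\<chi> \<one>\<^bsub>A\<^esub> = 1"
  using hom_one by simp

lemma character_inv: "x \<in> carrier A \<Longrightarrow> \<chi> (inv\<^bsub>A\<^esub> x) = 1 / \<chi> x"
  using hom_inv[of x] inv_Cstar[of "\<chi> x"] character_nonzero by simp

lemma character_pow: "x \<in> carrier A \<Longrightarrow> \<chi> (x [^]\<^bsub>A\<^esub> (n :: nat)) = \<chi> x ^ n"
  using hom_nat_pow[of x n] by (simp add: pow_Cstar)

end

text \<open>
  Adjoining one element \<open>a\<close> to \<open>H\<close>: if \<open>m\<close> is the least positive exponent with \<open>a\<^sup>m \<in> H\<close>, then any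
  \<open>m\<close>-th root \<open>z\<close> of \<open>\<phi> (a\<^sup>m)\<close> may be prescribed as the value at \<open>a\<close>, by
  \<open>h a\<^sup>k \<mapsto> \<phi> h z\<^sup>k\<close>. The choice of \<open>z\<close> is left open because a root of exact order \<open>m\<close> is needed
  later. Since a power of \<open>a\<close> lies in \<open>H\<close>, exponents in \<open>\<nat>\<close> suffice.
\<close>
lemma (in comm_group) extend_character_step:
  assumes H: "subgroup H G" and \<phi>: "\<phi> \<in> hom (G\<lparr>carrier := H\<rparr>) Cstar"
    and a: "a \<in> carrier G" and m: "0 < (m :: nat)" "a [^] m \<in> H"
    and min: "\<And>k. 0 < k \<Longrightarrow> k < m \<Longrightarrow> a [^] k \<notin> H"
    and z: "z ^ m = \<phi> (a [^] m)"
  obtains K \<psi> where "subgroup K G" "H \<subseteq> K" "a \<in> K" "\<psi> \<in> hom (G\<lparr>carrier := K\<rparr>) Cstar"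
    "\<And>h. h \<in> H \<Longrightarrow> \<psi> h = \<phi> h" "\<psi> a = z"
proof -
  interpret H: subgroup H G by fact
  have HG: "group (G\<lparr>carrier := H\<rparr>)"
    using H subgroup_imp_group by blast
  note Hc = H.mem_carrier
  have \<phi>0: "\<phi> h \<noteq> 0" if "h \<in> H" for h
    using character_nonzero[OF HG \<phi>] that by simp
  have \<phi>m: "\<phi> (h \<otimes> k) = \<phi> h * \<phi> k" if "h \<in> H" "k \<in> H" for h k
    using character_mult[OF HG \<phi>] that by simp
  have \<phi>1: "\<phi> \<one> = 1"
    using character_one[OF HG \<phi>] by simp
  have z0: "z \<noteq> 0"
    using z \<phi>0[OF m(2)] m(1) by (auto simp: power_0_left)
  have pow: "a [^] (m * q) \<in> H \<and> \<phi> (a [^] (m * q)) = z ^ (m * q)" for q :: nat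
  proof (induction q)
    case (Suc q)
    have "a [^] (m * Suc q) = a [^] m \<otimes> a [^] (m * q)"
      using a by (simp add: nat_pow_mult)
    then show ?case
      using Suc m(2) \<phi>m[of "a [^] m" "a [^] (m * q)"] by (simp add: power_add z)
  qed (simp add: \<phi>1)
  have pow': "\<phi> (a [^] k) = z ^ k" if k: "a [^] k \<in> H" for k :: nat
  proof -
    have "a [^] k = a [^] (k mod m) \<otimes> a [^] (m * (k div m))"
      using a by (simp add: nat_pow_mult)
    then have "a [^] (k mod m) = a [^] k \<otimes> inv (a [^] (m * (k div m)))"
      using a by (simp add: m_assoc)
    then have "a [^] (k mod m) \<in> H"
      using k pow by simp
    then have "k mod m = 0"
      using min[of "k mod m"] m(1) by (cases "k mod m = 0") auto
    then have "k = m * (k div m)" by auto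
    then show ?thesis using pow by metis
  qed
  have wd1: "\<phi> h * z ^ k = \<phi> h' * z ^ l"
    if eq: "h \<otimes> a [^] k = h' \<otimes> a [^] l" and h: "h \<in> H" "h' \<in> H" and kl: "k \<le> l" for h h' and k l :: nat
  proof -
    have "h \<otimes> a [^] k = (h' \<otimes> a [^] (l - k)) \<otimes> a [^] k"
      using eq a h kl by (simp add: m_assoc nat_pow_mult Hc)
    then have h': "h = h' \<otimes> a [^] (l - k)"
      using a h by (simp add: Hc)
    then have "a [^] (l - k) = inv h' \<otimes> h"
      using a h by (simp add: Hc m_assoc[symmetric])
    then have mem: "a [^] (l - k) \<in> H"
      using h by simp
    have "\<phi> h = \<phi> h' * z ^ (l - k)"
      using \<phi>m[OF h(2) mem] pow'[OF mem] h' by simp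
    then show ?thesis
      using kl by (simp flip: power_add)
  qed
  have wd: "\<phi> h * z ^ k = \<phi> h' * z ^ l"
    if "h \<otimes> a [^] k = h' \<otimes> a [^] l" "h \<in> H" "h' \<in> H" for h h' and k l :: nat
    using wd1[of h k h' l] wd1[of h' l h k] that by (cases "k \<le> l") auto
  define K where "K = {h \<otimes> a [^] k | h k. h \<in> H \<and> k \<in> (UNIV :: nat set)}"
  define \<psi> where "\<psi> x = (SOME w. \<exists>h k. h \<in> H \<and> x = h \<otimes> a [^] (k :: nat) \<and> w = \<phi> h * z ^ k)" for x
  have \<psi>: "\<psi> (h \<otimes> a [^] k) = \<phi> h * z ^ k" if "h \<in> H" for h and k :: nat
  proof -
    let ?P = "\<lambda>w. \<exists>h' l. h' \<in> H \<and> h \<otimes> a [^] k = h' \<otimes> a [^] (l :: nat) \<and> w = \<phi> h' * z ^ l"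
    have "?P (\<phi> h * z ^ k)" using that by blast
    moreover have "w = \<phi> h * z ^ k" if w: "?P w" for w
    proof -
      obtain h' l where "h' \<in> H" "h \<otimes> a [^] k = h' \<otimes> a [^] (l :: nat)" "w = \<phi> h' * z ^ l"
        using w by blast
      then show ?thesis using wd[of h k h' l] \<open>h \<in> H\<close> by simp
    qed
    ultimately show ?thesis unfolding \<psi>_def by (rule some_equality)
  qed
  have mult: "(h \<otimes> a [^] k) \<otimes> (h' \<otimes> a [^] l) = (h \<otimes> h') \<otimes> a [^] (k + l)"
    if "h \<in> H" "h' \<in> H" for h h' and k l :: nat
    using that a by (simp add: nat_pow_mult[symmetric] Hc m_ac)
  have KI: "h \<otimes> a [^] k \<in> K" if "h \<in> H" for h and k :: nat
    using that by (auto simp: K_def)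
  have sub: "H \<subseteq> K"
  proof
    fix h assume "h \<in> H" then show "h \<in> K" using KI[of h 0] by (simp add: Hc)
  qed
  show thesis
  proof
    show "H \<subseteq> K" by fact
    show "a \<in> K" using KI[of \<one> 1] a by simp
    show "subgroup K G"
    proof (rule subgroupI)
      show "K \<subseteq> carrier G" using a by (auto simp: K_def Hc)
      show "K \<noteq> {}" using \<open>a \<in> K\<close> by blast
    next
      fix x assume "x \<in> K"
      then obtain h k where h: "h \<in> H" "x = h \<otimes> a [^] (k :: nat)" by (auto simp: K_def)
      \<comment> \<open>the inverse of \<open>a [^] k\<close> is a non-negative power of \<open>a\<close> times an element of \<open>H\<close>\<close>
      let ?u = "inv h \<otimes> inv (a [^] (m * k))"
      have "a [^] (m * k) = a [^] k \<otimes> a [^] (m * k - k)"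
        using a m(1) by (simp add: nat_pow_mult)
      then have "(?u \<otimes> a [^] (m * k - k)) \<otimes> x = \<one>"
        using h a by (simp add: Hc inv_mult m_ac)
      then have "inv x = ?u \<otimes> a [^] (m * k - k)"
        using h a by (intro inv_equality) (auto simp: Hc)
      moreover have "?u \<in> H" using h pow by simp
      ultimately show "inv x \<in> K" using KI by simp
    next
      fix x y assume "x \<in> K" "y \<in> K"
      then show "x \<otimes> y \<in> K" using mult KI by (force simp: K_def)
    qed
    show "\<psi> \<in> hom (G\<lparr>carrier := K\<rparr>) Cstar"
    proof (rule homI)
      fix x assume "x \<in> carrier (G\<lparr>carrier := K\<rparr>)"
      then show "\<psi> x \<in> carrier Cstar" by (auto simp: K_def \<psi> \<phi>0 z0)
    next
      fix x y assume "x \<in> carrier (G\<lparr>carrier := K\<rparr>)" "y \<in> carrier (G\<lparr>carrier := K\<rparr>)"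
      then obtain h k h' l where "h \<in> H" "h' \<in> H" "x = h \<otimes> a [^] (k :: nat)" "y = h' \<otimes> a [^] (l :: nat)"
        by (auto simp: K_def)
      then show "\<psi> (x \<otimes>\<^bsub>G\<lparr>carrier := K\<rparr>\<^esub> y) = \<psi> x \<otimes>\<^bsub>Cstar\<^esub> \<psi> y"
        by (simp add: mult \<psi> \<phi>m power_add)
    qed
    show "\<psi> h = \<phi> h" if "h \<in> H" for h
      using \<psi>[OF that, of 0] that by (simp add: Hc)
    show "\<psi> a = z"
      using \<psi>[of \<one> 1] a by (simp add: \<phi>1)
  qed
qed

lemma nth_root_exists: "w \<noteq> 0 \<Longrightarrow> 0 < m \<Longrightarrow> \<exists>z :: complex. z ^ m = w"
  using card_nth_roots[of w m] by (metis (mono_tags) Collect_empty_eq card.empty less_irrefl)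

text \<open>
  This is the divisibility of \<open>\<complex>\<^sup>*\<close>. The group itself may be infinite, which matters for
  extensions of a finite group by \<open>\<complex>\<^sup>*\<close>.
\<close>
lemma (in comm_group) extend_character:
  assumes "finite S" "S \<subseteq> carrier G"
    and "subgroup H G" "\<phi> \<in> hom (G\<lparr>carrier := H\<rparr>) Cstar"
    and "\<And>a. a \<in> S \<Longrightarrow> \<exists>m > (0 :: nat). a [^] m \<in> H"
  shows "\<exists>K \<psi>. subgroup K G \<and> H \<subseteq> K \<and> S \<subseteq> K \<and> \<psi> \<in> hom (G\<lparr>carrier := K\<rparr>) Cstar \<and>
    (\<forall>h \<in> H. \<psi> h = \<phi> h)"
  using assms
proof (induction S rule: finite_induct)
  case (insert a S)
  then obtain K \<psi> where K: "subgroup K G" "H \<subseteq> K" "S \<subseteq> K" "\<psi> \<in> hom (G\<lparr>carrier := K\<rparr>) Cstar"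
    "\<forall>h \<in> H. \<psi> h = \<phi> h" by auto
  define m where "m = (LEAST m. 0 < m \<and> a [^] (m :: nat) \<in> K)"
  have "\<exists>m > 0. a [^] (m :: nat) \<in> K" using insert.prems(4) K(2) by blast
  then have m: "0 < m" "a [^] m \<in> K"
    unfolding m_def by (metis (mono_tags, lifting) LeastI)+
  have min: "a [^] k \<notin> K" if "0 < k" "k < m" for k
    using not_less_Least[of k "\<lambda>m. 0 < m \<and> a [^] m \<in> K"] that by (simp add: m_def)
  have "\<psi> (a [^] m) \<noteq> 0"
    using character_nonzero[OF subgroup_imp_group[OF K(1)] K(4)] m by simp
  then obtain z where "z ^ m = \<psi> (a [^] m)"
    using nth_root_exists m(1) by blast
  from extend_character_step[OF K(1,4) _ m min this] insert.prems(1)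
  obtain K' \<psi>' where "subgroup K' G" "K \<subseteq> K'" "a \<in> K'" "\<psi>' \<in> hom (G\<lparr>carrier := K'\<rparr>) Cstar"
    "\<And>h. h \<in> K \<Longrightarrow> \<psi>' h = \<psi> h" by (metis insert_subset)
  then show ?case using K by (intro exI[of _ K'] exI[of _ \<psi>']) auto
qed auto

lemma cis_root_power: "cis (2 * pi / real n) ^ j = cis (2 * pi * real j / real n)"
  by (simp add: DeMoivre mult_ac)

lemma root_of_unity_is_power:
  assumes "0 < n" "z ^ n = 1"
  obtains j where "z = cis (2 * pi / real n) ^ j"
  using bij_betw_roots_unity[OF assms(1)] assms(2) that
  by (auto simp: bij_betw_def cis_root_power)

lemma cis_root_power_eq_1:
  assumes "0 < n" "cis (2 * pi / real n) ^ j = 1"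
  shows "n dvd j"
proof -
  let ?z = "cis (2 * pi / real n)"
  have "?z ^ n = 1" using assms(1) by (simp add: cis_root_power)
  have "?z ^ j = (?z ^ n) ^ (j div n) * ?z ^ (j mod n)"
    by (simp flip: power_mult power_add)
  then have "?z ^ (j mod n) = ?z ^ 0"
    using assms(2) \<open>?z ^ n = 1\<close> by simp
  then have "j mod n = 0"
    using inj_onD[OF bij_betw_imp_inj_on[OF bij_betw_roots_unity[OF assms(1)]], of "j mod n" 0] assms(1)
    by (simp add: cis_root_power)
  then show ?thesis by auto
qed

text \<open>
  Applied to the trivial subgroup, the extension step gives a faithful character of the cyclic
  group generated by \<open>a\<close>, which then extends to the whole group.
\<close>
lemma (in comm_group) character_of_primitive_value:
  assumes fin: "finite (carrier G)" and a: "a \<in> carrier G"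
  obtains \<chi> where "\<chi> \<in> hom G Cstar" "\<chi> a = cis (2 * pi / real (ord a))"
proof -
  let ?z = "cis (2 * pi / real (ord a))"
  have n: "0 < ord a" using ord_ge_1[OF fin a] by simp
  have one: "(\<lambda>_. 1) \<in> hom (G\<lparr>carrier := {\<one>}\<rparr>) Cstar"
    by (rule homI) auto
  have min: "a [^] k \<notin> {\<one>}" if "0 < k" "k < ord a" for k
    using pow_eq_id[OF a, of k] that by (auto dest: dvd_imp_le)
  have zn: "?z ^ ord a = 1" using n by (simp add: cis_root_power)
  obtain K \<psi> where K: "subgroup K G" "a \<in> K" "\<psi> \<in> hom (G\<lparr>carrier := K\<rparr>) Cstar" "\<psi> a = ?z"
    using extend_character_step[OF triv_subgroup one a n _ min zn] a pow_ord_eq_1[OF a]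
    by (metis singletonI)
  have "\<exists>m > (0 :: nat). b [^] m \<in> K" if "b \<in> carrier G" for b
    using pow_order_eq_1[OF that] fin order_gt_0_iff_finite subgroup.one_closed[OF K(1)]
    by (intro exI[of _ "order G"]) simp
  from extend_character[OF fin subset_refl K(1,3) this]
  obtain L \<chi> where L: "subgroup L G" "carrier G \<subseteq> L" "\<chi> \<in> hom (G\<lparr>carrier := L\<rparr>) Cstar"
    "\<forall>h \<in> K. \<chi> h = \<psi> h" by auto
  moreover have "L = carrier G" using L subgroup.subset by blast
  ultimately show thesis using that[of \<chi>] K by simp
qed

text \<open>
  By Lagrange, a subgroup of \<open>\<complex>\<^sup>*\<close> of finite order \<open>k\<close> consists of \<open>k\<close>-th roots of unity, and there
  are only \<open>k\<close> of them.
\<close>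
lemma (in comm_group) character_image_roots_of_unity:
  assumes fin: "finite (carrier G)" and \<chi>: "\<chi> \<in> hom G Cstar"
  shows "\<chi> ` carrier G = {z. z ^ card (\<chi> ` carrier G) = 1}"
proof -
  let ?S = "\<chi> ` carrier G"
  interpret group_hom G Cstar \<chi>
    using \<chi> group_Cstar by (simp add: group_hom_def group_hom_axioms_def)
  have S: "subgroup ?S Cstar"
    using img_is_subgroup .
  interpret S: group "Cstar\<lparr>carrier := ?S\<rparr>"
    using H.subgroup_imp_group[OF S] .
  have pos: "0 < card ?S" using fin subgroup.one_closed[OF S] by (auto simp: card_gt_0_iff)
  have "z ^ card ?S = 1" if "z \<in> ?S" for z
  proof -
    have "z [^]\<^bsub>Cstar\<lparr>carrier := ?S\<rparr>\<^esub> card ?S = 1"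
      using S.pow_order_eq_1[of z] that by (simp add: order_def)
    then show ?thesis
      using H.nat_pow_consistent[of z "card ?S" ?S] by (simp add: pow_Cstar)
  qed
  then have "?S \<subseteq> {z. z ^ card ?S = 1}" by blast
  then show ?thesis
    using pos by (intro card_subset_eq finite_roots_unity) (simp_all add: card_roots_unity_eq Suc_le_eq)
qed

text \<open>
  Self-duality of finite Abelian groups, by splitting off a cyclic factor. Choose a character \<open>\<chi>\<close>
  with the largest image, say the \<open>k\<close>-th roots of unity, and \<open>a\<close> with \<open>\<chi> a\<close> of order \<open>k\<close>. A
  faithful character of the cyclic group of \<open>a\<close> extends, so maximality bounds the order of \<open>a\<close> by
  \<open>k\<close>; hence \<open>A\<close> is the product of that cyclic group and the kernel of \<open>\<chi>\<close>. The pairing is the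
  product of the one on the kernel, which exists by induction, and of
  \<open>(a\<^sup>i, a\<^sup>j) \<mapsto> \<zeta>\<^sup>i\<^sup>j\<close>.
\<close>
theorem perfect_pairing:
  fixes A :: "('a, 'm) monoid_scheme"
  assumes "comm_group A" and "finite (carrier A)"
  shows "\<exists>B :: 'a \<Rightarrow> 'a \<Rightarrow> complex.
    (\<forall>x \<in> carrier A. B x \<in> hom A Cstar) \<and>
    (\<forall>x \<in> carrier A. \<forall>y \<in> carrier A. \<forall>b \<in> carrier A. B (x \<otimes>\<^bsub>A\<^esub> y) b = B x b * B y b) \<and>
    (\<forall>x \<in> carrier A. (\<forall>b \<in> carrier A. B x b = 1) \<longrightarrow> x = \<one>\<^bsub>A\<^esub>) \<and>
    (\<forall>\<psi> \<in> hom A Cstar. \<exists>x \<in> carrier A. \<forall>b \<in> carrier A. \<psi> b = B x b)"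
  using assms
proof (induction "card (carrier A)" arbitrary: A rule: less_induct)
  case (less A)
  interpret comm_group A by fact
  show ?case
  proof (cases "carrier A = {\<one>\<^bsub>A\<^esub>}")
    case True
    then show ?thesis
    proof (intro exI[of _ "\<lambda>_ _. 1"] conjI ballI impI)
      fix \<psi> assume "\<psi> \<in> hom A Cstar"
      from character_one[OF is_group this]
      show "\<exists>x \<in> carrier A. \<forall>b \<in> carrier A. \<psi> b = 1" using True by simp
    qed (use True in \<open>auto simp: hom_def\<close>)
  next
    case nontriv: False
    have fin: "finite (carrier A)" by fact
    have "(\<lambda>_. 1) \<in> hom A Cstar" by (rule homI) auto
    moreover have "card (\<psi> ` carrier A) < Suc (card (carrier A))" for \<psi> :: "'a \<Rightarrow> complex"
      using card_image_le[OF fin, of \<psi>] by (simp add: le_imp_less_Suc)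
    ultimately have "\<exists>\<chi>. \<chi> \<in> hom A Cstar \<and>
        (\<forall>\<psi>. \<psi> \<in> hom A Cstar \<longrightarrow> card (\<psi> ` carrier A) \<le> card (\<chi> ` carrier A))"
      by (intro ex_has_greatest_nat) auto
    then obtain \<chi> where \<chi>: "\<chi> \<in> hom A Cstar"
      and max: "\<And>\<psi>. \<psi> \<in> hom A Cstar \<Longrightarrow> card (\<psi> ` carrier A) \<le> card (\<chi> ` carrier A)"
      by blast
    define k where "k = card (\<chi> ` carrier A)"
    define \<zeta> where "\<zeta> = cis (2 * pi / real k)"
    have k0: "0 < k" using fin carrier_not_empty by (auto simp: k_def card_gt_0_iff)
    have ord_le: "ord b \<le> k" if b: "b \<in> carrier A" for b
    proof -
      obtain \<psi> where \<psi>: "\<psi> \<in> hom A Cstar" "\<psi> b = cis (2 * pi / real (ord b))"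
        using character_of_primitive_value[OF fin b] .
      have n: "0 < ord b" using ord_ge_1[OF fin b] by simp
      have "{z. z ^ ord b = 1} \<subseteq> \<psi> ` carrier A"
      proof
        fix z :: complex assume "z \<in> {z. z ^ ord b = 1}"
        then obtain j where "z = \<psi> b ^ j"
          using root_of_unity_is_power[OF n] \<psi>(2) by auto
        then show "z \<in> \<psi> ` carrier A"
          using character_pow[OF is_group \<psi>(1) b, of j] b by (auto intro!: image_eqI[of _ _ "b [^]\<^bsub>A\<^esub> j"])
      qed
      then have "card {z :: complex. z ^ ord b = 1} \<le> card (\<psi> ` carrier A)"
        using fin by (intro card_mono) auto
      then show ?thesis using n max[OF \<psi>(1)] by (simp add: card_roots_unity_eq k_def)
    qed
    have img: "\<chi> ` carrier A = {z. z ^ k = 1}"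
      unfolding k_def using character_image_roots_of_unity[OF fin \<chi>] .
    have \<zeta>k: "\<zeta> ^ k = 1" using k0 by (simp add: \<zeta>_def cis_root_power)
    then obtain a where a: "a \<in> carrier A" "\<chi> a = \<zeta>"
      using img by (metis (mono_tags, lifting) imageE mem_Collect_eq)
    note \<chi>m = character_mult[OF is_group \<chi>] and \<chi>p = character_pow[OF is_group \<chi>]
    have "\<zeta> ^ ord a = 1"
      using \<chi>p[OF a(1), of "ord a"] a pow_ord_eq_1[OF a(1)] character_one[OF is_group \<chi>] by simp
    then have "k dvd ord a" unfolding \<zeta>_def using k0 by (rule cis_root_power_eq_1[rotated])
    then have orda: "ord a = k"
      using ord_le[OF a(1)] ord_ge_1[OF fin a(1)] by (auto dest: dvd_imp_le)
    have pow_eq1: "a [^]\<^bsub>A\<^esub> m = a [^]\<^bsub>A\<^esub> l" if "\<zeta> ^ m = \<zeta> ^ l" "m \<le> l" for m l :: nat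
    proof -
      have "\<zeta> ^ l = \<zeta> ^ m * \<zeta> ^ (l - m)" using that(2) by (simp flip: power_add)
      then have "\<zeta> ^ (l - m) = 1" using that(1) by (simp add: \<zeta>_def)
      then have "ord a dvd l - m"
        unfolding orda \<zeta>_def using k0 by (rule cis_root_power_eq_1[rotated])
      then have "a [^]\<^bsub>A\<^esub> (l - m) = \<one>\<^bsub>A\<^esub>" using pow_eq_id[OF a(1)] by simp
      moreover have "a [^]\<^bsub>A\<^esub> l = a [^]\<^bsub>A\<^esub> m \<otimes>\<^bsub>A\<^esub> a [^]\<^bsub>A\<^esub> (l - m)"
        using a that(2) by (simp add: nat_pow_mult)
      ultimately show ?thesis using a by simp
    qed
    have pow_eq: "a [^]\<^bsub>A\<^esub> m = a [^]\<^bsub>A\<^esub> l" if "\<zeta> ^ m = \<zeta> ^ l" for m l :: nat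
      
    proof (cases "m \<le> l")
      case True
      then show ?thesis by (rule pow_eq1[OF that])
    next
      case False
      then have "l \<le> m" by simp
      then show ?thesis by (rule pow_eq1[OF that[symmetric], symmetric])
    qed
    define K where "K = kernel A Cstar \<chi>"
    let ?K = "A\<lparr>carrier := K\<rparr>"
    have K: "subgroup K A"
      unfolding K_def
      by (rule group_hom.subgroup_kernel) (intro group_hom.intro group_hom_axioms.intro is_group group_Cstar \<chi>)
    note Kc = subgroup.mem_carrier[OF K]
    have Kiff: "x \<in> K \<longleftrightarrow> x \<in> carrier A \<and> \<chi> x = 1" for x
      by (simp add: K_def kernel_def)
    obtain b where "b \<in> carrier A" "b \<noteq> \<one>\<^bsub>A\<^esub>" using nontriv by blast
    then have "k \<noteq> 1" using ord_le[of b] ord_ge_1[OF fin, of b] ord_eq_1[of b] by auto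
    then have "\<zeta> \<noteq> 1" using cis_root_power_eq_1[of k 1] k0 by (auto simp: \<zeta>_def)
    then have "a \<notin> K" using a by (simp add: Kiff)
    then have "card K < card (carrier A)"
      using a subgroup.subset[OF K] fin by (intro psubset_card_mono) auto
    moreover have "comm_group ?K" using group.group_comm_groupI[OF subgroup_imp_group[OF K]] Kc by (simp add: m_comm)
    moreover have "finite K" using fin subgroup.subset[OF K] finite_subset by blast
    ultimately obtain B :: "'a \<Rightarrow> 'a \<Rightarrow> complex" where
      B1: "\<forall>x \<in> K. B x \<in> hom ?K Cstar" and
      B2: "\<forall>x \<in> K. \<forall>y \<in> K. \<forall>b \<in> K. B (x \<otimes>\<^bsub>A\<^esub> y) b = B x b * B y b" and
      B3: "\<forall>x \<in> K. (\<forall>b \<in> K. B x b = 1) \<longrightarrow> x = \<one>\<^bsub>A\<^esub>" and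
      B4: "\<forall>\<psi> \<in> hom ?K Cstar. \<exists>x \<in> K. \<forall>b \<in> K. \<psi> b = B x b"
      using less.hyps[of ?K] by auto
    have KG: "group ?K" using K subgroup_imp_group by blast
    have Bm: "B x (b \<otimes>\<^bsub>A\<^esub> c) = B x b * B x c" if "x \<in> K" "b \<in> K" "c \<in> K" for x b c
      using character_mult[OF KG, of "B x" b c] B1 that by simp
    have B0: "B x b \<noteq> 0" if "x \<in> K" "b \<in> K" for x b
      using character_nonzero[OF KG, of "B x" b] B1 that by simp
    have Bone: "B x \<one>\<^bsub>A\<^esub> = 1" if "x \<in> K" for x
      using character_one[OF KG, of "B x"] B1 that by simp
    \<comment> \<open>the decomposition \<open>x = r x \<cdot> a\<^sup>i\<close> with \<open>r x\<close> in the kernel; \<open>i\<close> matters only modulo \<open>k\<close>\<close>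
    define i where "i x = (SOME i :: nat. \<chi> x = \<zeta> ^ i)" for x
    have i: "\<zeta> ^ i x = \<chi> x" if "x \<in> carrier A" for x
    proof -
      have "\<chi> x ^ k = 1" using img that by blast
      then have "\<exists>i. \<chi> x = \<zeta> ^ i" using root_of_unity_is_power[OF k0] unfolding \<zeta>_def by metis
      then show ?thesis unfolding i_def by (metis (mono_tags, lifting) someI)
    qed
    have ai: "a [^]\<^bsub>A\<^esub> i x = a [^]\<^bsub>A\<^esub> m" if "x \<in> carrier A" "\<chi> x = \<zeta> ^ m" for x m
      by (rule pow_eq) (simp add: i[OF that(1)] that(2))
    define r where "r x = x \<otimes>\<^bsub>A\<^esub> inv\<^bsub>A\<^esub> (a [^]\<^bsub>A\<^esub> i x)" for x
    have \<chi>a: "\<chi> (a [^]\<^bsub>A\<^esub> m) = \<zeta> ^ m" for m :: nat using \<chi>p a by simp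
    have rK: "r x \<in> K" if "x \<in> carrier A" for x
    proof -
      have "\<chi> (inv\<^bsub>A\<^esub> (a [^]\<^bsub>A\<^esub> i x)) = 1 / \<chi> x"
        using character_inv[OF is_group \<chi>, of "a [^]\<^bsub>A\<^esub> i x"] a by (simp add: \<chi>a i[OF that])
      then have "\<chi> (r x) = 1"
        using that a character_nonzero[OF is_group \<chi> that] by (simp add: r_def \<chi>m)
      then show ?thesis using that a by (simp add: Kiff r_def)
    qed
    have rx: "x = r x \<otimes>\<^bsub>A\<^esub> a [^]\<^bsub>A\<^esub> i x" if "x \<in> carrier A" for x
      using that a by (simp add: r_def m_assoc)
    have rm: "r (x \<otimes>\<^bsub>A\<^esub> y) = r x \<otimes>\<^bsub>A\<^esub> r y" if "x \<in> carrier A" "y \<in> carrier A" for x y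
    proof -
      have "a [^]\<^bsub>A\<^esub> i (x \<otimes>\<^bsub>A\<^esub> y) = a [^]\<^bsub>A\<^esub> i x \<otimes>\<^bsub>A\<^esub> a [^]\<^bsub>A\<^esub> i y"
        using ai[of "x \<otimes>\<^bsub>A\<^esub> y" "i x + i y"] that a by (simp add: \<chi>m power_add i nat_pow_mult)
      then show ?thesis using that a by (simp add: r_def inv_mult m_ac)
    qed
    define P where "P x b = B (r x) (r b) * \<zeta> ^ (i x * i b)" for x b
    have zl: "\<zeta> ^ (i x * i b) = \<chi> b ^ i x" "\<zeta> ^ (i x * i b) = \<chi> x ^ i b"
      if "x \<in> carrier A" "b \<in> carrier A" for x b
      using i[OF that(1)] i[OF that(2)] by (metis mult.commute power_mult)+
    have \<zeta>0: "\<zeta> \<noteq> 0" by (simp add: \<zeta>_def)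
    show ?thesis
    proof (intro exI[of _ P] conjI ballI impI)
      fix x assume x: "x \<in> carrier A"
      show "P x \<in> hom A Cstar"
      proof (rule homI)
        show "P x b \<in> carrier Cstar" if "b \<in> carrier A" for b
          using B0 rK x that \<zeta>0 by (simp add: P_def)
        show "P x (b \<otimes>\<^bsub>A\<^esub> c) = P x b \<otimes>\<^bsub>Cstar\<^esub> P x c" if "b \<in> carrier A" "c \<in> carrier A" for b c
          using that x by (simp add: P_def zl(1) rm Bm rK \<chi>m power_mult_distrib)
      qed
    next
      fix x y b assume "x \<in> carrier A" "y \<in> carrier A" "b \<in> carrier A"
      then show "P (x \<otimes>\<^bsub>A\<^esub> y) b = P x b * P y b"
        using B2 by (simp add: P_def zl(2) rm rK \<chi>m power_mult_distrib)
    next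
      fix x assume x: "x \<in> carrier A" and triv: "\<forall>b \<in> carrier A. P x b = 1"
      have "a [^]\<^bsub>A\<^esub> i a = a" using ai[of a 1] a by simp
      then have "r a = \<one>\<^bsub>A\<^esub>" using a by (simp add: r_def)
      then have "\<chi> x = 1"
        using triv a x Bone[OF rK[OF x]] zl(1)[OF x a(1)] i[OF x] by (auto simp: P_def)
      then have xK: "x \<in> K" using x by (simp add: Kiff)
      have rK': "r b = b" if "b \<in> K" for b
        using that ai[of b 0] by (simp add: r_def Kiff)
      have "B x b = 1" if b: "b \<in> K" for b
      proof -
        have "P x b = 1" using triv b Kc by blast
        then show ?thesis using b xK zl(2)[of x b] by (simp add: P_def rK') (simp add: Kiff)
      qed
      then show "x = \<one>\<^bsub>A\<^esub>" using B3 xK by blast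
    next
      fix \<psi> assume \<psi>: "\<psi> \<in> hom A Cstar"
      note \<psi>m = character_mult[OF is_group \<psi>] and \<psi>p = character_pow[OF is_group \<psi>]
      have "\<psi> \<in> hom ?K Cstar" using \<psi> Kc by (auto simp: hom_def Pi_iff)
      then obtain y where y: "y \<in> K" "\<forall>b \<in> K. \<psi> b = B y b" using B4 by blast
      have "\<psi> a ^ k = 1"
        using \<psi>p[OF a(1), of k] pow_ord_eq_1[OF a(1)] orda character_one[OF is_group \<psi>] by simp
      then obtain j where j: "\<psi> a = \<zeta> ^ j" using root_of_unity_is_power[OF k0] unfolding \<zeta>_def by metis
      define x where "x = y \<otimes>\<^bsub>A\<^esub> a [^]\<^bsub>A\<^esub> j"
      have x: "x \<in> carrier A" using y Kc a by (simp add: x_def)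
      have \<chi>x: "\<chi> x = \<zeta> ^ j" using y a by (simp add: x_def \<chi>m \<chi>a Kiff)
      then have rxy: "r x = y" using ai[OF x, of j] a y Kc by (simp add: r_def x_def m_assoc)
      have "\<psi> b = P x b" if b: "b \<in> carrier A" for b
      proof -
        have "\<psi> b = \<psi> (r b \<otimes>\<^bsub>A\<^esub> a [^]\<^bsub>A\<^esub> i b)" using rx[OF b] by simp
        also have "\<dots> = B y (r b) * \<psi> a ^ i b"
          using y rK[OF b] Kc a by (simp add: \<psi>m \<psi>p)
        also have "\<dots> = P x b" using zl(2)[OF x b] by (simp add: P_def rxy j \<chi>x)
        finally show ?thesis .
      qed
      then show "\<exists>x \<in> carrier A. \<forall>b \<in> carrier A. \<psi> b = P x b" using x by blast
    qed
  qed
qed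

corollary dual_group_iso:
  assumes "comm_group A" and "finite (carrier A)"
  shows "A \<cong> dual_group A"
proof -
  interpret comm_group A by fact
  obtain B where
    B1: "\<And>x. x \<in> carrier A \<Longrightarrow> B x \<in> hom A Cstar" and
    B2: "\<And>x y b. x \<in> carrier A \<Longrightarrow> y \<in> carrier A \<Longrightarrow> b \<in> carrier A \<Longrightarrow> B (x \<otimes>\<^bsub>A\<^esub> y) b = B x b * B y b" and
    B3: "\<And>x. x \<in> carrier A \<Longrightarrow> (\<forall>b \<in> carrier A. B x b = 1) \<Longrightarrow> x = \<one>\<^bsub>A\<^esub>" and
    B4: "\<And>\<psi>. \<psi> \<in> hom A Cstar \<Longrightarrow> \<exists>x \<in> carrier A. \<forall>b \<in> carrier A. \<psi> b = B x b"
    using perfect_pairing[OF assms] by blast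
  let ?h = "\<lambda>x. restrict (B x) (carrier A)"
  have h: "?h x \<in> characters A" if "x \<in> carrier A" for x
    using B1[OF that] by (auto simp: characters_def hom_def Pi_iff)
  have hom: "?h \<in> hom A (dual_group A)"
    using h B2 by (auto simp: hom_def dual_group_def fun_eq_iff)
  have inj: "inj_on ?h (carrier A)"
  proof (rule inj_onI)
    fix x y assume x: "x \<in> carrier A" and y: "y \<in> carrier A" and eq: "?h x = ?h y"
    have "B (x \<otimes>\<^bsub>A\<^esub> inv\<^bsub>A\<^esub> y) b = 1" if b: "b \<in> carrier A" for b
    proof -
      have "B x b = B y b" using eq b by (metis restrict_apply')
      moreover have "B x b = B (x \<otimes>\<^bsub>A\<^esub> inv\<^bsub>A\<^esub> y) b * B y b"
        using B2[of "x \<otimes>\<^bsub>A\<^esub> inv\<^bsub>A\<^esub> y" y b] x y b by (simp add: m_assoc)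
      moreover have "B y b \<noteq> 0" using character_nonzero[OF is_group B1[OF y] b] .
      ultimately show ?thesis by simp
    qed
    then have "x \<otimes>\<^bsub>A\<^esub> inv\<^bsub>A\<^esub> y = \<one>\<^bsub>A\<^esub>" using B3 x y by simp
    then show "x = y" using x y inv_equality[of x "inv\<^bsub>A\<^esub> y"] by simp
  qed
  have "?h ` carrier A = characters A"
  proof (intro equalityI subsetI)
    fix \<psi> assume \<psi>: "\<psi> \<in> characters A"
    then obtain x where "x \<in> carrier A" "\<forall>b \<in> carrier A. \<psi> b = B x b"
      using B4 by (auto simp: characters_def)
    then show "\<psi> \<in> ?h ` carrier A"
      using \<psi> by (intro image_eqI[of _ _ x]) (auto simp: characters_def extensional_def fun_eq_iff)
  qed (use h in auto)
  then show ?thesis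
    using hom inj by (auto simp: is_iso_def iso_def bij_betw_def dual_group_def)
qed

section \<open>The Schur multiplier and alternating bicharacters\<close>

definition alternating_bicharacters :: "('a, 'm) monoid_scheme \<Rightarrow> ('a \<times> 'a \<Rightarrow> complex) set" where
  "alternating_bicharacters G = {\<beta> \<in> carrier (cochains2 G).
     (\<forall>x \<in> carrier G. \<beta> (x, x) = 1) \<and>
     (\<forall>x \<in> carrier G. \<forall>y \<in> carrier G. \<forall>z \<in> carrier G.
        \<beta> (x \<otimes>\<^bsub>G\<^esub> y, z) = \<beta> (x, z) * \<beta> (y, z) \<and> \<beta> (x, y \<otimes>\<^bsub>G\<^esub> z) = \<beta> (x, y) * \<beta> (x, z))}"

definition alternating_group :: "('a, 'm) monoid_scheme \<Rightarrow> ('a \<times> 'a \<Rightarrow> complex) monoid" where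
  "alternating_group G = (cochains2 G)\<lparr>carrier := alternating_bicharacters G\<rparr>"

text \<open>
  The extension of \<open>G\<close> by \<open>\<complex>\<^sup>*\<close> with cocycle \<open>f\<close>. Cocycles need not be normalised, whence the shape
  of the neutral element.
\<close>
definition twisted_product ::
    "('a, 'm) monoid_scheme \<Rightarrow> ('a \<times> 'a \<Rightarrow> complex) \<Rightarrow> (complex \<times> 'a) monoid" where
  "twisted_product G f = \<lparr>carrier = (UNIV - {0}) \<times> carrier G,
     mult = \<lambda>(s, x) (t, y). (s * t * f (x, y), x \<otimes>\<^bsub>G\<^esub> y), one = (1 / f (\<one>\<^bsub>G\<^esub>, \<one>\<^bsub>G\<^esub>), \<one>\<^bsub>G\<^esub>)\<rparr>"

lemma twisted_product_simps [simp]: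
  "carrier (twisted_product G f) = (UNIV - {0}) \<times> carrier G"
  "(s, x) \<otimes>\<^bsub>twisted_product G f\<^esub> (t, y) = (s * t * f (x, y), x \<otimes>\<^bsub>G\<^esub> y)"
  "\<one>\<^bsub>twisted_product G f\<^esub> = (1 / f (\<one>\<^bsub>G\<^esub>, \<one>\<^bsub>G\<^esub>), \<one>\<^bsub>G\<^esub>)"
  by (simp_all add: twisted_product_def)

lemma group_cochains2: "group (cochains2 G)"
  unfolding cochains2_def by (intro product_group group_Cstar)

lemma cochain_nonzero:
  "f \<in> carrier (cochains2 G) \<Longrightarrow> x \<in> carrier G \<Longrightarrow> y \<in> carrier G \<Longrightarrow> f (x, y) \<noteq> 0"
  by (fastforce simp: cochains2_def PiE_iff)

lemma cochain_mult:
  "x \<in> carrier G \<Longrightarrow> y \<in> carrier G \<Longrightarrow> (f \<otimes>\<^bsub>cochains2 G\<^esub> g) (x, y) = f (x, y) * g (x, y)"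
  by (simp add: cochains2_def)

lemma cochain_inv:
  assumes "f \<in> carrier (cochains2 G)" "x \<in> carrier G" "y \<in> carrier G"
  shows "(inv\<^bsub>cochains2 G\<^esub> f) (x, y) = 1 / f (x, y)"
proof -
  have "inv\<^bsub>cochains2 G\<^esub> f = (\<lambda>p \<in> carrier G \<times> carrier G. inv\<^bsub>Cstar\<^esub> (f p))"
    unfolding cochains2_def
    by (rule inv_product_group) (use assms group_Cstar in \<open>auto simp: cochains2_def\<close>)
  then show ?thesis using assms cochain_nonzero[OF assms] by (simp add: inv_Cstar)
qed

lemma cochainI:
  assumes "\<And>x y. x \<in> carrier G \<Longrightarrow> y \<in> carrier G \<Longrightarrow> h (x, y) \<noteq> 0"
  shows "restrict h (carrier G \<times> carrier G) \<in> carrier (cochains2 G)"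
  using assms by (auto simp: cochains2_def)

lemma cochain_eqI:
  assumes "f \<in> carrier (cochains2 G)" "g \<in> carrier (cochains2 G)"
    "\<And>x y. x \<in> carrier G \<Longrightarrow> y \<in> carrier G \<Longrightarrow> f (x, y) = g (x, y)"
  shows "f = g"
proof (rule PiE_ext)
  show "f \<in> carrier G \<times> carrier G \<rightarrow>\<^sub>E carrier Cstar" "g \<in> carrier G \<times> carrier G \<rightarrow>\<^sub>E carrier Cstar"
    using assms(1,2) by (simp_all add: cochains2_def)
qed (use assms(3) in auto)

context group
begin

lemma cocycle_cochain: "f \<in> cocycles2 G \<Longrightarrow> f \<in> carrier (cochains2 G)"
  by (simp add: cocycles2_def)

lemma cocycle_eq:
  "f \<in> cocycles2 G \<Longrightarrow> x \<in> carrier G \<Longrightarrow> y \<in> carrier G \<Longrightarrow> z \<in> carrier G \<Longrightarrow>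
     f (y, z) * f (x, y \<otimes> z) = f (x \<otimes> y, z) * f (x, y)"
  by (simp add: cocycles2_def)

lemma cocycle_one:
  assumes f: "f \<in> cocycles2 G" and x: "x \<in> carrier G"
  shows "f (\<one>, x) = f (\<one>, \<one>)" "f (x, \<one>) = f (\<one>, \<one>)"
  using cocycle_eq[OF f one_closed one_closed x] cocycle_eq[OF f x one_closed one_closed]
    cochain_nonzero[OF cocycle_cochain[OF f] one_closed x]
    cochain_nonzero[OF cocycle_cochain[OF f] x one_closed] x by auto

lemma group_twisted_product:
  assumes f: "f \<in> cocycles2 G"
  shows "group (twisted_product G f)"
proof (rule groupI)
  note nz = cochain_nonzero[OF cocycle_cochain[OF f]]
  fix p q r
  assume p: "p \<in> carrier (twisted_product G f)" and q: "q \<in> carrier (twisted_product G f)"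
  then show "p \<otimes>\<^bsub>twisted_product G f\<^esub> q \<in> carrier (twisted_product G f)"
    using nz by auto
  assume r: "r \<in> carrier (twisted_product G f)"
  obtain s x t y u z where
    "p = (s, x)" "q = (t, y)" "r = (u, z)" "x \<in> carrier G" "y \<in> carrier G" "z \<in> carrier G"
    using p q r by (cases p; cases q; cases r) auto
  then show "p \<otimes>\<^bsub>twisted_product G f\<^esub> q \<otimes>\<^bsub>twisted_product G f\<^esub> r =
      p \<otimes>\<^bsub>twisted_product G f\<^esub> (q \<otimes>\<^bsub>twisted_product G f\<^esub> r)"
    using cocycle_eq[OF f, of x y z] by (simp add: m_assoc)
next
  note nz = cochain_nonzero[OF cocycle_cochain[OF f]]
  show "\<one>\<^bsub>twisted_product G f\<^esub> \<in> carrier (twisted_product G f)"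
    using nz by simp
  fix p assume p: "p \<in> carrier (twisted_product G f)"
  then obtain s x where [simp]: "p = (s, x)" and x: "x \<in> carrier G" "s \<noteq> 0" by (cases p) auto
  show "\<one>\<^bsub>twisted_product G f\<^esub> \<otimes>\<^bsub>twisted_product G f\<^esub> p = p"
    using cocycle_one(1)[OF f x(1)] nz[OF one_closed one_closed] x by simp
  show "\<exists>q \<in> carrier (twisted_product G f). q \<otimes>\<^bsub>twisted_product G f\<^esub> p = \<one>\<^bsub>twisted_product G f\<^esub>"
    using x nz[OF one_closed one_closed] nz[of "inv x" x]
    by (intro bexI[of _ "(1 / (s * f (inv x, x) * f (\<one>, \<one>)), inv x)"]) auto
qed

end

context comm_group
begin

text \<open>
  For symmetric \<open>f\<close> the twisted product is Abelian, so the identity of the central \<open>\<complex>\<^sup>*\<close> extends to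
  a retraction \<open>\<psi>\<close> onto \<open>\<complex>\<^sup>*\<close>. Restricting \<open>\<psi>\<close> to the section \<open>x \<mapsto> (1, x)\<close> gives a cochain with
  coboundary \<open>f\<close>.
\<close>
lemma symmetric_cocycle_is_coboundary:
  assumes fin: "finite (carrier G)" and f: "f \<in> cocycles2 G"
    and sym: "\<And>x y. x \<in> carrier G \<Longrightarrow> y \<in> carrier G \<Longrightarrow> f (x, y) = f (y, x)"
  shows "f \<in> coboundaries2 G"
proof -
  let ?E = "twisted_product G f"
  note nz = cochain_nonzero[OF cocycle_cochain[OF f]]
  have E: "group ?E" using group_twisted_product[OF f] .
  interpret E: comm_group ?E
  proof (rule group.group_comm_groupI[OF E])
    show "p \<otimes>\<^bsub>?E\<^esub> q = q \<otimes>\<^bsub>?E\<^esub> p" if "p \<in> carrier ?E" "q \<in> carrier ?E" for p q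
      using that sym by (auto simp: m_comm)
  qed
  define e where "e = f (\<one>, \<one>)"
  have e: "e \<noteq> 0" using nz by (simp add: e_def)
  let ?H = "(UNIV - {0 :: complex}) \<times> {\<one>}"
  have pow: "\<exists>t. t \<noteq> 0 \<and> (s, x) [^]\<^bsub>?E\<^esub> k = (t, x [^] k)" if "s \<noteq> 0" "x \<in> carrier G" for s x and k :: nat
    using that
  proof (induction k)
    case (Suc k)
    then obtain t where "t \<noteq> 0" "(s, x) [^]\<^bsub>?E\<^esub> k = (t, x [^] k)" by blast
    then show ?case using Suc.prems nz by simp
  qed (simp add: nz)
  have H: "subgroup ?H ?E"
  proof (rule E.subgroupI)
    fix p assume "p \<in> ?H"
    then obtain s where s: "p = (s, \<one>)" "s \<noteq> 0" by auto
    then have "inv\<^bsub>?E\<^esub> p = (1 / (s * e * e), \<one>)"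
      using e by (intro E.inv_equality) (auto simp: e_def)
    then show "inv\<^bsub>?E\<^esub> p \<in> ?H" using s e by simp
  qed (use e in \<open>auto simp: e_def\<close>)
  \<comment> \<open>the factor \<open>e\<close> corrects for the neutral element \<open>(1 / e, \<one>)\<close>\<close>
  have \<phi>: "(\<lambda>p. fst p * e) \<in> hom (?E\<lparr>carrier := ?H\<rparr>) Cstar"
    by (rule homI) (use e in \<open>auto simp: e_def\<close>)
  let ?S = "{1 :: complex} \<times> carrier G"
  have S: "finite ?S" "?S \<subseteq> carrier ?E" using fin by auto
  have tors: "\<exists>m > (0 :: nat). p [^]\<^bsub>?E\<^esub> m \<in> ?H" if "p \<in> ?S" for p
  proof -
    obtain x where x: "p = (1, x)" "x \<in> carrier G" using \<open>p \<in> ?S\<close> by auto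
    then obtain t where "t \<noteq> 0" "p [^]\<^bsub>?E\<^esub> order G = (t, \<one>)"
      using pow[of 1 x "order G"] pow_order_eq_1[of x] by auto
    then show ?thesis
      using fin order_gt_0_iff_finite by (intro exI[of _ "order G"]) simp
  qed
  obtain K \<psi> where K: "subgroup K ?E" "?H \<subseteq> K" "?S \<subseteq> K"
    and \<psi>: "\<psi> \<in> hom (?E\<lparr>carrier := K\<rparr>) Cstar" "\<forall>h \<in> ?H. \<psi> h = fst h * e"
    using E.extend_character[OF S H \<phi>] tors by (metis (no_types, lifting))
  have KG: "group (?E\<lparr>carrier := K\<rparr>)" using E.subgroup_imp_group[OF K(1)] .
  have \<psi>m: "\<psi> (p \<otimes>\<^bsub>?E\<^esub> q) = \<psi> p * \<psi> q" if "p \<in> K" "q \<in> K" for p q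
    using character_mult[OF KG \<psi>(1)] that by simp
  define c where "c = (\<lambda>x \<in> carrier G. \<psi> (1, x))"
  have c0: "c x \<noteq> 0" if "x \<in> carrier G" for x
    using character_nonzero[OF KG \<psi>(1)] K(3) that by (auto simp: c_def)
  have c: "c x * c y = f (x, y) * c (x \<otimes> y)" if x: "x \<in> carrier G" and y: "y \<in> carrier G" for x y
  proof -
    have "(1, x) \<otimes>\<^bsub>?E\<^esub> (1, y) = (f (x, y) / e, \<one>) \<otimes>\<^bsub>?E\<^esub> (1, x \<otimes> y)"
      using x y e cocycle_one(1)[OF f, of "x \<otimes> y"] by (simp add: e_def)
    moreover have "(f (x, y) / e, \<one>) \<in> ?H" using e nz x y by simp
    moreover have "(1, x) \<in> K" "(1, y) \<in> K" "(1, x \<otimes> y) \<in> K" using K(3) x y by auto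
    ultimately have "\<psi> (1, x) * \<psi> (1, y) = \<psi> (f (x, y) / e, \<one>) * \<psi> (1, x \<otimes> y)"
      using \<psi>m K(2) by (metis subsetD)
    then show ?thesis using \<psi>(2) \<open>_ \<in> ?H\<close> x y e by (auto simp: c_def)
  qed
  show ?thesis
    unfolding coboundaries2_def
  proof (rule image_eqI[of _ _ c])
    show "c \<in> carrier G \<rightarrow>\<^sub>E carrier Cstar" using c0 by (auto simp: c_def)
    have "(\<lambda>(x, y) \<in> carrier G \<times> carrier G. c y * c x / c (x \<otimes> y)) \<in> carrier (cochains2 G)"
      using c0 by (intro cochainI) auto
    then show "f = (\<lambda>(x, y) \<in> carrier G \<times> carrier G. c y * c x / c (x \<otimes> y))"
      using cocycle_cochain[OF f] c c0 by (intro cochain_eqI) (auto simp: mult.commute[of "c _" "c _"])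
  qed
qed

lemma coboundary_cocycle:
  assumes "b \<in> coboundaries2 G"
  shows "b \<in> cocycles2 G" "x \<in> carrier G \<Longrightarrow> y \<in> carrier G \<Longrightarrow> b (x, y) = b (y, x)"
proof -
  obtain c where c: "c \<in> carrier G \<rightarrow>\<^sub>E carrier Cstar"
    and b: "b = (\<lambda>(x, y) \<in> carrier G \<times> carrier G. c y * c x / c (x \<otimes> y))"
    using assms by (auto simp: coboundaries2_def)
  have c0: "c x \<noteq> 0" if "x \<in> carrier G" for x using c that by (auto simp: PiE_iff)
  have "b \<in> carrier (cochains2 G)"
    unfolding b using c0 by (intro cochainI) auto
  then show "b \<in> cocycles2 G"
    using c0 by (auto simp: cocycles2_def b m_assoc)
  show "x \<in> carrier G \<Longrightarrow> y \<in> carrier G \<Longrightarrow> b (x, y) = b (y, x)"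
    by (simp add: b m_comm)
qed

lemma subgroup_cocycles2: "subgroup (cocycles2 G) (cochains2 G)"
proof (rule group.subgroupI[OF group_cochains2])
  show "cocycles2 G \<subseteq> carrier (cochains2 G)" by (auto simp: cocycles2_def)
  have "\<one>\<^bsub>cochains2 G\<^esub> \<in> cocycles2 G"
    using group.is_monoid[OF group_cochains2, THEN monoid.one_closed]
    by (simp add: cocycles2_def) (simp add: cochains2_def)
  then show "cocycles2 G \<noteq> {}" by blast
next
  fix f assume f: "f \<in> cocycles2 G"
  then show "inv\<^bsub>cochains2 G\<^esub> f \<in> cocycles2 G"
    using group.inv_closed[OF group_cochains2, of f G]
    by (simp add: cocycles2_def cochain_inv)
next
  fix f g assume "f \<in> cocycles2 G" "g \<in> cocycles2 G"
  then show "f \<otimes>\<^bsub>cochains2 G\<^esub> g \<in> cocycles2 G"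
    using monoid.m_closed[OF group.is_monoid[OF group_cochains2], of f G g]
    by (simp add: cocycles2_def cochain_mult mult_ac)
qed

text \<open>The commutator pairing of the extension with cocycle \<open>f\<close>.\<close>
definition skew :: "('a \<times> 'a \<Rightarrow> complex) \<Rightarrow> 'a \<times> 'a \<Rightarrow> complex" where
  "skew f = (\<lambda>(x, y) \<in> carrier G \<times> carrier G. f (x, y) / f (y, x))"

lemma skew_apply: "x \<in> carrier G \<Longrightarrow> y \<in> carrier G \<Longrightarrow> skew f (x, y) = f (x, y) / f (y, x)"
  by (simp add: skew_def)

lemma skew_alternating:
  assumes f: "f \<in> cocycles2 G"
  shows "skew f \<in> alternating_bicharacters G"
proof -
  note nz = cochain_nonzero[OF cocycle_cochain[OF f]]
  have cl: "skew f \<in> carrier (cochains2 G)"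
    unfolding skew_def using nz by (intro cochainI) auto
  have left: "skew f (x \<otimes> y, z) = skew f (x, z) * skew f (y, z)"
    if x: "x \<in> carrier G" and y: "y \<in> carrier G" and z: "z \<in> carrier G" for x y z
  proof -
    have 1: "f (x \<otimes> y, z) = f (y, z) * f (x, y \<otimes> z) / f (x, y)"
      using cocycle_eq[OF f x y z] nz[OF x y] by (simp add: field_simps)
    have 2: "f (z, x \<otimes> y) = f (x \<otimes> z, y) * f (z, x) / f (x, y)"
      using cocycle_eq[OF f z x y] nz[OF x y] x y z by (simp add: field_simps m_comm)
    have 3: "f (x, y \<otimes> z) = f (x \<otimes> z, y) * f (x, z) / f (z, y)"
      using cocycle_eq[OF f x z y] nz[OF z y] x y z by (simp add: field_simps m_comm)
    show ?thesis
      using x y z nz by (simp add: skew_apply 1 2 3 mult_ac)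
  qed
  have flip: "skew f (y, x) = 1 / skew f (x, y)" if "x \<in> carrier G" "y \<in> carrier G" for x y
    using that by (simp add: skew_apply)
  have right: "skew f (x, y \<otimes> z) = skew f (x, y) * skew f (x, z)"
    if x: "x \<in> carrier G" and y: "y \<in> carrier G" and z: "z \<in> carrier G" for x y z
    using x y z left[OF y z x] flip[of "y \<otimes> z" x] flip[OF y x] flip[OF z x] by simp
  show ?thesis
    using cl left right nz by (simp add: alternating_bicharacters_def skew_apply)
qed

lemma alternating_mult:
  assumes "\<beta> \<in> alternating_bicharacters G" "x \<in> carrier G" "y \<in> carrier G" "z \<in> carrier G"
  shows "\<beta> (x \<otimes> y, z) = \<beta> (x, z) * \<beta> (y, z)" "\<beta> (x, y \<otimes> z) = \<beta> (x, y) * \<beta> (x, z)"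
  using assms by (auto simp: alternating_bicharacters_def)

lemma alternating_pow:
  assumes \<beta>: "\<beta> \<in> alternating_bicharacters G" and x: "x \<in> carrier G" and y: "y \<in> carrier G"
  shows "\<beta> (x [^] (k :: nat), y) = \<beta> (x, y) ^ k"
proof (induction k)
  case 0
  have "\<beta> (\<one>, y) = \<beta> (\<one>, y) * \<beta> (\<one>, y)"
    using alternating_mult(1)[OF \<beta> one_closed one_closed y] by simp
  then show ?case
    using \<beta> y cochain_nonzero[of \<beta> G \<one> y] by (auto simp: alternating_bicharacters_def)
next
  case (Suc k)
  then show ?case
    using alternating_mult(1)[OF \<beta> _ x y, of "x [^] k"] x by simp
qed

lemma alternating_swap:
  assumes \<beta>: "\<beta> \<in> alternating_bicharacters G" and x: "x \<in> carrier G" and y: "y \<in> carrier G"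
  shows "\<beta> (x, y) * \<beta> (y, x) = 1"
proof -
  have "\<beta> (x \<otimes> y, x \<otimes> y) = 1" using \<beta> x y by (simp add: alternating_bicharacters_def)
  moreover have "\<beta> (x \<otimes> y, x \<otimes> y) = (\<beta> (x, x) * \<beta> (x, y)) * (\<beta> (y, x) * \<beta> (y, y))"
    using alternating_mult[OF \<beta>] x y by (simp add: mult_ac)
  ultimately show ?thesis using \<beta> x y by (simp add: alternating_bicharacters_def)
qed

text \<open>If the order is odd, raising to this power inverts squaring on elements killed by the order.\<close>
definition half_order :: nat where
  "half_order = Suc (order G) div 2"

lemma double_half_order: "odd (order G) \<Longrightarrow> half_order + half_order = Suc (order G)"
  unfolding half_order_def by presburger

text \<open>
  An alternating bicharacter is a cocycle itself, but its commutator pairing is its square; taking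
  the square root first repairs this.
\<close>
lemma alternating_has_root:
  assumes odd: "odd (order G)" and \<beta>: "\<beta> \<in> alternating_bicharacters G"
  defines "f \<equiv> (\<lambda>p \<in> carrier G \<times> carrier G. \<beta> p ^ half_order)"
  shows "f \<in> cocycles2 G" "skew f = \<beta>" "f (\<one>, \<one>) = 1"
proof -
  have \<beta>c: "\<beta> \<in> carrier (cochains2 G)" using \<beta> by (simp add: alternating_bicharacters_def)
  note nz = cochain_nonzero[OF \<beta>c]
  have fc: "f \<in> carrier (cochains2 G)"
    unfolding f_def using nz by (intro cochainI) auto
  then show fz: "f \<in> cocycles2 G"
    by (simp add: cocycles2_def) (simp add: f_def alternating_mult[OF \<beta>] power_mult_distrib mult_ac)
  show "f (\<one>, \<one>) = 1"
    using \<beta> by (simp add: f_def alternating_bicharacters_def)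
  have "skew f \<in> carrier (cochains2 G)"
    using skew_alternating[OF fz] by (simp add: alternating_bicharacters_def)
  moreover have "skew f (x, y) = \<beta> (x, y)" if x: "x \<in> carrier G" and y: "y \<in> carrier G" for x y
  proof -
    have "1 / \<beta> (y, x) = \<beta> (x, y)"
      using alternating_swap[OF \<beta> x y] nz[OF y x] by (simp add: field_simps)
    then have "skew f (x, y) = \<beta> (x, y) ^ half_order * \<beta> (x, y) ^ half_order"
      using x y power_one_over[of "\<beta> (y, x)" half_order] by (simp add: skew_apply f_def)
    also have "\<dots> = \<beta> (x, y) ^ order G * \<beta> (x, y)"
      using double_half_order[OF odd] by (simp flip: power_add)
    also have "\<beta> (x, y) ^ order G = 1"
      using alternating_pow[OF \<beta> x y, of "order G"] alternating_pow[OF \<beta> x y, of 0] x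
      by (simp add: pow_order_eq_1)
    finally show ?thesis by simp
  qed
  ultimately show "skew f = \<beta>" using \<beta>c by (intro cochain_eqI)
qed

theorem schur_multiplier_iso_alternating:
  assumes fin: "finite (carrier G)" and odd: "odd (order G)"
  shows "alternating_group G \<cong> schur_multiplier G"
proof -
  let ?Z = "(cochains2 G)\<lparr>carrier := cocycles2 G\<rparr>"
  have Z: "group ?Z"
    using group.subgroup_imp_group[OF group_cochains2 subgroup_cocycles2] .
  have hom: "skew \<in> hom ?Z (cochains2 G)"
  proof (rule homI)
    fix f g assume "f \<in> carrier ?Z" "g \<in> carrier ?Z"
    then show "skew (f \<otimes>\<^bsub>?Z\<^esub> g) = skew f \<otimes>\<^bsub>cochains2 G\<^esub> skew g"
      by (auto simp: skew_def cochains2_def fun_eq_iff)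
  qed (use skew_alternating in \<open>auto simp: alternating_bicharacters_def\<close>)
  interpret Z: group_hom ?Z "cochains2 G" skew
    using Z group_cochains2 hom by (simp add: group_hom_def group_hom_axioms_def)
  have img: "skew ` cocycles2 G = alternating_bicharacters G"
    using skew_alternating alternating_has_root(1,2)[OF odd] by (metis (no_types, lifting) image_iff subsetI subset_antisym)
  have "subgroup (alternating_bicharacters G) (cochains2 G)"
    using Z.img_is_subgroup img by simp
  then have "group (alternating_group G)"
    unfolding alternating_group_def by (rule group.subgroup_imp_group[OF group_cochains2])
  moreover have "skew \<in> hom ?Z (alternating_group G)"
    using hom skew_alternating by (auto simp: hom_def alternating_group_def)
  ultimately have gh: "group_hom ?Z (alternating_group G) skew"
    using Z by (simp add: group_hom_def group_hom_axioms_def)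
  have "kernel ?Z (alternating_group G) skew = coboundaries2 G"
  proof (intro equalityI subsetI)
    fix f assume "f \<in> kernel ?Z (alternating_group G) skew"
    then have f: "f \<in> cocycles2 G" and s: "skew f = \<one>\<^bsub>cochains2 G\<^esub>"
      by (auto simp: kernel_def alternating_group_def)
    have "f (x, y) = f (y, x)" if "x \<in> carrier G" "y \<in> carrier G" for x y
    proof -
      have "skew f (x, y) = 1" using s that by (simp add: cochains2_def)
      then show ?thesis
        using that cochain_nonzero[OF cocycle_cochain[OF f]] by (simp add: skew_apply)
    qed
    then show "f \<in> coboundaries2 G" using symmetric_cocycle_is_coboundary[OF fin f] by blast
  next
    fix f assume f: "f \<in> coboundaries2 G"
    note fz = coboundary_cocycle(1)[OF f]
    have "skew f (x, y) = 1" if "x \<in> carrier G" "y \<in> carrier G" for x y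
      using that coboundary_cocycle(2)[OF f that] cochain_nonzero[OF cocycle_cochain[OF fz]]
      by (simp add: skew_apply)
    then have "skew f = \<one>\<^bsub>cochains2 G\<^esub>"
      by (auto simp: cochains2_def skew_def fun_eq_iff)
    then show "f \<in> kernel ?Z (alternating_group G) skew"
      using fz by (simp add: kernel_def alternating_group_def)
  qed
  moreover have "?Z Mod kernel ?Z (alternating_group G) skew \<cong> alternating_group G"
    using group_hom.FactGroup_iso[OF gh] img by (simp add: alternating_group_def)
  moreover have "group (?Z Mod kernel ?Z (alternating_group G) skew)"
    using normal.factorgroup_is_group[OF group_hom.normal_kernel[OF gh]] .
  ultimately show ?thesis
    using group.iso_sym by (metis schur_multiplier_def)
qed

end

section \<open>Commutators in central extensions of Abelian groups\<close>

definition commutator :: "('a, 'm) monoid_scheme \<Rightarrow> 'a \<Rightarrow> 'a \<Rightarrow> 'a" where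
  "commutator E x y = x \<otimes>\<^bsub>E\<^esub> y \<otimes>\<^bsub>E\<^esub> inv\<^bsub>E\<^esub> x \<otimes>\<^bsub>E\<^esub> inv\<^bsub>E\<^esub> y"

lemma (in group) commutator_closed [simp]:
  "x \<in> carrier G \<Longrightarrow> y \<in> carrier G \<Longrightarrow> commutator G x y \<in> carrier G"
  by (simp add: commutator_def)

lemma (in group_hom) hom_commutator:
  "x \<in> carrier G \<Longrightarrow> y \<in> carrier G \<Longrightarrow> h (commutator G x y) = commutator H (h x) (h y)"
  by (simp add: commutator_def)

lemma (in group) commutator_mult_swap:
  assumes "x \<in> carrier G" "y \<in> carrier G"
  shows "commutator G x y \<otimes> (y \<otimes> x) = x \<otimes> y"
  using assms by (simp add: commutator_def m_assoc) (simp flip: m_assoc)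

lemma (in group) commutator_eqI:
  assumes "x \<in> carrier G" "y \<in> carrier G" "c \<in> carrier G" "c \<otimes> (y \<otimes> x) = x \<otimes> y"
  shows "commutator G x y = c"
  using assms commutator_mult_swap[of x y] by (metis commutator_closed m_closed right_cancel)

lemma (in group) derived_eq_generate_commutators:
  "derived G H = generate G {commutator G x y | x y. x \<in> H \<and> y \<in> H}"
proof -
  have "(\<Union>x \<in> H. \<Union>y \<in> H. {x \<otimes> y \<otimes> inv x \<otimes> inv y}) = {commutator G x y | x y. x \<in> H \<and> y \<in> H}"
    by (auto simp: commutator_def)
  then show ?thesis by (simp add: derived_def)
qed

lemma (in group) commutator_in_derived:
  "x \<in> H \<Longrightarrow> y \<in> H \<Longrightarrow> commutator G x y \<in> derived G H"
  unfolding derived_eq_generate_commutators by (auto intro: generate.incl)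

text \<open>
  A generator of order dividing \<open>m\<close> multiplies the size of the generated subgroup by at most \<open>m\<close>.
\<close>
lemma (in comm_group) finite_generate_torsion:
  assumes "finite S" "S \<subseteq> carrier G" "\<And>a. a \<in> S \<Longrightarrow> \<exists>m > (0 :: nat). a [^] m = \<one>"
  shows "finite (generate G S)"
  using assms
proof (induction S rule: finite_induct)
  case empty
  then show ?case by (simp add: generate_empty)
next
  case (insert a S)
  then have fin: "finite (generate G S)" and a: "a \<in> carrier G" by auto
  obtain m where m: "0 < m" "a [^] (m :: nat) = \<one>" using insert.prems by blast
  have H: "subgroup (generate G S) G" using insert.prems generate_is_subgroup by simp
  note Hc = subgroup.mem_carrier[OF H]
  let ?T = "(\<lambda>(k, h). a [^] k \<otimes> h) ` ((UNIV :: nat set) \<times> generate G S)"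
  have T: "a [^] k \<otimes> h \<in> ?T" if "h \<in> generate G S" for k :: nat and h using that by force
  have inv_pow: "inv (a [^] k) = a [^] (m * k - k)" for k :: nat
  proof -
    have "a [^] (m * k - k) \<otimes> a [^] k = (a [^] m) [^] k"
      using a m(1) by (simp add: nat_pow_mult nat_pow_pow)
    then show ?thesis using a m(2) by (intro inv_equality) simp_all
  qed
  have "subgroup ?T G"
  proof (rule subgroupI)
    show "?T \<subseteq> carrier G" using a Hc by auto
    show "?T \<noteq> {}" using T[of \<one>] generate.one[of G S] by blast
  next
    fix x assume "x \<in> ?T"
    then obtain k h where "x = a [^] (k :: nat) \<otimes> h" "h \<in> generate G S" by auto
    then have "inv x = a [^] (m * k - k) \<otimes> inv h" "inv h \<in> generate G S"
      using a Hc inv_pow subgroup.m_inv_closed[OF H] by (auto simp: inv_mult)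
    then show "inv x \<in> ?T" using T by simp
  next
    fix x y assume "x \<in> ?T" "y \<in> ?T"
    then obtain k h l g where "x = a [^] (k :: nat) \<otimes> h" "h \<in> generate G S"
      "y = a [^] (l :: nat) \<otimes> g" "g \<in> generate G S" by auto
    then have "x \<otimes> y = a [^] (k + l) \<otimes> (h \<otimes> g)" "h \<otimes> g \<in> generate G S"
      using a Hc subgroup.m_closed[OF H] by (auto simp: m_ac nat_pow_mult[symmetric])
    then show "x \<otimes> y \<in> ?T" using T by simp
  qed
  moreover have "insert a S \<subseteq> ?T"
  proof
    fix x assume "x \<in> insert a S"
    moreover have "a \<in> ?T" using T[of \<one> 1] a by (simp add: generate.one)
    moreover have "x \<in> ?T" if "x \<in> S"
      using T[of x 0] that insert.prems by (simp add: generate.incl subset_iff)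
    ultimately show "x \<in> ?T" by blast
  qed
  ultimately have "generate G (insert a S) \<subseteq> ?T" by (intro generate_subgroup_incl)
  moreover have "?T \<subseteq> (\<lambda>(k, h). a [^] k \<otimes> h) ` ({..<m} \<times> generate G S)"
  proof
    fix x assume "x \<in> ?T"
    then obtain k h where x: "x = a [^] (k :: nat) \<otimes> h" "h \<in> generate G S" by auto
    have "a [^] k = a [^] (k mod m) \<otimes> (a [^] m) [^] (k div m)"
      using a by (simp add: nat_pow_pow nat_pow_mult)
    then have "a [^] k = a [^] (k mod m)" using a m by simp
    then show "x \<in> (\<lambda>(k, h). a [^] k \<otimes> h) ` ({..<m} \<times> generate G S)"
      using x m(1) by (intro image_eqI[of _ _ "(k mod m, h)"]) auto
  qed
  ultimately show ?case using fin by (meson finite_SigmaI finite_imageI finite_lessThan finite_subset)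
qed

locale central_extension = E: group E + G: comm_group G for E (structure) and G (structure) +
  fixes p
  assumes p_epi: "p \<in> epi E G"
    and kernel_central: "m \<in> kernel E G p \<Longrightarrow> x \<in> carrier E \<Longrightarrow> m \<otimes>\<^bsub>E\<^esub> x = x \<otimes>\<^bsub>E\<^esub> m"
begin

sublocale group_hom E G p
  using p_epi by (simp add: group_hom_def group_hom_axioms_def epi_def)

lemma p_surj: "p ` carrier E = carrier G"
  using p_epi by (simp add: epi_def)

lemma kernel_iff: "m \<in> kernel E G p \<longleftrightarrow> m \<in> carrier E \<and> p m = \<one>\<^bsub>G\<^esub>"
  by (simp add: kernel_def)

lemma commutator_in_kernel:
  "x \<in> carrier E \<Longrightarrow> y \<in> carrier E \<Longrightarrow> commutator E x y \<in> kernel E G p"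
  using G.commutator_eqI[of "p x" "p y" "\<one>\<^bsub>G\<^esub>"] by (simp add: kernel_iff hom_commutator G.m_comm)

lemma derived_subset_kernel: "derived E (carrier E) \<subseteq> kernel E G p"
  unfolding E.derived_eq_generate_commutators
  by (rule E.generate_subgroup_incl[OF _ subgroup_kernel]) (auto simp: commutator_in_kernel)

text \<open>
  \<open>[xy,z] = x[y,z]x\<inverse>[x,z]\<close> holds in every group; here the conjugation has no effect.
\<close>
lemma commutator_mult_left:
  assumes x: "x \<in> carrier E" and y: "y \<in> carrier E" and z: "z \<in> carrier E"
  shows "commutator E (x \<otimes>\<^bsub>E\<^esub> y) z = commutator E x z \<otimes>\<^bsub>E\<^esub> commutator E y z"
proof (rule E.commutator_eqI)
  let ?c = "commutator E x z" and ?d = "commutator E y z"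
  have "?c \<otimes>\<^bsub>E\<^esub> ?d \<otimes>\<^bsub>E\<^esub> (z \<otimes>\<^bsub>E\<^esub> (x \<otimes>\<^bsub>E\<^esub> y)) = ?d \<otimes>\<^bsub>E\<^esub> (?c \<otimes>\<^bsub>E\<^esub> (z \<otimes>\<^bsub>E\<^esub> x)) \<otimes>\<^bsub>E\<^esub> y"
    using kernel_central[OF commutator_in_kernel[OF x z], of ?d] x y z by (simp add: E.m_assoc)
  also have "\<dots> = (?d \<otimes>\<^bsub>E\<^esub> x) \<otimes>\<^bsub>E\<^esub> (z \<otimes>\<^bsub>E\<^esub> y)"
    using x y z by (simp add: E.commutator_mult_swap) (simp add: E.m_assoc)
  also have "\<dots> = x \<otimes>\<^bsub>E\<^esub> (?d \<otimes>\<^bsub>E\<^esub> (z \<otimes>\<^bsub>E\<^esub> y))"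
    using kernel_central[OF commutator_in_kernel[OF y z], of x] x y z by (simp add: E.m_assoc)
  also have "\<dots> = x \<otimes>\<^bsub>E\<^esub> y \<otimes>\<^bsub>E\<^esub> z"
    using x y z by (simp add: E.commutator_mult_swap E.m_assoc)
  finally show "?c \<otimes>\<^bsub>E\<^esub> ?d \<otimes>\<^bsub>E\<^esub> (z \<otimes>\<^bsub>E\<^esub> (x \<otimes>\<^bsub>E\<^esub> y)) = x \<otimes>\<^bsub>E\<^esub> y \<otimes>\<^bsub>E\<^esub> z" .
qed (use x y z in simp_all)

lemma commutator_inverse:
  assumes x: "x \<in> carrier E" and y: "y \<in> carrier E"
  shows "inv\<^bsub>E\<^esub> commutator E x y = commutator E y x"
  using x y by (simp add: commutator_def E.inv_mult_group E.m_assoc)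

lemma commutator_mult_right:
  assumes x: "x \<in> carrier E" and y: "y \<in> carrier E" and z: "z \<in> carrier E"
  shows "commutator E x (y \<otimes>\<^bsub>E\<^esub> z) = commutator E x y \<otimes>\<^bsub>E\<^esub> commutator E x z"
proof -
  have "commutator E x (y \<otimes>\<^bsub>E\<^esub> z) = inv\<^bsub>E\<^esub> (commutator E y x \<otimes>\<^bsub>E\<^esub> commutator E z x)"
    using commutator_inverse[of "y \<otimes>\<^bsub>E\<^esub> z" x] commutator_mult_left[OF y z x] x y z by simp
  also have "\<dots> = commutator E x z \<otimes>\<^bsub>E\<^esub> commutator E x y"
    using x y z by (simp add: E.inv_mult_group commutator_inverse)
  also have "\<dots> = commutator E x y \<otimes>\<^bsub>E\<^esub> commutator E x z"
    using kernel_central[OF commutator_in_kernel[OF x z]] x y by simp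
  finally show ?thesis .
qed

lemma commutator_kernel:
  assumes "m \<in> kernel E G p" "x \<in> carrier E"
  shows "commutator E m x = \<one>\<^bsub>E\<^esub>" "commutator E x m = \<one>\<^bsub>E\<^esub>"
  using kernel_central[OF assms] assms by (auto intro!: E.commutator_eqI simp: kernel_iff)

text \<open>The commutator only sees \<open>x\<close> and \<open>y\<close> modulo the central kernel, hence their images in \<open>G\<close>.\<close>
lemma commutator_cong:
  assumes x: "x \<in> carrier E" "x' \<in> carrier E" "p x = p x'"
    and y: "y \<in> carrier E" "y' \<in> carrier E" "p y = p y'"
  shows "commutator E x y = commutator E x' y'"
proof -
  have "x \<otimes>\<^bsub>E\<^esub> inv\<^bsub>E\<^esub> x' \<in> kernel E G p" "y \<otimes>\<^bsub>E\<^esub> inv\<^bsub>E\<^esub> y' \<in> kernel E G p"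
    using x y by (simp_all add: kernel_iff)
  moreover have "x = (x \<otimes>\<^bsub>E\<^esub> inv\<^bsub>E\<^esub> x') \<otimes>\<^bsub>E\<^esub> x'" "y = (y \<otimes>\<^bsub>E\<^esub> inv\<^bsub>E\<^esub> y') \<otimes>\<^bsub>E\<^esub> y'"
    using x y by (simp_all add: E.m_assoc)
  ultimately have "commutator E x y = commutator E x' y" "commutator E x' y = commutator E x' y'"
    using commutator_mult_left[of "x \<otimes>\<^bsub>E\<^esub> inv\<^bsub>E\<^esub> x'" x' y] commutator_kernel(1)[of "x \<otimes>\<^bsub>E\<^esub> inv\<^bsub>E\<^esub> x'" y]
      commutator_mult_right[of x' "y \<otimes>\<^bsub>E\<^esub> inv\<^bsub>E\<^esub> y'" y'] commutator_kernel(2)[of "y \<otimes>\<^bsub>E\<^esub> inv\<^bsub>E\<^esub> y'" x']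
      x y by simp_all
  then show ?thesis by simp
qed

lemma commutator_pow:
  assumes x: "x \<in> carrier E" and y: "y \<in> carrier E"
  shows "commutator E (x [^]\<^bsub>E\<^esub> (k :: nat)) y = commutator E x y [^]\<^bsub>E\<^esub> k"
proof (induction k)
  case 0
  show ?case using y commutator_kernel(1)[of "\<one>\<^bsub>E\<^esub>" y] by (simp add: kernel_iff)
next
  case (Suc k)
  then show ?case using x y by (simp add: commutator_mult_left)
qed

lemma commutator_inv_inv:
  assumes x: "x \<in> carrier E" and y: "y \<in> carrier E"
  shows "commutator E (inv\<^bsub>E\<^esub> x) (inv\<^bsub>E\<^esub> y) = commutator E x y"
proof -
  have one: "\<one>\<^bsub>E\<^esub> \<in> kernel E G p" by (simp add: kernel_iff)
  have "commutator E (inv\<^bsub>E\<^esub> x) (inv\<^bsub>E\<^esub> y) \<otimes>\<^bsub>E\<^esub> commutator E x (inv\<^bsub>E\<^esub> y) = \<one>\<^bsub>E\<^esub>"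
    using commutator_mult_left[of "inv\<^bsub>E\<^esub> x" x "inv\<^bsub>E\<^esub> y"] commutator_kernel(1)[OF one] x y by simp
  moreover have "commutator E x y \<otimes>\<^bsub>E\<^esub> commutator E x (inv\<^bsub>E\<^esub> y) = \<one>\<^bsub>E\<^esub>"
    using commutator_mult_right[of x y "inv\<^bsub>E\<^esub> y"] commutator_kernel(2)[OF one] x y by simp
  ultimately show ?thesis
    using x y by (metis E.commutator_closed E.inv_closed E.right_cancel)
qed

lemma commutator_pow_order:
  assumes x: "x \<in> carrier E" and y: "y \<in> carrier E"
  shows "commutator E x y [^]\<^bsub>E\<^esub> order G = \<one>\<^bsub>E\<^esub>"
proof -
  have "x [^]\<^bsub>E\<^esub> order G \<in> kernel E G p"
    using x by (simp add: kernel_iff hom_nat_pow G.pow_order_eq_1)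
  then show ?thesis
    using commutator_pow[OF x y, of "order G"] commutator_kernel(1) y by simp
qed

abbreviation derived_part where "derived_part \<equiv> E\<lparr>carrier := derived E (carrier E)\<rparr>"

lemma comm_group_derived: "comm_group derived_part"
proof (rule group.group_comm_groupI)
  show "group derived_part"
    by (rule E.subgroup_imp_group[OF E.derived_is_subgroup]) simp
  fix x y assume "x \<in> carrier derived_part" "y \<in> carrier derived_part"
  then show "x \<otimes>\<^bsub>derived_part\<^esub> y = y \<otimes>\<^bsub>derived_part\<^esub> x"
    using derived_subset_kernel kernel_central[of x y] kernel_iff[of y] by auto
qed

lemma derived_eq_generate_lifts:
  assumes s: "\<And>g. g \<in> carrier G \<Longrightarrow> s g \<in> carrier E \<and> p (s g) = g"
  shows "derived E (carrier E) =
    generate E ((\<lambda>(g, h). commutator E (s g) (s h)) ` (carrier G \<times> carrier G))"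
proof -
  have "{commutator E x y | x y. x \<in> carrier E \<and> y \<in> carrier E} =
      (\<lambda>(g, h). commutator E (s g) (s h)) ` (carrier G \<times> carrier G)" (is "?A = ?B")
  proof (intro equalityI subsetI)
    fix c assume "c \<in> ?A"
    then obtain x y where "c = commutator E x y" "x \<in> carrier E" "y \<in> carrier E" by blast
    then show "c \<in> ?B"
      using s[of "p x"] s[of "p y"] commutator_cong[of x "s (p x)" y "s (p y)"]
      by (intro image_eqI[of _ _ "(p x, p y)"]) simp_all
  next
    fix c assume "c \<in> ?B"
    then obtain g h where "c = commutator E (s g) (s h)" "g \<in> carrier G" "h \<in> carrier G" by auto
    then show "c \<in> ?A" using s[of g] s[of h] by blast
  qed
  then show ?thesis by (simp add: E.derived_eq_generate_commutators)
qed

text \<open>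
  By \<open>commutator_cong\<close> there are finitely many commutators, and each of them is killed by the order
  of \<open>G\<close>.
\<close>
lemma finite_derived:
  assumes fin: "finite (carrier G)"
  shows "finite (derived E (carrier E))"
proof -
  define s where "s = inv_into (carrier E) p"
  have s: "s g \<in> carrier E \<and> p (s g) = g" if "g \<in> carrier G" for g
    using that p_surj by (simp add: s_def inv_into_into f_inv_into_f)
  let ?S = "(\<lambda>(g, h). commutator E (s g) (s h)) ` (carrier G \<times> carrier G)"
  have S: "?S \<subseteq> derived E (carrier E)"
    using s by (auto intro!: E.commutator_in_derived)
  have "finite (generate derived_part ?S)"
  proof (rule comm_group.finite_generate_torsion[OF comm_group_derived])
    show "finite ?S" using fin by simp
    show "?S \<subseteq> carrier derived_part" using S by simp
    fix a assume "a \<in> ?S"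
    then obtain g h where "a = commutator E (s g) (s h)" "g \<in> carrier G" "h \<in> carrier G" by auto
    then have "a [^]\<^bsub>E\<^esub> order G = \<one>\<^bsub>E\<^esub>" using commutator_pow_order s by simp
    then show "\<exists>m > (0 :: nat). a [^]\<^bsub>derived_part\<^esub> m = \<one>\<^bsub>derived_part\<^esub>"
      using fin G.order_gt_0_iff_finite
        E.nat_pow_consistent[of a "order G" "derived E (carrier E)"] by (intro exI[of _ "order G"]) simp
  qed
  then show ?thesis
    using E.generate_consistent[OF S E.derived_is_subgroup] derived_eq_generate_lifts[OF s] by simp
qed

end

section \<open>Free groups are projective\<close>

lemma word_val_simps [simp]:
  "word_val F [] = \<one>\<^bsub>F\<^esub>" "word_val F (l # w) = letter_val F l \<otimes>\<^bsub>F\<^esub> word_val F w"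
  by (simp_all add: word_val_def)

lemma (in group_hom) hom_word_val:
  assumes "set w \<subseteq> carrier G \<times> UNIV"
  shows "h (word_val G w) = word_val H (map (apfst h) w)"
  using assms
proof (induction w)
  case (Cons l w)
  then have l: "fst l \<in> carrier G" and w: "word_val G w \<in> carrier G"
    using G.word_val_closed[of w] by auto
  have "h (letter_val G l) = letter_val H (apfst h l)"
    using l by (cases l) (simp add: letter_val_def)
  moreover have "h (word_val G w) = word_val H (map (apfst h) w)"
    by (rule Cons.IH) (use Cons.prems in simp)
  ultimately show ?case
    using G.letter_val_closed[OF l] w by simp
qed simp

lemma (in group) word_val_map_push:
  assumes \<sigma>: "\<sigma> \<in> X \<rightarrow> carrier G" and l: "fst l \<in> X" and w: "set w \<subseteq> X \<times> UNIV"
  shows "word_val G (map (apfst \<sigma>) (push l w)) =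
    letter_val G (apfst \<sigma> l) \<otimes> word_val G (map (apfst \<sigma>) w)"
proof (cases w)
  case (Cons k u)
  have k: "\<sigma> (fst k) \<in> carrier G" and "set (map (apfst \<sigma>) u) \<subseteq> carrier G \<times> UNIV"
    using \<sigma> w Cons by auto
  then have u: "word_val G (map (apfst \<sigma>) u) \<in> carrier G" by (intro word_val_closed)
  show ?thesis
  proof (cases "fst l = fst k \<and> snd l \<noteq> snd k")
    case True
    then have "letter_val G (apfst \<sigma> l) \<otimes> letter_val G (apfst \<sigma> k) = \<one>"
      using k by (cases l; cases k) (auto simp: letter_val_def)
    moreover have "letter_val G (apfst \<sigma> l) \<in> carrier G" "letter_val G (apfst \<sigma> k) \<in> carrier G"
      using k True by (auto intro!: letter_val_closed)
    ultimately have "letter_val G (apfst \<sigma> l) \<otimes>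
        (letter_val G (apfst \<sigma> k) \<otimes> word_val G (map (apfst \<sigma>) u)) =
        word_val G (map (apfst \<sigma>) u)"
      using u by (simp flip: m_assoc)
    then show ?thesis using True Cons by simp
  qed (use Cons in auto)
qed simp

text \<open>
  The universal property of a free basis. The product of two reduced words is computed by repeated
  \<^const>\<open>push\<close>, and evaluating the images of letters is compatible with a single cancellation
  (\<open>word_val_map_push\<close>), although \<open>\<sigma>\<close> may identify letters and so need not preserve reducedness.
\<close>
lemma free_basis_extend:
  assumes F: "group F" and X: "free_basis F X" and E: "group E" and \<sigma>: "\<sigma> \<in> X \<rightarrow> carrier E"
  obtains \<phi> where "\<phi> \<in> hom F E" "\<And>w. w \<in> reduced_words X \<Longrightarrow>
    \<phi> (word_val F w) = word_val E (map (apfst \<sigma>) w)"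
proof -
  interpret F: group F by fact
  interpret E: group E by fact
  have XF: "X \<subseteq> carrier F" and bij: "bij_betw (word_val F) (reduced_words X) (carrier F)"
    using X by (auto simp: free_basis_def)
  let ?ev = "\<lambda>w. word_val E (map (apfst \<sigma>) w)"
  have ev_closed: "?ev w \<in> carrier E" if "set w \<subseteq> X \<times> UNIV" for w
    using that \<sigma> by (intro E.word_val_closed) fastforce
  have ev_mult: "?ev (foldr push u v) = ?ev u \<otimes>\<^bsub>E\<^esub> ?ev v"
    if "u \<in> lists (X \<times> UNIV)" "v \<in> reduced_words X" for u v
    using that(1)
  proof (induction u)
    case Nil
    have "?ev v \<in> carrier E" by (rule ev_closed) (use that(2) in \<open>simp add: reduced_words_iff\<close>)
    then show ?case by simp
  next
    case (Cons l u)
    have sets: "set (foldr push u v) \<subseteq> X \<times> UNIV" "set u \<subseteq> X \<times> UNIV" "set v \<subseteq> X \<times> UNIV"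
      using foldr_push_in[OF _ that(2), of u] Cons that(2) by (auto simp: reduced_words_iff)
    have l: "fst l \<in> X" using Cons by auto
    then have "letter_val E (apfst \<sigma> l) \<in> carrier E"
      using \<sigma> by (intro E.letter_val_closed) (cases l, auto)
    then show ?case
      using E.word_val_map_push[OF \<sigma> l sets(1)] Cons.IH ev_closed[OF sets(2)] ev_closed[OF sets(3)]
      by (simp only: foldr.simps comp_apply list.map word_val_simps E.m_assoc)
  qed
  define \<phi> where "\<phi> f = ?ev (inv_into (reduced_words X) (word_val F) f)" for f
  have \<phi>: "\<phi> (word_val F w) = ?ev w" if "w \<in> reduced_words X" for w
    using bij that by (simp add: \<phi>_def bij_betw_def)
  have "\<phi> \<in> hom F E"
  proof (rule homI)
    fix f assume "f \<in> carrier F"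
    then obtain w where w: "w \<in> reduced_words X" "f = word_val F w"
      using bij by (auto simp: bij_betw_def)
    then show "\<phi> f \<in> carrier E" using \<phi> ev_closed by (simp add: reduced_words_iff)
    fix g assume "g \<in> carrier F"
    then obtain v where v: "v \<in> reduced_words X" "g = word_val F v"
      using bij by (auto simp: bij_betw_def)
    have wl: "w \<in> lists (X \<times> UNIV)" using w by (simp add: reduced_words_def)
    have "w \<in> lists (carrier F \<times> UNIV)" "v \<in> reduced_words (carrier F)"
      using wl v XF by (auto simp: reduced_words_iff)
    then have "f \<otimes>\<^bsub>F\<^esub> g = word_val F (foldr push w v)"
      using F.word_val_mult w v by simp
    then show "\<phi> (f \<otimes>\<^bsub>F\<^esub> g) = \<phi> f \<otimes>\<^bsub>E\<^esub> \<phi> g"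
      using \<phi> foldr_push_in[OF wl v(1)] ev_mult[OF wl v(1)] w v by simp
  qed
  then show thesis using \<phi> that by blast
qed

text \<open>Send each basis element to a preimage of its value under \<open>\<pi>\<close>.\<close>
lemma free_group_projective:
  assumes free: "free_group F" and E: "group E" and G: "group G"
    and \<pi>: "\<pi> \<in> hom F G" and p: "p \<in> epi E G"
  obtains \<phi> where "\<phi> \<in> hom F E" "\<And>f. f \<in> carrier F \<Longrightarrow> p (\<phi> f) = \<pi> f"
proof -
  obtain X where F: "group F" and X: "free_basis F X" using free by (auto simp: free_group_def)
  have XF: "X \<subseteq> carrier F" and bij: "bij_betw (word_val F) (reduced_words X) (carrier F)"
    using X by (auto simp: free_basis_def)
  define \<sigma> where "\<sigma> x = inv_into (carrier E) p (\<pi> x)" for x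
  have \<sigma>: "\<sigma> x \<in> carrier E \<and> p (\<sigma> x) = \<pi> x" if "x \<in> X" for x
  proof -
    have "\<pi> x \<in> p ` carrier E" using that XF \<pi> p by (auto simp: hom_def epi_def)
    then show ?thesis by (simp add: \<sigma>_def inv_into_into f_inv_into_f)
  qed
  then have \<sigma>X: "\<sigma> \<in> X \<rightarrow> carrier E" by blast
  obtain \<phi> where \<phi>: "\<phi> \<in> hom F E" and ev: "\<And>w. w \<in> reduced_words X \<Longrightarrow>
      \<phi> (word_val F w) = word_val E (map (apfst \<sigma>) w)"
    using free_basis_extend[OF F X E \<sigma>X] by metis
  interpret p: group_hom E G p
    using E G p by (simp add: group_hom_def group_hom_axioms_def epi_def)
  interpret \<pi>: group_hom F G \<pi>
    using F G \<pi> by (simp add: group_hom_def group_hom_axioms_def)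
  have "p (\<phi> f) = \<pi> f" if "f \<in> carrier F" for f
  proof -
    obtain w where w: "w \<in> reduced_words X" "f = word_val F w"
      using bij \<open>f \<in> carrier F\<close> by (auto simp: bij_betw_def)
    then have wX: "set w \<subseteq> X \<times> UNIV" by (simp add: reduced_words_iff)
    then have "set (map (apfst \<sigma>) w) \<subseteq> carrier E \<times> UNIV" using \<sigma>X by auto
    then have "p (\<phi> f) = word_val G (map (apfst p) (map (apfst \<sigma>) w))"
      using w ev p.hom_word_val by simp
    also have "map (apfst p) (map (apfst \<sigma>) w) = map (apfst \<pi>) w"
      using \<sigma> wX by (auto simp: apfst_def map_prod_def)
    also have "word_val G \<dots> = \<pi> f"
      using \<pi>.hom_word_val[of w] wX XF w by (metis Sigma_mono order_trans subset_refl)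
    finally show ?thesis .
  qed
  with \<phi> that show thesis by blast
qed

section \<open>The universal central extension of a presented Abelian group\<close>

lemma (in group) inv_cancel [simp]:
  assumes "x \<in> carrier G" "y \<in> carrier G"
  shows "inv x \<otimes> (x \<otimes> y) = y" "x \<otimes> (inv x \<otimes> y) = y"
  using assms by (simp_all flip: m_assoc)

lemma (in group) commutator_conjugate:
  assumes "g \<in> carrier G" "x \<in> carrier G" "y \<in> carrier G"
  shows "g \<otimes> commutator G x y \<otimes> inv g = commutator G (g \<otimes> x \<otimes> inv g) (g \<otimes> y \<otimes> inv g)"
  using assms by (simp add: commutator_def inv_mult_group m_assoc)

definition commutator_subgroup :: "('a, 'm) monoid_scheme \<Rightarrow> 'a set \<Rightarrow> 'a set \<Rightarrow> 'a set" where
  "commutator_subgroup F A B = generate F {commutator F a b | a b. a \<in> A \<and> b \<in> B}"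

lemma (in group) commutator_subgroup_normal:
  assumes "A \<lhd> G" "B \<lhd> G"
  shows "commutator_subgroup G A B \<lhd> G"
  unfolding commutator_subgroup_def
proof (rule normal_generateI)
  note A = normal_invE[OF assms(1)] and B = normal_invE[OF assms(2)]
  show "{commutator G a b | a b. a \<in> A \<and> b \<in> B} \<subseteq> carrier G"
    using subgroup.mem_carrier[OF A(1)] subgroup.mem_carrier[OF B(1)] by auto
  fix h g assume "h \<in> {commutator G a b | a b. a \<in> A \<and> b \<in> B}" and g: "g \<in> carrier G"
  then obtain a b where h: "h = commutator G a b" and ab: "a \<in> A" "b \<in> B" by blast
  have "g \<otimes> h \<otimes> inv g = commutator G (g \<otimes> a \<otimes> inv g) (g \<otimes> b \<otimes> inv g)"
    unfolding h using g ab subgroup.mem_carrier[OF A(1)] subgroup.mem_carrier[OF B(1)]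
    by (intro commutator_conjugate)
  then show "g \<otimes> h \<otimes> inv g \<in> {commutator G a b | a b. a \<in> A \<and> b \<in> B}"
    using A(2)[OF g ab(1)] B(2)[OF g ab(2)] by blast
qed

text \<open>
  The quotient groups below are used through the homomorphism property of the coset maps;
  unfolding their operations to products of cosets would only obscure this.
\<close>
declare mult_FactGroup [simp del] one_FactGroup [simp del]

locale abelian_presentation = F: group F + G: comm_group G + \<pi>: group_hom F G \<pi>
  for F :: "('f, 'm) monoid_scheme" (structure) and G :: "('g, 'n) monoid_scheme" (structure)
    and \<pi> :: "'f \<Rightarrow> 'g" +
  assumes free: "free_group F" and \<pi>_surj: "\<pi> ` carrier F = carrier G"
begin

abbreviation N where "N \<equiv> kernel F G \<pi>"
abbreviation L where "L \<equiv> commutator_subgroup F (carrier F) N"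
text \<open>
  \<open>Q\<close> is the quotient of \<open>F\<close> that makes \<open>N\<close> central, and \<open>q'\<close> below is the map it induces onto
  \<open>G\<close>.
\<close>
abbreviation Q where "Q \<equiv> F Mod L"
abbreviation q where "q x \<equiv> L #>\<^bsub>F\<^esub> x"

lemma N_iff: "x \<in> N \<longleftrightarrow> x \<in> carrier F \<and> \<pi> x = \<one>\<^bsub>G\<^esub>"
  by (simp add: kernel_def)

lemma L_normal: "L \<lhd> F"
  by (intro F.commutator_subgroup_normal F.normal_self \<pi>.normal_kernel)

lemma L_subgroup: "subgroup L F"
  using L_normal by (rule normal_imp_subgroup)

lemma L_subset_N: "L \<subseteq> N"
  unfolding commutator_subgroup_def
  by (rule F.generate_subgroup_incl[OF _ \<pi>.subgroup_kernel])
    (auto simp: N_iff \<pi>.hom_commutator intro!: G.commutator_eqI)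

lemma group_Q: "group Q"
  by (rule normal.factorgroup_is_group[OF L_normal])

sublocale q: group_hom F Q q
  using normal.r_coset_hom_Mod[OF L_normal] group_Q
  by (simp add: group_hom_def group_hom_axioms_def F.is_group)

lemma q_surj: "q ` carrier F = carrier Q"
  by (simp add: carrier_FactGroup)

lemma q_eq_one_iff: "x \<in> carrier F \<Longrightarrow> q x = \<one>\<^bsub>Q\<^esub> \<longleftrightarrow> x \<in> L"
  unfolding one_FactGroup
  using F.coset_join1[OF _ _ L_subgroup] F.coset_join2[OF _ L_subgroup] by auto

definition q' where
  "q' = (SOME g. g \<in> hom Q G \<and> (\<forall>x \<in> carrier F. g (q x) = \<pi> x))"

lemma q': "q' \<in> hom Q G" "x \<in> carrier F \<Longrightarrow> q' (q x) = \<pi> x"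
proof -
  have "\<exists>g. g \<in> hom Q G \<and> (\<forall>x \<in> carrier F. g (q x) = \<pi> x)"
    using \<pi>.FactGroup_universal_kernel[OF L_normal L_subset_N] by metis
  from someI_ex[OF this]
  show "q' \<in> hom Q G" "x \<in> carrier F \<Longrightarrow> q' (q x) = \<pi> x" by (auto simp: q'_def)
qed

lemma q'_epi: "q' \<in> epi Q G"
proof -
  have "q' ` carrier Q = \<pi> ` carrier F"
    unfolding q_surj[symmetric] image_image by (rule image_cong) (simp_all add: q'(2))
  then show ?thesis using q'(1) \<pi>_surj by (simp add: epi_def)
qed

lemma q'_kernel_central:
  assumes m: "m \<in> kernel Q G q'" and c: "c \<in> carrier Q"
  shows "m \<otimes>\<^bsub>Q\<^esub> c = c \<otimes>\<^bsub>Q\<^esub> m"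
proof -
  have mQ: "m \<in> carrier Q" using m by (simp only: kernel_def mem_Collect_eq)
  obtain n where n: "n \<in> carrier F" "m = q n" using mQ unfolding q_surj[symmetric] by (rule imageE)
  obtain x where x: "x \<in> carrier F" "c = q x" using c unfolding q_surj[symmetric] by (rule imageE)
  have "q' m = \<one>\<^bsub>G\<^esub>" using m by (simp only: kernel_def mem_Collect_eq)
  then have "n \<in> N" using n q'(2)[OF n(1)] by (simp only: N_iff simp_thms)
  then have "commutator F x n \<in> L"
    unfolding commutator_subgroup_def using x by (intro generate.incl) blast
  then have "commutator Q c m = \<one>\<^bsub>Q\<^esub>"
    unfolding n(2) x(2) q.hom_commutator[OF x(1) n(1), symmetric]
    using q_eq_one_iff F.commutator_closed[OF x(1) n(1)] by blast
  then have "\<one>\<^bsub>Q\<^esub> \<otimes>\<^bsub>Q\<^esub> (m \<otimes>\<^bsub>Q\<^esub> c) = c \<otimes>\<^bsub>Q\<^esub> m"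
    using group.commutator_mult_swap[OF group_Q c mQ] by (simp only:)
  then show ?thesis by (simp only: q.H.l_one q.H.m_closed mQ c)
qed

lemma central_extension_Q: "central_extension Q G q'"
  by (rule central_extension.intro[OF group_Q G.comm_group_axioms
        central_extension_axioms.intro[OF q'_epi q'_kernel_central]])

sublocale Q: central_extension Q G q'
  by (rule central_extension_Q)

text \<open>
  A lift \<open>\<phi>\<close> of \<open>\<pi>\<close> to \<open>E\<close> exists as \<open>F\<close> is free. It takes \<open>N\<close> into the central kernel of \<open>p\<close>,
  so it kills \<open>[F,N]\<close> and factors through \<open>Q\<close>.
\<close>
lemma universal:
  assumes "central_extension E G p"
  obtains \<psi> where "\<psi> \<in> hom Q E" "\<And>c. c \<in> carrier Q \<Longrightarrow> p (\<psi> c) = q' c"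
proof -
  interpret E: central_extension E G p by fact
  obtain \<phi> where \<phi>: "\<phi> \<in> hom F E" "\<And>x. x \<in> carrier F \<Longrightarrow> p (\<phi> x) = \<pi> x"
    using free_group_projective[OF free E.E.is_group G.is_group \<pi>.homh E.p_epi] by metis
  interpret \<phi>: group_hom F E \<phi>
    using \<phi>(1) by (simp add: group_hom_def group_hom_axioms_def F.is_group E.E.is_group)
  have "L \<subseteq> kernel F E \<phi>"
    unfolding commutator_subgroup_def
  proof (rule F.generate_subgroup_incl[OF _ \<phi>.subgroup_kernel], clarify)
    fix x n assume x: "x \<in> carrier F" and n: "n \<in> N"
    then have "\<phi> n \<in> kernel E G p" by (simp add: N_iff E.kernel_iff \<phi>(2))
    then show "commutator F x n \<in> kernel F E \<phi>"
      using x n E.commutator_kernel(2) by (simp add: kernel_def \<phi>.hom_commutator)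
  qed
  then obtain \<psi> where \<psi>: "\<psi> \<in> hom Q E" "\<And>x. x \<in> carrier F \<Longrightarrow> \<psi> (q x) = \<phi> x"
    using \<phi>.FactGroup_universal_kernel[OF L_normal] by metis
  have "p (\<psi> c) = q' c" if "c \<in> carrier Q" for c
  proof -
    obtain x where x: "x \<in> carrier F" "c = q x"
      using \<open>c \<in> carrier Q\<close> unfolding q_surj[symmetric] by (rule imageE)
    then show ?thesis using \<psi>(2)[OF x(1)] \<phi>(2)[OF x(1)] q'(2)[OF x(1)] by (simp only:)
  qed
  with \<psi>(1) show thesis by (rule that)
qed

end

section \<open>Characters of the commutator subgroup of the universal central extension\<close>

text \<open>
  Every alternating bicharacter is the commutator pairing of some central extension of \<open>G\<close>: take
  the square root of \<open>\<beta>\<close> as cocycle.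
\<close>
lemma (in comm_group) central_extension_twisted_product:
  assumes odd: "odd (order G)" and \<beta>: "\<beta> \<in> alternating_bicharacters G"
  defines "f \<equiv> (\<lambda>p \<in> carrier G \<times> carrier G. \<beta> p ^ half_order)"
  shows "central_extension (twisted_product G f) G snd"
    and "s \<noteq> 0 \<Longrightarrow> t \<noteq> 0 \<Longrightarrow> x \<in> carrier G \<Longrightarrow> y \<in> carrier G \<Longrightarrow>
      commutator (twisted_product G f) (s, x) (t, y) = (\<beta> (x, y), \<one>)"
proof -
  note root = alternating_has_root[OF odd \<beta>, folded f_def]
  let ?E = "twisted_product G f"
  have E: "group ?E" using group_twisted_product[OF root(1)] .
  note nz = cochain_nonzero[OF cocycle_cochain[OF root(1)]]
  have f1: "f (\<one>, x) = 1" "f (x, \<one>) = 1" if "x \<in> carrier G" for x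
    using cocycle_one[OF root(1) that] root(3) by simp_all
  have "snd \<in> hom ?E G" by (rule homI) auto
  moreover have "snd ` carrier ?E = carrier G"
    by (simp add: snd_image_times) (metis UNIV_I singletonD subsetD zero_neq_one)
  ultimately have "snd \<in> epi ?E G" by (simp add: epi_def)
  moreover have "m \<otimes>\<^bsub>?E\<^esub> x = x \<otimes>\<^bsub>?E\<^esub> m" if "m \<in> kernel ?E G snd" "x \<in> carrier ?E" for m x
    using that f1 by (auto simp: kernel_def)
  ultimately show "central_extension ?E G snd"
    using E comm_group_axioms by (intro central_extension.intro central_extension_axioms.intro)
  assume st: "s \<noteq> 0" "t \<noteq> 0" and x: "x \<in> carrier G" and y: "y \<in> carrier G"
  have \<beta>f: "\<beta> (x, y) * f (y, x) = f (x, y)"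
    using root(2) skew_apply[OF x y, of f] nz[OF y x] by (simp add: field_simps)
  have \<beta>0: "\<beta> (x, y) \<noteq> 0" using \<beta>f nz[OF x y] by auto
  show "commutator ?E (s, x) (t, y) = (\<beta> (x, y), \<one>)"
  proof (rule group.commutator_eqI[OF E])
    show "(\<beta> (x, y), \<one>) \<otimes>\<^bsub>?E\<^esub> ((t, y) \<otimes>\<^bsub>?E\<^esub> (s, x)) = (s, x) \<otimes>\<^bsub>?E\<^esub> (t, y)"
      using x y f1 by (simp add: m_comm \<beta>f[symmetric])
  qed (use st x y \<beta>0 in auto)
qed

context abelian_presentation
begin

definition lift where "lift g = inv_into (carrier Q) q' g"

lemma lift: "g \<in> carrier G \<Longrightarrow> lift g \<in> carrier Q" "g \<in> carrier G \<Longrightarrow> q' (lift g) = g"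
  using Q.p_surj by (simp_all add: lift_def inv_into_into f_inv_into_f)

lemma characters_eqI:
  assumes \<chi>: "\<chi> \<in> characters Q.derived_part" and \<chi>': "\<chi>' \<in> characters Q.derived_part"
    and eq: "\<And>x y. x \<in> carrier G \<Longrightarrow> y \<in> carrier G \<Longrightarrow>
      \<chi> (commutator Q (lift x) (lift y)) = \<chi>' (commutator Q (lift x) (lift y))"
  shows "\<chi> = \<chi>'"
proof (rule extensionalityI)
  let ?A = "derived Q (carrier Q)"
  let ?S = "(\<lambda>(g, h). commutator Q (lift g) (lift h)) ` (carrier G \<times> carrier G)"
  have A: "subgroup ?A Q" by (rule q.H.derived_is_subgroup) simp
  have gA: "group Q.derived_part" using q.H.subgroup_imp_group[OF A] .
  have h: "\<chi> \<in> hom Q.derived_part Cstar" "\<chi>' \<in> hom Q.derived_part Cstar"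
    using \<chi> \<chi>' by (simp_all add: characters_def)
  have SA: "?S \<subseteq> ?A" using lift by (auto intro!: q.H.commutator_in_derived)
  have gen: "?A = generate Q ?S"
    by (rule Q.derived_eq_generate_lifts) (simp add: lift)
  fix a assume "a \<in> carrier Q.derived_part"
  then have "a \<in> generate Q ?S" using gen by simp
  then have "a \<in> ?A \<and> \<chi> a = \<chi>' a"
  proof (induction a rule: generate.induct)
    case one
    then show ?case
      using subgroup.one_closed[OF A] character_one[OF gA h(1)] character_one[OF gA h(2)] by simp
  next
    case (incl a)
    then show ?case using SA eq by auto
  next
    case (inv a)
    then have a: "a \<in> ?A" "\<chi> a = \<chi>' a" using SA eq by auto
    then show ?case
      using character_inv[OF gA h(1), of a] character_inv[OF gA h(2), of a]
        q.H.m_inv_consistent[OF A a(1)] subgroup.m_inv_closed[OF A a(1)] by simp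
  next
    case (eng a b)
    then show ?case
      using character_mult[OF gA h(1), of a b] character_mult[OF gA h(2), of a b]
        subgroup.m_closed[OF A] by simp
  qed
  then show "\<chi> a = \<chi>' a" by simp
qed (use \<chi> \<chi>' in \<open>simp_all add: characters_def\<close>)

text \<open>
  The transgression of a character of \<open>[Q,Q]\<close>, read as a bicharacter of \<open>G\<close>; the choice of
  \<^const>\<open>lift\<close> has no influence by \<open>Q.commutator_cong\<close>.
\<close>
definition transgression :: "('f set \<Rightarrow> complex) \<Rightarrow> 'g \<times> 'g \<Rightarrow> complex" where
  "transgression \<chi> = (\<lambda>(x, y) \<in> carrier G \<times> carrier G. \<chi> (commutator Q (lift x) (lift y)))"

lemma transgression_apply:
  "x \<in> carrier G \<Longrightarrow> y \<in> carrier G \<Longrightarrow> transgression \<chi> (x, y) = \<chi> (commutator Q (lift x) (lift y))"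
  by (simp add: transgression_def)

lemma transgression_alternating:
  assumes "\<chi> \<in> characters Q.derived_part"
  shows "transgression \<chi> \<in> alternating_bicharacters G"
proof -
  let ?A = "derived Q (carrier Q)"
  have \<chi>: "\<chi> \<in> hom Q.derived_part Cstar" using assms by (simp add: characters_def)
  have gA: "group Q.derived_part"
    by (rule q.H.subgroup_imp_group) (simp add: q.H.derived_is_subgroup)
  have mem: "commutator Q a b \<in> ?A" if "a \<in> carrier Q" "b \<in> carrier Q" for a b
    using that by (rule q.H.commutator_in_derived)
  have \<chi>m: "\<chi> (a \<otimes>\<^bsub>Q\<^esub> b) = \<chi> a * \<chi> b" if "a \<in> ?A" "b \<in> ?A" for a b
    using character_mult[OF gA \<chi>, of a b] that by simp
  have \<chi>0: "\<chi> a \<noteq> 0" if "a \<in> ?A" for a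
    using character_nonzero[OF gA \<chi>] that by simp
  have "commutator Q (lift x) (lift x) = \<one>\<^bsub>Q\<^esub>" if "x \<in> carrier G" for x
    using that lift by (intro q.H.commutator_eqI) simp_all
  then have diag: "transgression \<chi> (x, x) = 1" if "x \<in> carrier G" for x
    using that character_one[OF gA \<chi>] by (simp add: transgression_apply)
  have "commutator Q (lift (x \<otimes>\<^bsub>G\<^esub> y)) (lift z) =
      commutator Q (lift x) (lift z) \<otimes>\<^bsub>Q\<^esub> commutator Q (lift y) (lift z)"
    if "x \<in> carrier G" "y \<in> carrier G" "z \<in> carrier G" for x y z
    using that lift Q.commutator_cong[of "lift (x \<otimes>\<^bsub>G\<^esub> y)" "lift x \<otimes>\<^bsub>Q\<^esub> lift y" "lift z" "lift z"]
      Q.commutator_mult_left[of "lift x" "lift y" "lift z"] by simp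
  then have left: "transgression \<chi> (x \<otimes>\<^bsub>G\<^esub> y, z) = transgression \<chi> (x, z) * transgression \<chi> (y, z)"
    if "x \<in> carrier G" "y \<in> carrier G" "z \<in> carrier G" for x y z
    using that lift mem by (simp add: transgression_apply \<chi>m)
  have "commutator Q (lift x) (lift (y \<otimes>\<^bsub>G\<^esub> z)) =
      commutator Q (lift x) (lift y) \<otimes>\<^bsub>Q\<^esub> commutator Q (lift x) (lift z)"
    if "x \<in> carrier G" "y \<in> carrier G" "z \<in> carrier G" for x y z
    using that lift Q.commutator_cong[of "lift x" "lift x" "lift (y \<otimes>\<^bsub>G\<^esub> z)" "lift y \<otimes>\<^bsub>Q\<^esub> lift z"]
      Q.commutator_mult_right[of "lift x" "lift y" "lift z"] by simp
  then have right: "transgression \<chi> (x, y \<otimes>\<^bsub>G\<^esub> z) = transgression \<chi> (x, y) * transgression \<chi> (x, z)"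
    if "x \<in> carrier G" "y \<in> carrier G" "z \<in> carrier G" for x y z
    using that lift mem by (simp add: transgression_apply \<chi>m)
  have "transgression \<chi> \<in> carrier (cochains2 G)"
    unfolding transgression_def using lift mem \<chi>0 by (intro cochainI) auto
  then show ?thesis
    using diag left right by (simp add: alternating_bicharacters_def)
qed

text \<open>
  \<open>\<beta>\<close> is the commutator pairing of a twisted product, and \<open>\<psi>\<close> from \<open>Q\<close> to that product preserves
  commutators. On \<open>[Q,Q]\<close> the values of \<open>\<psi>\<close> lie in the central \<open>\<complex>\<^sup>*\<close>, so they form the desired
  character.
\<close>
lemma transgression_surj:
  assumes odd: "odd (order G)" and \<beta>: "\<beta> \<in> alternating_bicharacters G"
  obtains \<chi> where "\<chi> \<in> characters Q.derived_part" "transgression \<chi> = \<beta>"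
proof -
  let ?A = "derived Q (carrier Q)"
  define f where "f = (\<lambda>p \<in> carrier G \<times> carrier G. \<beta> p ^ G.half_order)"
  let ?E = "twisted_product G f"
  have f: "f \<in> cocycles2 G" "f (\<one>\<^bsub>G\<^esub>, \<one>\<^bsub>G\<^esub>) = 1"
    using G.alternating_has_root[OF odd \<beta>] by (simp_all add: f_def)
  have cE: "central_extension ?E G snd"
    using G.central_extension_twisted_product(1)[OF odd \<beta>] by (simp add: f_def)
  have comm: "commutator ?E u v = (\<beta> (snd u, snd v), \<one>\<^bsub>G\<^esub>)"
    if "u \<in> carrier ?E" "v \<in> carrier ?E" for u v
    using that G.central_extension_twisted_product(2)[OF odd \<beta>, of "fst u" "fst v" "snd u" "snd v"]
    by (cases u; cases v) (simp add: f_def)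
  obtain \<psi> where \<psi>: "\<psi> \<in> hom Q ?E" and over: "\<And>c. c \<in> carrier Q \<Longrightarrow> snd (\<psi> c) = q' c"
    using universal[OF cE] by metis
  interpret E: group ?E using G.group_twisted_product[OF f(1)] .
  interpret \<psi>: group_hom Q ?E \<psi>
    using \<psi> group_Q E.is_group by (simp add: group_hom_def group_hom_axioms_def)
  have A: "a \<in> carrier Q \<and> q' a = \<one>\<^bsub>G\<^esub>" if "a \<in> ?A" for a
    using that Q.derived_subset_kernel by (auto simp: kernel_def)
  have \<psi>A: "\<psi> a = (fst (\<psi> a), \<one>\<^bsub>G\<^esub>)" "fst (\<psi> a) \<noteq> 0" if "a \<in> ?A" for a
  proof -
    have "\<psi> a \<in> carrier ?E" using A[OF that] by (intro \<psi>.hom_closed) simp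
    then show "fst (\<psi> a) \<noteq> 0" by (cases "\<psi> a") simp
    show "\<psi> a = (fst (\<psi> a), \<one>\<^bsub>G\<^esub>)" using over[of a] A[OF that] by (metis prod.collapse)
  qed
  define \<chi> where "\<chi> = (\<lambda>a \<in> ?A. fst (\<psi> a))"
  have \<chi>: "\<chi> \<in> characters Q.derived_part"
    unfolding characters_def
  proof (intro IntI homI)
    fix a assume "a \<in> carrier Q.derived_part"
    then show "\<chi> a \<in> carrier Cstar" using \<psi>A(2) by (simp add: \<chi>_def)
  next
    fix a b assume a: "a \<in> carrier Q.derived_part" and b: "b \<in> carrier Q.derived_part"
    then have ab: "a \<otimes>\<^bsub>Q\<^esub> b \<in> ?A"
      using subgroup.m_closed[OF q.H.derived_is_subgroup[of "carrier Q"]] by simp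
    have "\<psi> (a \<otimes>\<^bsub>Q\<^esub> b) = (fst (\<psi> a), \<one>\<^bsub>G\<^esub>) \<otimes>\<^bsub>?E\<^esub> (fst (\<psi> b), \<one>\<^bsub>G\<^esub>)"
      using a b A \<psi>A(1)[symmetric] by simp
    then show "\<chi> (a \<otimes>\<^bsub>Q.derived_part\<^esub> b) = \<chi> a \<otimes>\<^bsub>Cstar\<^esub> \<chi> b"
      using a b ab f(2) by (simp add: \<chi>_def)
  qed (simp add: \<chi>_def)
  have "transgression \<chi> (x, y) = \<beta> (x, y)" if x: "x \<in> carrier G" and y: "y \<in> carrier G" for x y
  proof -
    have "\<psi> (commutator Q (lift x) (lift y)) = (\<beta> (x, y), \<one>\<^bsub>G\<^esub>)"
      using lift[OF x] lift[OF y] over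
        comm[OF \<psi>.hom_closed \<psi>.hom_closed, of "lift x" "lift y"] by (simp add: \<psi>.hom_commutator)
    then show ?thesis
      using x y lift[OF x] lift[OF y]
      by (simp add: transgression_apply \<chi>_def q.H.commutator_in_derived)
  qed
  moreover have "\<beta> \<in> carrier (cochains2 G)" "transgression \<chi> \<in> carrier (cochains2 G)"
    using \<beta> transgression_alternating[OF \<chi>] by (simp_all add: alternating_bicharacters_def)
  ultimately have "transgression \<chi> = \<beta>" by (intro cochain_eqI)
  with \<chi> show thesis by (rule that)
qed

theorem dual_derived_iso_alternating:
  assumes odd: "odd (order G)"
  shows "dual_group Q.derived_part \<cong> alternating_group G"
proof -
  have "transgression \<in> hom (dual_group Q.derived_part) (alternating_group G)"
  proof (rule homI)
    fix \<chi> assume "\<chi> \<in> carrier (dual_group Q.derived_part)"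
    then show "transgression \<chi> \<in> carrier (alternating_group G)"
      using transgression_alternating by (simp add: dual_group_def alternating_group_def)
  next
    fix \<chi> \<chi>'
    have "commutator Q (lift x) (lift y) \<in> derived Q (carrier Q)" if "x \<in> carrier G" "y \<in> carrier G" for x y
      using that lift by (intro q.H.commutator_in_derived)
    then show "transgression (\<chi> \<otimes>\<^bsub>dual_group Q.derived_part\<^esub> \<chi>') =
        transgression \<chi> \<otimes>\<^bsub>alternating_group G\<^esub> transgression \<chi>'"
      unfolding transgression_def dual_group_def alternating_group_def cochains2_def
      by (auto intro!: restrict_ext)
  qed
  moreover have "inj_on transgression (characters Q.derived_part)"
  proof (rule inj_onI)
    fix \<chi> \<chi>' assume \<chi>: "\<chi> \<in> characters Q.derived_part" "\<chi>' \<in> characters Q.derived_part"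
      and eq: "transgression \<chi> = transgression \<chi>'"
    show "\<chi> = \<chi>'"
      using \<chi>
    proof (rule characters_eqI)
      fix x y assume "x \<in> carrier G" "y \<in> carrier G"
      then show "\<chi> (commutator Q (lift x) (lift y)) = \<chi>' (commutator Q (lift x) (lift y))"
        using fun_cong[OF eq, of "(x, y)"] by (simp only: transgression_apply)
    qed
  qed
  moreover have "transgression ` characters Q.derived_part = alternating_bicharacters G"
  proof (intro equalityI subsetI)
    fix \<beta> assume "\<beta> \<in> alternating_bicharacters G"
    then show "\<beta> \<in> transgression ` characters Q.derived_part"
      by (rule transgression_surj[OF odd]) blast
  qed (use transgression_alternating in blast)
  ultimately show ?thesis
    by (intro is_isoI[of transgression] isoI bij_betw_imageI)
      (simp_all add: dual_group_def alternating_group_def)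
qed

corollary derived_iso_schur_multiplier:
  assumes "finite (carrier G)" and "odd (order G)"
  shows "Q.derived_part \<cong> schur_multiplier G"
proof -
  have "Q.derived_part \<cong> dual_group Q.derived_part"
    by (rule dual_group_iso[OF Q.comm_group_derived]) (simp add: Q.finite_derived[OF assms(1)])
  also have "\<dots> \<cong> alternating_group G"
    by (rule dual_derived_iso_alternating[OF assms(2)])
  also have "\<dots> \<cong> schur_multiplier G"
    by (rule G.schur_multiplier_iso_alternating[OF assms])
  finally show ?thesis .
qed

end

section \<open>The covering group of an Abelian group of odd order\<close>

context group
begin

lemma group_square: "group (G \<times>\<times> G)"
  by (rule DirProd_group[OF is_group is_group])

lemma derived_normal: "derived G (carrier G) \<lhd> G"
  by (rule derived_is_normal[OF normal_self])

lemma K2_iff: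
  "(a, b) \<in> K2 G \<longleftrightarrow> a \<in> carrier G \<and> b \<in> carrier G \<and> a \<otimes> b \<in> derived G (carrier G)"
proof -
  have "derived G (carrier G) #> x = derived G (carrier G) \<longleftrightarrow> x \<in> derived G (carrier G)"
    if "x \<in> carrier G" for x
    using coset_join1[OF _ that] coset_join2[OF that] derived_is_subgroup[of "carrier G"] by blast
  then show ?thesis
    by (auto simp: K2_def kernel_def abelianization_def one_FactGroup)
qed

lemma K2_subgroup: "subgroup (K2 G) (G \<times>\<times> G)"
proof -
  let ?D = "derived G (carrier G)"
  interpret Ab: comm_group "G Mod ?D" by (rule derived_quot_is_comm_group)
  interpret d: group_hom G "G Mod ?D" "\<lambda>x. ?D #> x"
    using normal.r_coset_hom_Mod[OF derived_normal] Ab.is_group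
    by (simp add: group_hom_def group_hom_axioms_def)
  have "(\<lambda>(a, b). ?D #> (a \<otimes> b)) \<in> hom (G \<times>\<times> G) (G Mod ?D)"
    by (rule homI) (auto simp: Ab.m_ac)
  then have "group_hom (G \<times>\<times> G) (G Mod ?D) (\<lambda>(a, b). ?D #> (a \<otimes> b))"
    using group_square Ab.is_group by (simp add: group_hom_def group_hom_axioms_def)
  then show ?thesis
    unfolding K2_def abelianization_def by (rule group_hom.subgroup_kernel)
qed

text \<open>Used to see that \<open>(a,b) \<mapsto> ab\<close> is multiplicative where \<open>b\<close> and \<open>c\<close> commute.\<close>
lemma middle_swap:
  assumes "a \<in> carrier G" "b \<in> carrier G" "c \<in> carrier G" "d \<in> carrier G" "c \<otimes> b = b \<otimes> c"
  shows "(a \<otimes> c) \<otimes> (b \<otimes> d) = (a \<otimes> b) \<otimes> (c \<otimes> d)"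
proof -
  have "(a \<otimes> c) \<otimes> (b \<otimes> d) = a \<otimes> ((c \<otimes> b) \<otimes> d)" using assms(1-4) by (simp add: m_assoc)
  also have "\<dots> = (a \<otimes> b) \<otimes> (c \<otimes> d)" unfolding assms(5) using assms(1-4) by (simp add: m_assoc)
  finally show ?thesis .
qed

end

context abelian_presentation
begin

abbreviation D where "D \<equiv> derived F (carrier F)"
abbreviation KF where "KF \<equiv> (F \<times>\<times> F)\<lparr>carrier := K2 F\<rparr>"

text \<open>
  The condition on the product says \<open>ab \<in> L\<close>; phrasing it in \<open>Q\<close>, where the images of elements of
  \<open>N\<close> are central, makes the closure properties immediate.
\<close>
definition W where "W = {(a, b). a \<in> N \<and> b \<in> N \<and> q a \<otimes>\<^bsub>Q\<^esub> q b = \<one>\<^bsub>Q\<^esub>}"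

lemma W_iff: "(a, b) \<in> W \<longleftrightarrow> a \<in> N \<and> b \<in> N \<and> q a \<otimes>\<^bsub>Q\<^esub> q b = \<one>\<^bsub>Q\<^esub>"
  by (simp add: W_def)

lemma NF: "n \<in> N \<Longrightarrow> n \<in> carrier F"
  by (simp add: N_iff)

lemma q_N_central:
  assumes n: "n \<in> N" and c: "c \<in> carrier Q"
  shows "q n \<otimes>\<^bsub>Q\<^esub> c = c \<otimes>\<^bsub>Q\<^esub> q n"
proof -
  have "q n \<in> kernel Q G q'"
    unfolding Q.kernel_iff using n q.hom_closed[OF NF[OF n]] q'(2)[OF NF[OF n]] by (simp add: N_iff)
  then show ?thesis using c by (rule Q.kernel_central)
qed

lemma inv_square: "a \<in> carrier F \<Longrightarrow> b \<in> carrier F \<Longrightarrow>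
    inv\<^bsub>F \<times>\<times> F\<^esub> (a, b) = (inv\<^bsub>F\<^esub> a, inv\<^bsub>F\<^esub> b)"
  by (rule inv_DirProd[OF F.is_group F.is_group])

lemma W_normal: "W \<lhd> F \<times>\<times> F"
proof (rule group.normal_invI[OF F.group_square])
  show "subgroup W (F \<times>\<times> F)"
  proof (rule group.subgroupI[OF F.group_square])
    show "W \<subseteq> carrier (F \<times>\<times> F)" using NF by (auto simp: W_def)
    have "(\<one>\<^bsub>F\<^esub>, \<one>\<^bsub>F\<^esub>) \<in> W" by (simp add: W_iff N_iff)
    then show "W \<noteq> {}" by blast
  next
    fix u assume "u \<in> W"
    then obtain a b where u: "u = (a, b)" "a \<in> N" "b \<in> N" "q a \<otimes>\<^bsub>Q\<^esub> q b = \<one>\<^bsub>Q\<^esub>"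
      by (cases u) (simp add: W_iff)
    have "q (inv\<^bsub>F\<^esub> a) \<otimes>\<^bsub>Q\<^esub> q (inv\<^bsub>F\<^esub> b) = inv\<^bsub>Q\<^esub> (q b \<otimes>\<^bsub>Q\<^esub> q a)"
      using u NF by (simp add: q.H.inv_mult_group)
    also have "q b \<otimes>\<^bsub>Q\<^esub> q a = \<one>\<^bsub>Q\<^esub>"
      using u(4) NF[OF u(3)] by (simp add: q_N_central[OF u(2), of "q b", symmetric])
    finally have "q (inv\<^bsub>F\<^esub> a) \<otimes>\<^bsub>Q\<^esub> q (inv\<^bsub>F\<^esub> b) = \<one>\<^bsub>Q\<^esub>"
      by simp
    then show "inv\<^bsub>F \<times>\<times> F\<^esub> u \<in> W"
      using u by (simp add: inv_square W_iff N_iff)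
  next
    fix u v assume "u \<in> W" "v \<in> W"
    then obtain a b c d where u: "u = (a, b)" "a \<in> N" "b \<in> N" "q a \<otimes>\<^bsub>Q\<^esub> q b = \<one>\<^bsub>Q\<^esub>"
      and v: "v = (c, d)" "c \<in> N" "d \<in> N" "q c \<otimes>\<^bsub>Q\<^esub> q d = \<one>\<^bsub>Q\<^esub>"
      by (cases u; cases v) (simp add: W_iff)
    have "q (a \<otimes>\<^bsub>F\<^esub> c) \<otimes>\<^bsub>Q\<^esub> q (b \<otimes>\<^bsub>F\<^esub> d) = \<one>\<^bsub>Q\<^esub>"
      using u v NF q.H.middle_swap[of "q a" "q b" "q c" "q d"] q_N_central[of c "q b"] by simp
    then show "u \<otimes>\<^bsub>F \<times>\<times> F\<^esub> v \<in> W"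
      using u v by (simp add: W_iff N_iff)
  qed
  fix u v assume "u \<in> carrier (F \<times>\<times> F)" "v \<in> W"
  then obtain x y a b where u: "u = (x, y)" "x \<in> carrier F" "y \<in> carrier F"
    and v: "v = (a, b)" "a \<in> N" "b \<in> N" "q a \<otimes>\<^bsub>Q\<^esub> q b = \<one>\<^bsub>Q\<^esub>"
    by (cases u; cases v) (simp add: W_iff)
  have conj: "q (x \<otimes>\<^bsub>F\<^esub> n \<otimes>\<^bsub>F\<^esub> inv\<^bsub>F\<^esub> x) = q n" if "x \<in> carrier F" "n \<in> N" for x n
    using that NF[OF that(2)] q_N_central[OF that(2), of "q x", symmetric] by (simp add: q.H.m_assoc)
  have "x \<otimes>\<^bsub>F\<^esub> n \<otimes>\<^bsub>F\<^esub> inv\<^bsub>F\<^esub> x \<in> N" if "x \<in> carrier F" "n \<in> N" for x n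
    using F.normal_invE(2)[OF \<pi>.normal_kernel] that by blast
  then show "u \<otimes>\<^bsub>F \<times>\<times> F\<^esub> v \<otimes>\<^bsub>F \<times>\<times> F\<^esub> inv\<^bsub>F \<times>\<times> F\<^esub> u \<in> W"
    using u v by (simp add: inv_square W_iff conj)
qed

text \<open>
  \<open>W\<close> contains \<open>\<K>(N,2)\<close> since \<open>[N,N] \<subseteq> L\<close>. Conversely, a normal subgroup \<open>H\<close> above
  \<open>\<K>(N,2)\<close> contains the pairs \<open>(n,n\<inverse>)\<close> and their conjugates \<open>(xnx\<inverse>,n\<inverse>)\<close>, hence
  \<open>([x,n],1)\<close>, and \<open>(a,b) = (ab,1)(b\<inverse>,b)\<close>.
\<close>
lemma normal_closure_K2_kernel:
  "normal_closure (F \<times>\<times> F) (K2 (F\<lparr>carrier := N\<rparr>)) = W"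
proof (rule equalityI)
  have NG: "group (F\<lparr>carrier := N\<rparr>)" by (rule F.subgroup_imp_group[OF \<pi>.subgroup_kernel])
  have dN: "derived (F\<lparr>carrier := N\<rparr>) N = derived F N"
    by (rule F.derived_consistent[OF subset_refl \<pi>.subgroup_kernel])
  have K2N: "(a, b) \<in> K2 (F\<lparr>carrier := N\<rparr>) \<longleftrightarrow> a \<in> N \<and> b \<in> N \<and> a \<otimes>\<^bsub>F\<^esub> b \<in> derived F N" for a b
    using group.K2_iff[OF NG, of a b] by (simp add: dN)
  have dL: "derived F N \<subseteq> L"
    unfolding F.derived_eq_generate_commutators commutator_subgroup_def
    using NF by (intro F.mono_generate) blast
  have "u \<in> W" if u: "u \<in> K2 (F\<lparr>carrier := N\<rparr>)" for u
  proof -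
    obtain a b where ab: "u = (a, b)" by (cases u)
    then have "a \<in> N" "b \<in> N" "a \<otimes>\<^bsub>F\<^esub> b \<in> L" using u K2N dL by auto
    then show ?thesis using q_eq_one_iff[of "a \<otimes>\<^bsub>F\<^esub> b"] NF ab by (simp add: W_iff)
  qed
  then show "normal_closure (F \<times>\<times> F) (K2 (F\<lparr>carrier := N\<rparr>)) \<subseteq> W"
    unfolding normal_closure_def using W_normal by (intro Inter_lower) blast
  show "W \<subseteq> normal_closure (F \<times>\<times> F) (K2 (F\<lparr>carrier := N\<rparr>))"
    unfolding normal_closure_def
  proof (rule Inter_greatest)
    fix H assume "H \<in> {H. H \<lhd> F \<times>\<times> F \<and> K2 (F\<lparr>carrier := N\<rparr>) \<subseteq> H}"
    then have H: "H \<lhd> F \<times>\<times> F" and KH: "K2 (F\<lparr>carrier := N\<rparr>) \<subseteq> H" by auto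
    have sH: "subgroup H (F \<times>\<times> F)" using H by (rule normal_imp_subgroup)
    note mH = subgroup.m_closed[OF sH] and iH = subgroup.m_inv_closed[OF sH]
    have anti: "(n, inv\<^bsub>F\<^esub> n) \<in> H" if "n \<in> N" for n
    proof -
      have "\<one>\<^bsub>F\<^esub> \<in> derived F N" unfolding derived_def by (rule generate.one)
      then have "(n, inv\<^bsub>F\<^esub> n) \<in> K2 (F\<lparr>carrier := N\<rparr>)"
        using that by (simp add: K2N N_iff)
      then show ?thesis using KH by blast
    qed
    let ?T = "{x \<in> carrier F. (x, \<one>\<^bsub>F\<^esub>) \<in> H}"
    have "subgroup ?T F"
    proof (rule F.subgroupI)
      show "?T \<noteq> {}" using subgroup.one_closed[OF sH] by auto
      fix x assume "x \<in> ?T"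
      then show "inv\<^bsub>F\<^esub> x \<in> ?T" using iH[of "(x, \<one>\<^bsub>F\<^esub>)"] by (simp add: inv_square)
      fix y assume "y \<in> ?T"
      then show "x \<otimes>\<^bsub>F\<^esub> y \<in> ?T"
        using mH[of "(x, \<one>\<^bsub>F\<^esub>)" "(y, \<one>\<^bsub>F\<^esub>)"] \<open>x \<in> ?T\<close> by simp
    qed auto
    moreover have "commutator F x n \<in> ?T" if x: "x \<in> carrier F" and n: "n \<in> N" for x n
    proof -
      have "(x, \<one>\<^bsub>F\<^esub>) \<otimes>\<^bsub>F \<times>\<times> F\<^esub> (n, inv\<^bsub>F\<^esub> n) \<otimes>\<^bsub>F \<times>\<times> F\<^esub> inv\<^bsub>F \<times>\<times> F\<^esub> (x, \<one>\<^bsub>F\<^esub>) \<in> H"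
        by (rule group.normal_invE(2)[OF F.group_square H _ anti[OF n]]) (simp add: x)
      from mH[OF this iH[OF anti[OF n]]] show ?thesis
        using x NF[OF n] by (simp add: inv_square commutator_def F.m_assoc)
    qed
    ultimately have LT: "L \<subseteq> ?T"
      unfolding commutator_subgroup_def by (intro F.generate_subgroup_incl) auto
    show "W \<subseteq> H"
    proof
      fix u assume "u \<in> W"
      then obtain a b where u: "u = (a, b)" "a \<in> N" "b \<in> N" "q a \<otimes>\<^bsub>Q\<^esub> q b = \<one>\<^bsub>Q\<^esub>"
        by (cases u) (simp add: W_iff)
      then have "a \<otimes>\<^bsub>F\<^esub> b \<in> L" using q_eq_one_iff[of "a \<otimes>\<^bsub>F\<^esub> b"] NF by simp
      then have "(a \<otimes>\<^bsub>F\<^esub> b, \<one>\<^bsub>F\<^esub>) \<in> H" using LT by blast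
      moreover have "(inv\<^bsub>F\<^esub> b, b) \<in> H" using anti[of "inv\<^bsub>F\<^esub> b"] u(3) by (simp add: N_iff)
      ultimately have "(a \<otimes>\<^bsub>F\<^esub> b, \<one>\<^bsub>F\<^esub>) \<otimes>\<^bsub>F \<times>\<times> F\<^esub> (inv\<^bsub>F\<^esub> b, b) \<in> H" by (rule mH)
      then show "u \<in> H" using u NF by (simp add: F.m_assoc)
    qed
  qed
qed

lemma L_subset_D: "L \<subseteq> D"
  unfolding F.derived_eq_generate_commutators commutator_subgroup_def
  using NF by (intro F.mono_generate) blast

lemma D_subgroup: "subgroup D F"
  by (rule F.derived_is_subgroup) simp

lemma D_subset_N: "D \<subseteq> N"
  unfolding F.derived_eq_generate_commutators
  by (rule F.generate_subgroup_incl[OF _ \<pi>.subgroup_kernel])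
    (auto simp: N_iff \<pi>.hom_commutator G.m_comm intro!: G.commutator_eqI)

lemma DF: "d \<in> D \<Longrightarrow> d \<in> carrier F"
  using D_subset_N NF by blast

lemma q_image_D: "q ` D = derived Q (carrier Q)"
  using q.derived_img[OF subset_refl] q_surj by simp

lemma W_subset_K2: "W \<subseteq> K2 F"
proof
  fix u assume "u \<in> W"
  then obtain a b where "u = (a, b)" "a \<in> N" "b \<in> N" "q a \<otimes>\<^bsub>Q\<^esub> q b = \<one>\<^bsub>Q\<^esub>"
    by (cases u) (simp add: W_iff)
  then show "u \<in> K2 F"
    using q_eq_one_iff[of "a \<otimes>\<^bsub>F\<^esub> b"] NF L_subset_D by (auto simp: F.K2_iff)
qed

lemma group_KF: "group KF"
  by (rule group.subgroup_imp_group[OF F.group_square F.K2_subgroup])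

lemma W_normal_KF: "W \<lhd> KF"
  by (rule group.normal_restrict_supergroup[OF F.group_square F.K2_subgroup W_normal W_subset_K2])

abbreviation KT where "KT \<equiv> K2_tilde F \<pi> G"
abbreviation h where "h u \<equiv> W #>\<^bsub>F \<times>\<times> F\<^esub> u"

lemma KT_eq: "KT = KF Mod W"
  by (simp add: K2_tilde_def normal_closure_K2_kernel)

lemma group_KT: "group KT"
  unfolding KT_eq by (rule normal.factorgroup_is_group[OF W_normal_KF])

sublocale h: group_hom KF KT h
  using normal.r_coset_hom_Mod[OF W_normal_KF] group_KT group_KF
  by (simp add: group_hom_def group_hom_axioms_def KT_eq)

lemma h_surj: "carrier KT = h ` K2 F"
  by (simp add: KT_eq carrier_FactGroup)

lemma h_eq_one:
  assumes "w \<in> W"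
  shows "h w = \<one>\<^bsub>KT\<^esub>"
  using group.coset_join2[OF group_KF _ normal_imp_subgroup[OF W_normal_KF], of w] subsetD[OF W_subset_K2 assms] assms
  by (simp add: KT_eq one_FactGroup)

lemma h_eqI:
  assumes "(a, b) \<in> K2 F" "(c, d) \<in> K2 F" "q a = q c" "q b = q d"
  shows "h (a, b) = h (c, d)"
proof -
  have F: "a \<in> carrier F" "b \<in> carrier F" "c \<in> carrier F" "d \<in> carrier F"
    using assms by (simp_all add: F.K2_iff)
  have "q (a \<otimes>\<^bsub>F\<^esub> inv\<^bsub>F\<^esub> c) = \<one>\<^bsub>Q\<^esub>" "q (b \<otimes>\<^bsub>F\<^esub> inv\<^bsub>F\<^esub> d) = \<one>\<^bsub>Q\<^esub>"
    using F assms by simp_all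
  moreover from this have "a \<otimes>\<^bsub>F\<^esub> inv\<^bsub>F\<^esub> c \<in> L" "b \<otimes>\<^bsub>F\<^esub> inv\<^bsub>F\<^esub> d \<in> L"
    using F q_eq_one_iff[of "a \<otimes>\<^bsub>F\<^esub> inv\<^bsub>F\<^esub> c"] q_eq_one_iff[of "b \<otimes>\<^bsub>F\<^esub> inv\<^bsub>F\<^esub> d"] by auto
  note subsetD[OF L_subset_N this(1)] subsetD[OF L_subset_N this(2)]
  ultimately have w: "(a \<otimes>\<^bsub>F\<^esub> inv\<^bsub>F\<^esub> c, b \<otimes>\<^bsub>F\<^esub> inv\<^bsub>F\<^esub> d) \<in> W" by (simp add: W_iff)
  have "(a, b) = (a \<otimes>\<^bsub>F\<^esub> inv\<^bsub>F\<^esub> c, b \<otimes>\<^bsub>F\<^esub> inv\<^bsub>F\<^esub> d) \<otimes>\<^bsub>KF\<^esub> (c, d)"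
    using F by (simp add: F.m_assoc)
  then have "h (a, b) = h (a \<otimes>\<^bsub>F\<^esub> inv\<^bsub>F\<^esub> c, b \<otimes>\<^bsub>F\<^esub> inv\<^bsub>F\<^esub> d) \<otimes>\<^bsub>KT\<^esub> h (c, d)"
    using h.hom_mult[of "(a \<otimes>\<^bsub>F\<^esub> inv\<^bsub>F\<^esub> c, b \<otimes>\<^bsub>F\<^esub> inv\<^bsub>F\<^esub> d)" "(c, d)"] w W_subset_K2 assms(2)
    by auto
  also have "\<dots> = h (c, d)"
    unfolding h_eq_one[OF w] using h.hom_closed[of "(c, d)"] assms(2) by simp
  finally show ?thesis .
qed

text \<open>
  Elements over \<open>\<one>\<close> are represented by pairs \<open>(d,1)\<close> with \<open>d \<in> D\<close>, as
  \<open>(a,b) = (ab,1)(b\<inverse>,b)\<close>.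
\<close>
lemma h_shift:
  assumes ab: "(a, b) \<in> K2 F" and a: "a \<in> N"
  shows "b \<in> N" "h (a, b) = h (a \<otimes>\<^bsub>F\<^esub> b, \<one>\<^bsub>F\<^esub>)"
proof -
  have F: "a \<in> carrier F" "b \<in> carrier F" "a \<otimes>\<^bsub>F\<^esub> b \<in> D"
    using ab by (simp_all add: F.K2_iff)
  have "\<pi> (a \<otimes>\<^bsub>F\<^esub> b) = \<one>\<^bsub>G\<^esub>" using F D_subset_N by (auto simp: N_iff)
  then show b: "b \<in> N" using F a by (simp add: N_iff)
  then have w: "(inv\<^bsub>F\<^esub> b, b) \<in> W" by (simp add: W_iff N_iff)
  have ab1: "(a \<otimes>\<^bsub>F\<^esub> b, \<one>\<^bsub>F\<^esub>) \<in> K2 F" using F by (simp add: F.K2_iff)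
  have "(a, b) = (a \<otimes>\<^bsub>F\<^esub> b, \<one>\<^bsub>F\<^esub>) \<otimes>\<^bsub>KF\<^esub> (inv\<^bsub>F\<^esub> b, b)"
    using F by (simp add: F.m_assoc)
  then have "h (a, b) = h (a \<otimes>\<^bsub>F\<^esub> b, \<one>\<^bsub>F\<^esub>) \<otimes>\<^bsub>KT\<^esub> h (inv\<^bsub>F\<^esub> b, b)"
    using h.hom_mult[of "(a \<otimes>\<^bsub>F\<^esub> b, \<one>\<^bsub>F\<^esub>)" "(inv\<^bsub>F\<^esub> b, b)"] w W_subset_K2 ab1 by auto
  also have "\<dots> = h (a \<otimes>\<^bsub>F\<^esub> b, \<one>\<^bsub>F\<^esub>)"
    unfolding h_eq_one[OF w] using h.hom_closed[of "(a \<otimes>\<^bsub>F\<^esub> b, \<one>\<^bsub>F\<^esub>)"] ab1 by simp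
  finally show "h (a, b) = h (a \<otimes>\<^bsub>F\<^esub> b, \<one>\<^bsub>F\<^esub>)" .
qed

abbreviation proj where "proj \<equiv> K2_tilde_proj \<pi>"

lemma proj_h: "(a, b) \<in> K2 F \<Longrightarrow> proj (h (a, b)) = \<pi> a"
proof -
  assume "(a, b) \<in> K2 F"
  then have F: "a \<in> carrier F" "b \<in> carrier F" by (simp_all add: F.K2_iff)
  have "(\<one>\<^bsub>F\<^esub>, \<one>\<^bsub>F\<^esub>) \<in> W" by (simp add: W_iff N_iff)
  have "(\<lambda>(a, b). (\<pi> a, \<pi> b)) ` h (a, b) = {(\<pi> a, \<pi> b)}"
  proof (intro equalityI subsetI)
    fix z assume "z \<in> (\<lambda>(a, b). (\<pi> a, \<pi> b)) ` h (a, b)"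
    then obtain w v where "(w, v) \<in> W" "z = (\<pi> (w \<otimes>\<^bsub>F\<^esub> a), \<pi> (v \<otimes>\<^bsub>F\<^esub> b))"
      by (auto simp: r_coset_def)
    then show "z \<in> {(\<pi> a, \<pi> b)}" using F by (simp add: W_iff N_iff)
  next
    fix z assume "z \<in> {(\<pi> a, \<pi> b)}"
    moreover have "(a, b) \<in> h (a, b)"
      using \<open>(\<one>\<^bsub>F\<^esub>, \<one>\<^bsub>F\<^esub>) \<in> W\<close> F by (force simp: r_coset_def)
    ultimately show "z \<in> (\<lambda>(a, b). (\<pi> a, \<pi> b)) ` h (a, b)" by force
  qed
  then show ?thesis by (simp add: K2_tilde_proj_def K2_tilde_map_def)
qed

lemma KT_cases:
  assumes "X \<in> carrier KT"
  obtains a b where "(a, b) \<in> K2 F" "X = h (a, b)"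
  using assms unfolding h_surj by auto

lemma proj_epi: "proj \<in> epi KT G"
proof -
  have "proj \<in> hom KT G"
  proof (rule homI)
    fix X assume "X \<in> carrier KT"
    then obtain a b where X: "(a, b) \<in> K2 F" "X = h (a, b)" by (rule KT_cases)
    then have a: "a \<in> carrier F" by (simp add: F.K2_iff)
    then show "proj X \<in> carrier G" unfolding X(2) proj_h[OF X(1)] by simp
    fix Y assume "Y \<in> carrier KT"
    then obtain c d where Y: "(c, d) \<in> K2 F" "Y = h (c, d)" by (rule KT_cases)
    have "X \<otimes>\<^bsub>KT\<^esub> Y = h (a \<otimes>\<^bsub>F\<^esub> c, b \<otimes>\<^bsub>F\<^esub> d)"
      using h.hom_mult[of "(a, b)" "(c, d)"] X Y by simp
    moreover have "(a \<otimes>\<^bsub>F\<^esub> c, b \<otimes>\<^bsub>F\<^esub> d) \<in> K2 F"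
      using subgroup.m_closed[OF F.K2_subgroup X(1) Y(1)] by simp
    moreover have "c \<in> carrier F" using Y by (simp add: F.K2_iff)
    ultimately show "proj (X \<otimes>\<^bsub>KT\<^esub> Y) = proj X \<otimes>\<^bsub>G\<^esub> proj Y"
      using X Y a by (simp add: proj_h)
  qed
  moreover have "proj ` carrier KT = carrier G"
  proof (intro equalityI subsetI)
    fix g assume "g \<in> carrier G"
    then obtain a where a: "a \<in> carrier F" "g = \<pi> a" using \<pi>_surj by auto
    then have "(a, inv\<^bsub>F\<^esub> a) \<in> K2 F"
      using subgroup.one_closed[OF D_subgroup] by (simp add: F.K2_iff)
    then show "g \<in> proj ` carrier KT"
      unfolding h_surj using a by (intro image_eqI[of _ _ "h (a, inv\<^bsub>F\<^esub> a)"]) (simp_all add: proj_h)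
  qed (use calculation in \<open>auto simp: hom_def\<close>)
  ultimately show ?thesis by (simp add: epi_def)
qed

lemma kernel_proj: "kernel KT G proj = h ` {(a, b) \<in> K2 F. a \<in> N}"
proof (intro equalityI subsetI)
  fix X assume X: "X \<in> kernel KT G proj"
  then have "X \<in> carrier KT" by (simp add: kernel_def)
  then obtain a b where ab: "(a, b) \<in> K2 F" "X = h (a, b)" by (rule KT_cases)
  moreover have "a \<in> carrier F" using ab(1) by (simp add: F.K2_iff)
  ultimately have "a \<in> N" using X by (simp add: kernel_def proj_h)
  then show "X \<in> h ` {(a, b) \<in> K2 F. a \<in> N}" using ab by blast
next
  fix X assume "X \<in> h ` {(a, b) \<in> K2 F. a \<in> N}"
  then obtain a b where "(a, b) \<in> K2 F" "a \<in> N" "X = h (a, b)" by auto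
  then show "X \<in> kernel KT G proj" by (simp add: kernel_def proj_h N_iff h_surj)
qed

lemma kernel_proj_central:
  assumes "X \<in> kernel KT G proj" "Y \<in> carrier KT"
  shows "X \<otimes>\<^bsub>KT\<^esub> Y = Y \<otimes>\<^bsub>KT\<^esub> X"
proof -
  obtain a b where ab: "(a, b) \<in> K2 F" "a \<in> N" "X = h (a, b)"
    using assms(1) unfolding kernel_proj by auto
  obtain c d where cd: "(c, d) \<in> K2 F" "Y = h (c, d)" using assms(2) by (rule KT_cases)
  have b: "b \<in> N" using h_shift(1)[OF ab(1,2)] .
  have F: "c \<in> carrier F" "d \<in> carrier F" using cd by (simp_all add: F.K2_iff)
  have "(a \<otimes>\<^bsub>F\<^esub> c, b \<otimes>\<^bsub>F\<^esub> d) \<in> K2 F" "(c \<otimes>\<^bsub>F\<^esub> a, d \<otimes>\<^bsub>F\<^esub> b) \<in> K2 F"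
    using subgroup.m_closed[OF F.K2_subgroup ab(1) cd(1)]
      subgroup.m_closed[OF F.K2_subgroup cd(1) ab(1)] by simp_all
  then have "h (a \<otimes>\<^bsub>F\<^esub> c, b \<otimes>\<^bsub>F\<^esub> d) = h (c \<otimes>\<^bsub>F\<^esub> a, d \<otimes>\<^bsub>F\<^esub> b)"
    using F NF[OF ab(2)] NF[OF b] q_N_central[OF ab(2), of "q c"] q_N_central[OF b, of "q d"]
    by (intro h_eqI) simp_all
  then show ?thesis
    using h.hom_mult[of "(a, b)" "(c, d)"] h.hom_mult[of "(c, d)" "(a, b)"] ab cd by simp
qed

text \<open>
  Hopf's formula: \<open>(a,b) \<mapsto> ab\<close> takes the pairs over \<open>\<one>\<close> onto \<open>D\<close>, and modulo \<open>L\<close> it is a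
  homomorphism with kernel \<open>W\<close>.
\<close>
lemma kernel_proj_iso_derived: "KT\<lparr>carrier := kernel KT G proj\<rparr> \<cong> Q.derived_part"
proof -
  let ?K = "{(a, b) \<in> K2 F. a \<in> N}"
  let ?KK = "KF\<lparr>carrier := ?K\<rparr>"
  let ?\<kappa> = "\<lambda>(a, b). q (a \<otimes>\<^bsub>F\<^esub> b)"
  have "(\<lambda>(a, b). \<pi> a) \<in> hom KF G"
  proof (rule homI)
    fix u v assume "u \<in> carrier KF" "v \<in> carrier KF"
    then show "(case u \<otimes>\<^bsub>KF\<^esub> v of (a, b) \<Rightarrow> \<pi> a) = (case u of (a, b) \<Rightarrow> \<pi> a) \<otimes>\<^bsub>G\<^esub> (case v of (a, b) \<Rightarrow> \<pi> a)"
      by (cases u; cases v) (simp add: F.K2_iff)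
  next
    fix u assume "u \<in> carrier KF"
    then show "(case u of (a, b) \<Rightarrow> \<pi> a) \<in> carrier G"
      by (cases u) (simp add: F.K2_iff)
  qed
  then have fst_hom: "group_hom KF G (\<lambda>(a, b). \<pi> a)"
    using group_KF G.is_group by (simp add: group_hom_def group_hom_axioms_def)
  have ker_fst: "kernel KF G (\<lambda>(a, b). \<pi> a) = ?K"
  proof (rule Set.set_eqI)
    fix u
    show "u \<in> kernel KF G (\<lambda>(a, b). \<pi> a) \<longleftrightarrow> u \<in> ?K"
      by (cases u) (auto simp: kernel_def F.K2_iff)
  qed
  have "subgroup ?K KF"
    using group_hom.subgroup_kernel[OF fst_hom] unfolding ker_fst .
  then have KK: "group ?KK" by (rule group.subgroup_imp_group[OF group_KF])
  have A: "q d \<in> derived Q (carrier Q)" if "d \<in> D" for d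
    using that q_image_D by blast
  have "?\<kappa> \<in> hom ?KK Q.derived_part"
  proof (rule homI)
    fix u assume "u \<in> carrier ?KK"
    then show "?\<kappa> u \<in> carrier Q.derived_part" using A by (auto simp: F.K2_iff)
  next
    fix u v assume "u \<in> carrier ?KK" "v \<in> carrier ?KK"
    then obtain a b c d where u: "u = (a, b)" "a \<in> carrier F" "b \<in> carrier F"
      and v: "v = (c, d)" "c \<in> carrier F" "d \<in> carrier F" "c \<in> N"
      by (cases u; cases v) (simp add: F.K2_iff)
    then show "?\<kappa> (u \<otimes>\<^bsub>?KK\<^esub> v) = ?\<kappa> u \<otimes>\<^bsub>Q.derived_part\<^esub> ?\<kappa> v"
      using q.H.middle_swap[of "q a" "q b" "q c" "q d"] q_N_central[OF v(4), of "q b"] by simp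
  qed
  then interpret \<kappa>: group_hom ?KK Q.derived_part ?\<kappa>
    using KK Q.comm_group_derived by (simp add: group_hom_def group_hom_axioms_def comm_group.axioms(2))
  have "?\<kappa> ` carrier ?KK = carrier Q.derived_part"
  proof (intro equalityI subsetI)
    fix x assume "x \<in> carrier Q.derived_part"
    then obtain d where d: "d \<in> D" "x = q d" using q_image_D by auto
    then have "(d, \<one>\<^bsub>F\<^esub>) \<in> ?K" using DF D_subset_N by (auto simp: F.K2_iff)
    then show "x \<in> ?\<kappa> ` carrier ?KK" using d DF by (intro image_eqI[of _ _ "(d, \<one>\<^bsub>F\<^esub>)"]) simp_all
  qed (use \<kappa>.hom_closed in blast)
  then have "?KK Mod kernel ?KK Q.derived_part ?\<kappa> \<cong> Q.derived_part"
    by (rule \<kappa>.FactGroup_iso)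
  moreover have "kernel ?KK Q.derived_part ?\<kappa> = W"
  proof (intro equalityI subsetI)
    fix u assume "u \<in> kernel ?KK Q.derived_part ?\<kappa>"
    then obtain a b where u: "u = (a, b)" "(a, b) \<in> K2 F" "a \<in> N" "q (a \<otimes>\<^bsub>F\<^esub> b) = \<one>\<^bsub>Q\<^esub>"
      by (cases u) (simp add: kernel_def)
    then show "u \<in> W" using h_shift(1)[OF u(2,3)] NF by (simp add: W_iff F.K2_iff)
  next
    fix u assume u: "u \<in> W"
    then obtain a b where ab: "u = (a, b)" "a \<in> N" "b \<in> N" "q a \<otimes>\<^bsub>Q\<^esub> q b = \<one>\<^bsub>Q\<^esub>"
      by (cases u) (simp add: W_iff)
    have "u \<in> carrier ?KK" using subsetD[OF W_subset_K2 u] ab by simp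
    moreover have "?\<kappa> u = \<one>\<^bsub>Q.derived_part\<^esub>" using ab NF[OF ab(2)] NF[OF ab(3)] by simp
    ultimately show "u \<in> kernel ?KK Q.derived_part ?\<kappa>"
      unfolding kernel_def[of ?KK] by (intro CollectI conjI)
  qed
  moreover have "?KK Mod W = KT\<lparr>carrier := kernel KT G proj\<rparr>"
    unfolding kernel_proj
    by (auto simp: KT_eq FactGroup_def RCOSETS_def r_coset_def set_mult_def fun_eq_iff)
  ultimately show ?thesis by simp
qed

text \<open>
  With \<open>z\<close> the power of \<open>x\<close> with exponent \<open>(n+1)/2\<close>, the commutator of \<open>(z,z\<inverse>)\<close> and
  \<open>(y,y\<inverse>)\<close> is \<open>([z,y],[z\<inverse>,y\<inverse>])\<close>, which is \<open>([z,y]\<^sup>2,1) = ([x,y],1)\<close> modulo \<open>W\<close>.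
\<close>
lemma kernel_proj_subset_derived:
  assumes odd: "odd (order G)"
  shows "kernel KT G proj \<subseteq> derived KT (carrier KT)"
proof -
  let ?\<Delta> = "derived KT (carrier KT)"
  have \<Delta>: "subgroup ?\<Delta> KT" by (rule h.H.derived_is_subgroup) simp
  have K2D: "(d, \<one>\<^bsub>F\<^esub>) \<in> K2 F" if "d \<in> D" for d
    using that DF by (simp add: F.K2_iff)
  have comm: "h (commutator F x y, \<one>\<^bsub>F\<^esub>) \<in> ?\<Delta>" if x: "x \<in> carrier F" and y: "y \<in> carrier F" for x y
  proof -
    define z where "z = x [^]\<^bsub>F\<^esub> G.half_order"
    have z: "z \<in> carrier F" using x by (simp add: z_def)
    let ?c = "commutator F z y" and ?d = "commutator F (inv\<^bsub>F\<^esub> z) (inv\<^bsub>F\<^esub> y)"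
    have K: "(v, inv\<^bsub>F\<^esub> v) \<in> K2 F" if "v \<in> carrier F" for v
      using that subgroup.one_closed[OF D_subgroup] by (simp add: F.K2_iff)
    have cD: "?c \<in> D" "?d \<in> D" "commutator F x y \<in> D"
      using x y z by (simp_all add: F.commutator_in_derived)
    then have cd: "(?c, ?d) \<in> K2 F" using DF subgroup.m_closed[OF D_subgroup] by (simp add: F.K2_iff)
    have hK: "h (z, inv\<^bsub>F\<^esub> z) \<in> carrier KT" "h (y, inv\<^bsub>F\<^esub> y) \<in> carrier KT"
      using h.hom_closed K y z by auto
    have "commutator KF (z, inv\<^bsub>F\<^esub> z) (y, inv\<^bsub>F\<^esub> y) = (?c, ?d)"
    proof (rule group.commutator_eqI[OF group_KF])
      show "(?c, ?d) \<otimes>\<^bsub>KF\<^esub> ((y, inv\<^bsub>F\<^esub> y) \<otimes>\<^bsub>KF\<^esub> (z, inv\<^bsub>F\<^esub> z)) = (z, inv\<^bsub>F\<^esub> z) \<otimes>\<^bsub>KF\<^esub> (y, inv\<^bsub>F\<^esub> y)"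
        using y z by (simp add: F.commutator_mult_swap)
    qed (use K y z cd in simp_all)
    then have "h (?c, ?d) = commutator KT (h (z, inv\<^bsub>F\<^esub> z)) (h (y, inv\<^bsub>F\<^esub> y))"
      using h.hom_commutator[of "(z, inv\<^bsub>F\<^esub> z)" "(y, inv\<^bsub>F\<^esub> y)"] K y z by simp
    then have "h (?c, ?d) \<in> ?\<Delta>" using h.H.commutator_in_derived[OF hK] by simp
    moreover have "h (?c, ?d) = h (?c \<otimes>\<^bsub>F\<^esub> ?d, \<one>\<^bsub>F\<^esub>)"
      using h_shift(2)[OF cd] cD D_subset_N by blast
    moreover have "h (?c \<otimes>\<^bsub>F\<^esub> ?d, \<one>\<^bsub>F\<^esub>) = h (commutator F x y, \<one>\<^bsub>F\<^esub>)"
    proof (rule h_eqI)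
      let ?k = "commutator Q (q x) (q y)"
      have "q ?c = ?k [^]\<^bsub>Q\<^esub> G.half_order"
        using x y Q.commutator_pow[of "q x" "q y"] by (simp add: q.hom_commutator z_def q.hom_nat_pow)
      moreover have "q ?d = q ?c"
        using y z Q.commutator_inv_inv[of "q z" "q y"] by (simp add: q.hom_commutator)
      ultimately have "q (?c \<otimes>\<^bsub>F\<^esub> ?d) = ?k [^]\<^bsub>Q\<^esub> Suc (order G)"
        using x y z by (simp add: q.H.nat_pow_mult G.double_half_order[OF odd] del: nat_pow_Suc)
      also have "\<dots> = q (commutator F x y)"
        using x y Q.commutator_pow_order[of "q x" "q y"] by (simp add: q.hom_commutator)
      finally show "q (?c \<otimes>\<^bsub>F\<^esub> ?d) = q (commutator F x y)" .
    qed (use cD K2D subgroup.m_closed[OF D_subgroup] in auto)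
    ultimately show ?thesis by simp
  qed
  have D: "h (d, \<one>\<^bsub>F\<^esub>) \<in> ?\<Delta> \<and> d \<in> D" if "d \<in> generate F {commutator F x y | x y. x \<in> carrier F \<and> y \<in> carrier F}" for d
    using that
  proof (induction d rule: generate.induct)
    case one
    then show ?case
      using h_eq_one[of "(\<one>\<^bsub>F\<^esub>, \<one>\<^bsub>F\<^esub>)"] subgroup.one_closed[OF \<Delta>] subgroup.one_closed[OF D_subgroup]
      by (simp add: W_iff N_iff)
  next
    case (incl d)
    then show ?case using comm F.commutator_in_derived by blast
  next
    case (inv d)
    then obtain x y where d: "d = commutator F x y" "x \<in> carrier F" "y \<in> carrier F" by blast
    then have "inv\<^bsub>F\<^esub> d = commutator F y x"
      by (simp add: commutator_def F.inv_mult_group F.m_assoc)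
    then show ?case using comm[OF d(3,2)] F.commutator_in_derived[OF d(3,2)] by simp
  next
    case (eng d e)
    have "h (d \<otimes>\<^bsub>F\<^esub> e, \<one>\<^bsub>F\<^esub>) = h (d, \<one>\<^bsub>F\<^esub>) \<otimes>\<^bsub>KT\<^esub> h (e, \<one>\<^bsub>F\<^esub>)"
      using h.hom_mult[of "(d, \<one>\<^bsub>F\<^esub>)" "(e, \<one>\<^bsub>F\<^esub>)"] eng K2D by simp
    then show ?case
      using eng subgroup.m_closed[OF \<Delta>] subgroup.m_closed[OF D_subgroup] by simp
  qed
  show ?thesis
  proof
    fix X assume "X \<in> kernel KT G proj"
    then obtain a b where ab: "(a, b) \<in> K2 F" "a \<in> N" "X = h (a, b)"
      unfolding kernel_proj by auto
    then have "a \<otimes>\<^bsub>F\<^esub> b \<in> D" by (simp add: F.K2_iff)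
    then show "X \<in> ?\<Delta>"
      using h_shift(2)[OF ab(1,2)] D ab(3) by (simp add: F.derived_eq_generate_commutators)
  qed
qed

theorem K2_tilde_is_cover:
  assumes "finite (carrier G)" and "odd (order G)"
  shows "is_cover G KT proj"
proof -
  have "KT\<lparr>carrier := kernel KT G proj\<rparr> \<cong> schur_multiplier G"
    using kernel_proj_iso_derived derived_iso_schur_multiplier[OF assms] by (rule iso_trans)
  then show ?thesis
    unfolding is_cover_def
    using assms(1) G.is_group group_KT proj_epi kernel_proj_central kernel_proj_subset_derived[OF assms(2)]
    by blast
qed

end

section \<open>Comparison with an arbitrary cover\<close>

text \<open>
  The map \<open>\<psi>\<close> need not be onto, but it hits every element modulo the kernel of \<open>p\<close>, and
  commutators do not see that kernel.
\<close>
lemma (in central_extension) derived_covered_by_lift: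
  assumes D: "central_extension D G r" and \<psi>: "\<psi> \<in> hom D E"
    and over: "\<And>c. c \<in> carrier D \<Longrightarrow> p (\<psi> c) = r c"
  shows "derived E (carrier E) = \<psi> ` derived D (carrier D)"
proof -
  interpret D: central_extension D G r by fact
  interpret \<psi>: group_hom D E \<psi>
    using \<psi> D.E.is_group E.is_group by (simp add: group_hom_def group_hom_axioms_def)
  let ?C = "\<lambda>H. {commutator H x y | x y. x \<in> carrier H \<and> y \<in> carrier H}"
  have "?C E \<subseteq> \<psi> ` derived D (carrier D)"
  proof clarify
    fix x y assume x: "x \<in> carrier E" and y: "y \<in> carrier E"
    have "p x \<in> r ` carrier D" "p y \<in> r ` carrier D" using x y by (simp_all add: D.p_surj)
    then obtain c d where c: "c \<in> carrier D" "p x = r c" and d: "d \<in> carrier D" "p y = r d" by auto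
    have "commutator E x y = commutator E (\<psi> c) (\<psi> d)"
      using x y c d over by (intro commutator_cong) simp_all
    also have "\<dots> = \<psi> (commutator D c d)" using c d by (simp add: \<psi>.hom_commutator)
    finally show "commutator E x y \<in> \<psi> ` derived D (carrier D)"
      using D.E.commutator_in_derived[OF c(1) d(1)] by blast
  qed
  moreover have "subgroup (\<psi> ` derived D (carrier D)) E"
    by (rule \<psi>.subgroup_img_is_subgroup) (simp add: D.E.derived_is_subgroup)
  ultimately have "derived E (carrier E) \<subseteq> \<psi> ` derived D (carrier D)"
    unfolding E.derived_eq_generate_commutators by (intro E.generate_subgroup_incl)
  moreover have "\<psi> ` derived D (carrier D) \<subseteq> derived E (carrier E)"
    unfolding \<psi>.derived_img[OF subset_refl, symmetric]
    by (rule E.mono_derived) auto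
  ultimately show ?thesis by blast
qed

context central_extension
begin

text \<open>As before, \<open>(g,h) = (gh,1)(h\<inverse>,h)\<close>.\<close>
lemma cover_subgroup_eq:
  "cover_subgroup E (kernel E G p) = {(g, h). g \<in> carrier E \<and> h \<in> carrier E \<and> g \<otimes>\<^bsub>E\<^esub> h \<in> kernel E G p}"
  (is "_ = ?S")
proof (rule equalityI)
  have iS: "inv\<^bsub>E \<times>\<times> E\<^esub> (x, y) = (inv\<^bsub>E\<^esub> x, inv\<^bsub>E\<^esub> y)" if "x \<in> carrier E" "y \<in> carrier E" for x y
    by (rule inv_DirProd[OF E.is_group E.is_group that])
  have S: "subgroup ?S (E \<times>\<times> E)"
  proof (rule group.subgroupI[OF E.group_square])
    have "(\<one>\<^bsub>E\<^esub>, \<one>\<^bsub>E\<^esub>) \<in> ?S" by (simp add: kernel_iff)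
    then show "?S \<noteq> {}" by blast
  next
    fix u assume "u \<in> ?S"
    then obtain g h where u: "u = (g, h)" "g \<in> carrier E" "h \<in> carrier E" "p g \<otimes>\<^bsub>G\<^esub> p h = \<one>\<^bsub>G\<^esub>"
      by (cases u) (auto simp: kernel_iff)
    then have "inv\<^bsub>G\<^esub> p g \<otimes>\<^bsub>G\<^esub> inv\<^bsub>G\<^esub> p h = \<one>\<^bsub>G\<^esub>" by (simp flip: G.inv_mult)
    then show "inv\<^bsub>E \<times>\<times> E\<^esub> u \<in> ?S" using u by (simp add: iS kernel_iff)
  next
    fix u v assume "u \<in> ?S" "v \<in> ?S"
    then obtain g h k l where "u = (g, h)" "g \<in> carrier E" "h \<in> carrier E" "p g \<otimes>\<^bsub>G\<^esub> p h = \<one>\<^bsub>G\<^esub>"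
      "v = (k, l)" "k \<in> carrier E" "l \<in> carrier E" "p k \<otimes>\<^bsub>G\<^esub> p l = \<one>\<^bsub>G\<^esub>"
      by (cases u; cases v) (auto simp: kernel_iff)
    then show "u \<otimes>\<^bsub>E \<times>\<times> E\<^esub> v \<in> ?S"
      using G.middle_swap[of "p g" "p h" "p k" "p l"] G.m_comm[of "p k" "p h"]
      by (simp add: kernel_iff)
  qed auto
  then show "cover_subgroup E (kernel E G p) \<subseteq> ?S"
    unfolding cover_subgroup_def
    by (rule group.generate_subgroup_incl[OF E.group_square, rotated]) (auto simp: kernel_iff)
  show "?S \<subseteq> cover_subgroup E (kernel E G p)"
  proof
    fix u assume "u \<in> ?S"
    then obtain g h where u: "u = (g, h)" "g \<in> carrier E" "h \<in> carrier E" "g \<otimes>\<^bsub>E\<^esub> h \<in> kernel E G p"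
      by (cases u) simp
    have "(g \<otimes>\<^bsub>E\<^esub> h, \<one>\<^bsub>E\<^esub>) \<otimes>\<^bsub>E \<times>\<times> E\<^esub> (inv\<^bsub>E\<^esub> h, inv\<^bsub>E\<^esub> (inv\<^bsub>E\<^esub> h)) \<in> cover_subgroup E (kernel E G p)"
      unfolding cover_subgroup_def
    proof (rule generate.eng)
      show "(g \<otimes>\<^bsub>E\<^esub> h, \<one>\<^bsub>E\<^esub>) \<in> generate (E \<times>\<times> E) ({(g, inv\<^bsub>E\<^esub> g) | g. g \<in> carrier E} \<union>
          {(m, \<one>\<^bsub>E\<^esub>) | m. m \<in> kernel E G p})"
        using u(4) by (intro generate.incl UnI2) blast
      show "(inv\<^bsub>E\<^esub> h, inv\<^bsub>E\<^esub> (inv\<^bsub>E\<^esub> h)) \<in> generate (E \<times>\<times> E) ({(g, inv\<^bsub>E\<^esub> g) | g. g \<in> carrier E} \<union>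
          {(m, \<one>\<^bsub>E\<^esub>) | m. m \<in> kernel E G p})"
        using E.inv_closed[OF u(3)] by (intro generate.incl UnI1) blast
    qed
    then show "u \<in> cover_subgroup E (kernel E G p)" using u by (simp add: E.m_assoc)
  qed
qed

lemma antidiagonal_eq:
  "antidiagonal E (kernel E G p) = {(m, inv\<^bsub>E\<^esub> m) | m. m \<in> kernel E G p}" (is "_ = ?T")
  and antidiagonal_normal: "antidiagonal E (kernel E G p) \<lhd> E \<times>\<times> E"
proof -
  have iS: "inv\<^bsub>E \<times>\<times> E\<^esub> (x, y) = (inv\<^bsub>E\<^esub> x, inv\<^bsub>E\<^esub> y)" if "x \<in> carrier E" "y \<in> carrier E" for x y
    by (rule inv_DirProd[OF E.is_group E.is_group that])
  note M = subgroup_kernel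
  note Mc = subgroup.mem_carrier[OF M]
  have T: "subgroup ?T (E \<times>\<times> E)"
  proof (rule group.subgroupI[OF E.group_square])
    show "?T \<subseteq> carrier (E \<times>\<times> E)" using Mc by auto
    show "?T \<noteq> {}" using subgroup.one_closed[OF M] by blast
  next
    fix u assume "u \<in> ?T"
    then obtain m where m: "u = (m, inv\<^bsub>E\<^esub> m)" "m \<in> kernel E G p" by blast
    then have "inv\<^bsub>E \<times>\<times> E\<^esub> u = (inv\<^bsub>E\<^esub> m, inv\<^bsub>E\<^esub> (inv\<^bsub>E\<^esub> m))" using Mc[OF m(2)] by (simp add: iS)
    then show "inv\<^bsub>E \<times>\<times> E\<^esub> u \<in> ?T" using subgroup.m_inv_closed[OF M m(2)] by blast
  next
    fix u v assume "u \<in> ?T" "v \<in> ?T"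
    then obtain m n where m: "u = (m, inv\<^bsub>E\<^esub> m)" "m \<in> kernel E G p"
      and n: "v = (n, inv\<^bsub>E\<^esub> n)" "n \<in> kernel E G p" by blast
    have "u \<otimes>\<^bsub>E \<times>\<times> E\<^esub> v = (m \<otimes>\<^bsub>E\<^esub> n, inv\<^bsub>E\<^esub> (m \<otimes>\<^bsub>E\<^esub> n))"
      using m n Mc[OF m(2)] Mc[OF n(2)] kernel_central[OF m(2) Mc[OF n(2)]]
      by (simp add: E.inv_mult_group)
    then show "u \<otimes>\<^bsub>E \<times>\<times> E\<^esub> v \<in> ?T" using subgroup.m_closed[OF M m(2) n(2)] by blast
  qed
  show eq: "antidiagonal E (kernel E G p) = ?T"
    unfolding antidiagonal_def
    by (rule group.generateI[OF E.group_square T, symmetric]) auto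
  show "antidiagonal E (kernel E G p) \<lhd> E \<times>\<times> E"
    unfolding eq
  proof (rule group.normal_invI[OF E.group_square T])
    fix u v assume "u \<in> carrier (E \<times>\<times> E)" "v \<in> ?T"
    then obtain x y m where u: "u = (x, y)" "x \<in> carrier E" "y \<in> carrier E"
      and m: "v = (m, inv\<^bsub>E\<^esub> m)" "m \<in> kernel E G p" by (cases u) auto
    have "x \<otimes>\<^bsub>E\<^esub> m \<otimes>\<^bsub>E\<^esub> inv\<^bsub>E\<^esub> x = m" "y \<otimes>\<^bsub>E\<^esub> inv\<^bsub>E\<^esub> m \<otimes>\<^bsub>E\<^esub> inv\<^bsub>E\<^esub> y = inv\<^bsub>E\<^esub> m"
      using u Mc[OF m(2)] kernel_central[OF m(2) u(2), symmetric]
        kernel_central[OF subgroup.m_inv_closed[OF M m(2)] u(3), symmetric]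
      by (simp_all add: E.m_assoc)
    then have "u \<otimes>\<^bsub>E \<times>\<times> E\<^esub> v \<otimes>\<^bsub>E \<times>\<times> E\<^esub> inv\<^bsub>E \<times>\<times> E\<^esub> u = v" using u m by (simp add: iS)
    then show "u \<otimes>\<^bsub>E \<times>\<times> E\<^esub> v \<otimes>\<^bsub>E \<times>\<times> E\<^esub> inv\<^bsub>E \<times>\<times> E\<^esub> u \<in> ?T" using m by auto
  qed
qed

end

context abelian_presentation
begin

text \<open>
  The map \<open>\<phi>\<close> from \<open>F\<close> through \<open>Q\<close> to \<open>E\<close> is onto because its image contains \<open>[E,E] = M\<close> and
  covers \<open>G\<close>. Counting shows that an element of \<open>D\<close> killed by \<open>\<phi>\<close> lies in \<open>L\<close>, which makes \<open>W\<close>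
  the kernel of \<open>(a,b) \<mapsto> (\<phi> a, \<phi> b)\<close> modulo the antidiagonal.
\<close>
theorem K2_tilde_iso_cover_subquotient:
  assumes fin: "finite (carrier G)" and odd: "odd (order G)" and cover: "is_cover G E p"
  shows "KT \<cong> cover_subquotient E (kernel E G p)"
proof -
  let ?M = "kernel E G p"
  have "central_extension E G p"
    using cover G.comm_group_axioms
    by (intro central_extension.intro central_extension_axioms.intro) (auto simp: is_cover_def)
  then interpret E: central_extension E G p .
  obtain \<psi> where \<psi>: "\<psi> \<in> hom Q E" and over: "\<And>c. c \<in> carrier Q \<Longrightarrow> p (\<psi> c) = q' c"
    using universal[OF E.central_extension_axioms] by metis
  interpret \<psi>: group_hom Q E \<psi>
    using \<psi> group_Q E.E.is_group by (simp add: group_hom_def group_hom_axioms_def)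
  let ?A = "derived Q (carrier Q)"
  have "?M = derived E (carrier E)"
    using cover E.derived_subset_kernel by (auto simp: is_cover_def)
  then have img: "\<psi> ` ?A = ?M"
    using E.derived_covered_by_lift[OF central_extension_Q \<psi> over] by simp
  have "card ?M = card ?A"
  proof -
    have "card ?M = card (carrier (schur_multiplier G))"
      using cover iso_same_card[of "E\<lparr>carrier := ?M\<rparr>" "schur_multiplier G"] by (simp add: is_cover_def)
    also have "\<dots> = card ?A"
      using iso_same_card[OF derived_iso_schur_multiplier[OF fin odd]] by simp
    finally show ?thesis .
  qed
  then have inj: "inj_on \<psi> ?A"
    using img Q.finite_derived[OF fin] by (intro eq_card_imp_inj_on) simp_all
  define \<phi> where "\<phi> x = \<psi> (q x)" for x
  have \<phi>: "\<phi> \<in> hom F E"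
    unfolding \<phi>_def using hom_compose[OF q.homh \<psi>] by (simp add: comp_def)
  interpret \<phi>: group_hom F E \<phi>
    using \<phi> F.is_group E.E.is_group by (simp add: group_hom_def group_hom_axioms_def)
  have p\<phi>: "p (\<phi> x) = \<pi> x" if "x \<in> carrier F" for x
    using over[of "q x"] q'(2)[OF that] that by (simp add: \<phi>_def)
  have \<phi>N: "\<phi> x \<in> ?M \<longleftrightarrow> x \<in> N" if "x \<in> carrier F" for x
    using that p\<phi>[OF that] by (simp add: E.kernel_iff N_iff)
  have \<phi>D: "\<phi> ` D = ?M"
    using img unfolding q_image_D[symmetric] by (simp add: image_image \<phi>_def)
  have \<phi>1: "q d = \<one>\<^bsub>Q\<^esub>" if "d \<in> D" "\<phi> d = \<one>\<^bsub>E\<^esub>" for d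
  proof -
    have "q d \<in> ?A" "\<one>\<^bsub>Q\<^esub> \<in> ?A"
      using that q_image_D subgroup.one_closed[OF q.H.derived_is_subgroup[OF subset_refl]] by auto
    moreover have "\<psi> (q d) = \<psi> \<one>\<^bsub>Q\<^esub>" using that by (simp add: \<phi>_def)
    ultimately show ?thesis by (meson inj inj_onD)
  qed
  have \<phi>_surj: "\<exists>b \<in> carrier F. \<phi> b = e" if e: "e \<in> carrier E" for e
  proof -
    have "p e \<in> \<pi> ` carrier F" using e by (simp add: \<pi>_surj)
    then obtain x where x: "x \<in> carrier F" "p e = \<pi> x" by auto
    then have "e \<otimes>\<^bsub>E\<^esub> inv\<^bsub>E\<^esub> \<phi> x \<in> ?M" using e p\<phi>[OF x(1)] by (simp add: E.kernel_iff)
    then obtain d where d: "d \<in> D" "\<phi> d = e \<otimes>\<^bsub>E\<^esub> inv\<^bsub>E\<^esub> \<phi> x"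
      unfolding \<phi>D[symmetric] by (metis imageE)
    then have "\<phi> (d \<otimes>\<^bsub>F\<^esub> x) = e" using DF x e by (simp add: E.E.m_assoc)
    then show ?thesis using d DF x by (intro bexI[of _ "d \<otimes>\<^bsub>F\<^esub> x"]) simp_all
  qed
  let ?S = "cover_subgroup E ?M" and ?T = "antidiagonal E ?M"
  let ?SE = "(E \<times>\<times> E)\<lparr>carrier := ?S\<rparr>"
  have S_iff: "(g, k) \<in> ?S \<longleftrightarrow> g \<in> carrier E \<and> k \<in> carrier E \<and> g \<otimes>\<^bsub>E\<^esub> k \<in> ?M" for g k
    by (simp add: E.cover_subgroup_eq)
  have T_iff: "(g, k) \<in> ?T \<longleftrightarrow> g \<in> ?M \<and> k = inv\<^bsub>E\<^esub> g" for g k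
    by (auto simp: E.antidiagonal_eq)
  have S: "subgroup ?S (E \<times>\<times> E)"
    unfolding cover_subgroup_def
    by (rule group.generate_is_subgroup[OF E.E.group_square]) (auto simp: E.kernel_iff)
  have TS: "?T \<subseteq> ?S"
    using subgroup.one_closed[OF E.subgroup_kernel] by (auto simp: E.antidiagonal_eq S_iff E.kernel_iff)
  have SE: "group ?SE" by (rule group.subgroup_imp_group[OF E.E.group_square S])
  have T: "?T \<lhd> ?SE"
    by (rule group.normal_restrict_supergroup[OF E.E.group_square S E.antidiagonal_normal TS])
  have CQ: "cover_subquotient E ?M = ?SE Mod ?T" by (simp add: cover_subquotient_def)
  have gCQ: "group (?SE Mod ?T)" by (rule normal.factorgroup_is_group[OF T])
  let ?\<Theta> = "\<lambda>u. ?T #>\<^bsub>?SE\<^esub> (case u of (a, b) \<Rightarrow> (\<phi> a, \<phi> b))"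
  have "(\<lambda>(a, b). (\<phi> a, \<phi> b)) \<in> hom KF ?SE"
  proof (rule homI)
    fix u assume "u \<in> carrier KF"
    then obtain a b where u: "u = (a, b)" "a \<in> carrier F" "b \<in> carrier F" "a \<otimes>\<^bsub>F\<^esub> b \<in> D"
      by (cases u) (simp add: F.K2_iff)
    have "\<phi> (a \<otimes>\<^bsub>F\<^esub> b) \<in> ?M" using u \<phi>D by blast
    then show "(case u of (a, b) \<Rightarrow> (\<phi> a, \<phi> b)) \<in> carrier ?SE" using u by (simp add: S_iff)
  next
    fix u v assume "u \<in> carrier KF" "v \<in> carrier KF"
    then show "(case u \<otimes>\<^bsub>KF\<^esub> v of (a, b) \<Rightarrow> (\<phi> a, \<phi> b)) =
        (case u of (a, b) \<Rightarrow> (\<phi> a, \<phi> b)) \<otimes>\<^bsub>?SE\<^esub> (case v of (a, b) \<Rightarrow> (\<phi> a, \<phi> b))"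
      by (cases u; cases v) (simp add: F.K2_iff)
  qed
  then have \<Theta>: "?\<Theta> \<in> hom KF (?SE Mod ?T)"
    using hom_compose[OF _ normal.r_coset_hom_Mod[OF T]] by (simp add: comp_def)
  interpret \<Theta>: group_hom KF "?SE Mod ?T" ?\<Theta>
    using group_KF gCQ \<Theta> by (simp add: group_hom_def group_hom_axioms_def)
  have surj: "?\<Theta> ` carrier KF = carrier (?SE Mod ?T)"
  proof (intro equalityI subsetI)
    fix X assume "X \<in> carrier (?SE Mod ?T)"
    then obtain g k where X: "X = ?T #>\<^bsub>?SE\<^esub> (g, k)" and gk: "g \<in> carrier E" "k \<in> carrier E" "g \<otimes>\<^bsub>E\<^esub> k \<in> ?M"
      by (auto simp: carrier_FactGroup S_iff)
    obtain b where b: "b \<in> carrier F" "\<phi> b = k" using \<phi>_surj gk by blast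
    obtain d where d: "d \<in> D" "\<phi> d = g \<otimes>\<^bsub>E\<^esub> k"
      using gk(3) unfolding \<phi>D[symmetric] by (metis imageE)
    \<comment> \<open>lifting \<open>(g,k)\<close> entrywise would only give a product in \<open>N\<close>, so the first entry is corrected\<close>
    let ?u = "(d \<otimes>\<^bsub>F\<^esub> inv\<^bsub>F\<^esub> b, b)"
    have "?u \<in> K2 F" using b d DF by (simp add: F.K2_iff F.m_assoc)
    moreover have "(\<phi> (d \<otimes>\<^bsub>F\<^esub> inv\<^bsub>F\<^esub> b), \<phi> b) = (g, k)"
      using b d DF gk by (simp add: E.E.m_assoc)
    ultimately show "X \<in> ?\<Theta> ` carrier KF"
      unfolding X by (intro image_eqI[of _ _ ?u]) simp_all
  qed (use \<Theta>.hom_closed in blast)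
  have ker: "kernel KF (?SE Mod ?T) ?\<Theta> = W"
  proof -
    have coset_iff: "?\<Theta> (a, b) = ?T \<longleftrightarrow> (a, b) \<in> W" if ab: "(a, b) \<in> K2 F" for a b
    proof -
      have F: "a \<in> carrier F" "b \<in> carrier F" "a \<otimes>\<^bsub>F\<^esub> b \<in> D" using ab by (simp_all add: F.K2_iff)
      have mem: "(\<phi> a, \<phi> b) \<in> carrier ?SE"
        using F \<phi>D imageI[OF F(3), of \<phi>] by (simp add: S_iff)
      have T_coset: "?\<Theta> (a, b) = ?T \<longleftrightarrow> (\<phi> a, \<phi> b) \<in> ?T"
        unfolding prod.case
        using group.coset_join1[OF SE _ mem normal_imp_subgroup[OF T]]
          group.coset_join2[OF SE mem normal_imp_subgroup[OF T]] by blast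
      have "\<phi> (a \<otimes>\<^bsub>F\<^esub> b) = \<phi> a \<otimes>\<^bsub>E\<^esub> \<phi> b" "inv\<^bsub>E\<^esub> \<phi> a \<otimes>\<^bsub>E\<^esub> \<one>\<^bsub>E\<^esub> = inv\<^bsub>E\<^esub> \<phi> a"
        using F by simp_all
      then have inv_iff: "\<phi> b = inv\<^bsub>E\<^esub> \<phi> a \<longleftrightarrow> \<phi> (a \<otimes>\<^bsub>F\<^esub> b) = \<one>\<^bsub>E\<^esub>"
        using E.E.inv_solve_left[of "\<phi> b" "\<phi> a" "\<one>\<^bsub>E\<^esub>"] F(1,2) \<phi>.hom_closed E.E.one_closed by metis
      have one_iff: "\<phi> (a \<otimes>\<^bsub>F\<^esub> b) = \<one>\<^bsub>E\<^esub> \<longleftrightarrow> q (a \<otimes>\<^bsub>F\<^esub> b) = \<one>\<^bsub>Q\<^esub>"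
        using \<phi>1[OF F(3)] \<psi>.hom_one unfolding \<phi>_def by metis
      have q_mult: "q (a \<otimes>\<^bsub>F\<^esub> b) = q a \<otimes>\<^bsub>Q\<^esub> q b" using F by simp
      show ?thesis
        unfolding T_coset T_iff \<phi>N[OF F(1)] inv_iff one_iff q_mult W_iff
        using h_shift(1)[OF ab] by blast
    qed
    show ?thesis
    proof (rule Set.set_eqI)
      fix u :: "'f \<times> 'f"
      obtain a b where u: "u = (a, b)" by (cases u)
      have "u \<in> kernel KF (?SE Mod ?T) ?\<Theta> \<longleftrightarrow> u \<in> K2 F \<and> ?\<Theta> u = ?T"
        unfolding kernel_def[of KF] one_FactGroup by simp
      then show "u \<in> kernel KF (?SE Mod ?T) ?\<Theta> \<longleftrightarrow> u \<in> W"
        using coset_iff[of a b] subsetD[OF W_subset_K2, of u] unfolding u by blast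
    qed
  qed
  show ?thesis
    unfolding CQ KT_eq using \<Theta>.FactGroup_iso[OF surj] unfolding ker .
qed

end

theorem theorem4p4:
  fixes G :: "('g, 'n) monoid_scheme"
    and F :: "('f, 'm) monoid_scheme"
    and \<pi> :: "'f \<Rightarrow> 'g"
  assumes "comm_group G" and "finite (carrier G)" and "odd (order G)"
    and "presentation F \<pi> G"
  shows "is_cover G (K2_tilde F \<pi> G) (K2_tilde_proj \<pi>) \<and>
         (\<forall>(E :: ('e, 'k) monoid_scheme) p. is_cover G E p \<longrightarrow>
            K2_tilde F \<pi> G \<cong> cover_subquotient E (kernel E G p))"
proof -
  have F: "free_group F" and \<pi>: "\<pi> \<in> epi F G" using assms(4) by (simp_all add: presentation_def)
  interpret abelian_presentation F G \<pi>
    using F \<pi> assms(1)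
    by (simp add: abelian_presentation_def abelian_presentation_axioms_def group_hom_def
        group_hom_axioms_def epi_def free_group_def comm_group.axioms(2))
  show ?thesis
    using K2_tilde_is_cover[OF assms(2,3)] K2_tilde_iso_cover_subquotient[OF assms(2,3)] by blast
qed

end
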